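(* Let $G$ be a Lie group, $M$ a smooth $G$-manifold, $\{U_i\}$ a $G$-invariant open cover of $M$, and $\{\phi_{ij}:U_i\cap U_j\to G\}$ a $\star$-collection. Let $\pi:P\to M$ be the principal $G$-bundle associated to $\{\phi_{ij}\}$. Then $P$ admits a new action $\star:G\times P\to P$ such that: (i) $\star$ is free and commutes with the principal action of $\pi$; (ii) the quotient $P/\star$ is a $G$-manifold which is $G$-equivariantly diffeomorphic to $$M':=\bigcup_{\widehat\phi_{ij}}U_i,$$ where the $G$-action on each $U_i$ is the restriction of the $G$-action on $M$.
   Context: $\star$-collection: a family of smooth maps $\phi_{ij}:U_i\cap U_j\to G$, indexed by pairs of members of a cover of $M$ by $G$-invariant open sets $U_i$, satisfying the cocycle condition $\phi_{ij}\phi_{jk}\phi_{ki}(x)=\phi_{ii}(x)=\mathrm{id}$ for $x\in U_i\cap U_j\cap U_k$, and $\phi_{ij}(g\cdot x)=g\,\phi_{ij}(x)\,g^{-1}$ for all $i,j$, $g\in G$, $x\in U_i\cap U_j$. Adjoint map: $\widehat\phi_{ij}:U_i\cap U_j\to U_i\cap U_j$, $\widehat\phi_{ij}(x)=\phi_{ij}(x)\cdot x$ (these are $G$-equivariant diffeomorphisms). Gluing notation: for bijections $f_{ij}:A_i\to A_j$ between subsets $A_i\subset X_i$, $A_j\subset X_j$, satisfying the cocycle compatibility, $\bigcup_{f_{ij}}X_i$ denotes the quotient of the disjoint union of the $X_i$ by identifying $x\in A_i\subset X_i$ with $f_{ij}(x)\in A_j\subset X_j$. Thus $M'$ is obtained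 from the disjoint union of the $U_i$ by identifying $x\in U_i\cap U_j\subset U_i$ with $\widehat\phi_{ij}(x)\in U_i\cap U_j\subset U_j$; the $G$-actions on the $U_i$ patch to a $G$-action on $M'$. Associated principal bundle: $P$ is the union of the $U_i\times G$ glued by $(x,g)\in (U_i\cap U_j)\times G\subset U_i\times G$ identified with $(x,g\phi_{ij}(x))\in U_j\times G$; $\pi(x,g)=x$; the principal action is written $(s,p)\mapsto ps^{-1}$ and is given on $U_i\times G$ by $(x,g)s^{-1}=(x,sg)$. The $G$-action on $P/\star$ is the one induced by the principal action of $\pi$.
   Formalization: P/⋆ (equivalently M') can fail to be Hausdorff for noncompact G, so "P/⋆ is a G-manifold" is proved without the Hausdorff property in general, and with it when G is compact or M/G is Hausdorff; M and G are assumed Hausdorff and second countable. *)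

theory Defs
  imports "HOL-Analysis.Analysis" "HOL-Algebra.Group_Action"
begin

section \<open>Smooth functions on open subsets of finite-dimensional vector spaces\<close>

text \<open>Only used for open \<open>S\<close> in a finite-dimensional space; there, all directional derivatives
  being of class \<open>C\<^sup>k\<close> is the same as the derivative being of class \<open>C\<^sup>k\<close>.\<close>

primrec Ck_on :: "nat \<Rightarrow> 'a::real_normed_vector set \<Rightarrow> ('a \<Rightarrow> 'b::real_normed_vector) \<Rightarrow> bool" where
  "Ck_on 0 S f \<longleftrightarrow> continuous_on S f"
| "Ck_on (Suc k) S f \<longleftrightarrow> (\<forall>x\<in>S. f differentiable (at x)) \<and>
     (\<forall>v. Ck_on k S (\<lambda>x. frechet_derivative f (at x) v))"

definition smooth_on :: "'a::real_normed_vector set \<Rightarrow> ('a \<Rightarrow> 'b::real_normed_vector) \<Rightarrow> bool" where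
  "smooth_on S f \<longleftrightarrow> (\<forall>k. Ck_on k S f)"


section \<open>Smooth manifolds\<close>

text \<open>A space with an atlas; a chart is a pair of its domain and its coordinate map (whose values
  off the domain are irrelevant). Atlases are not required to be maximal: the smooth structure is
  the one generated by the atlas.

  The model space \<open>'e\<close> is an arbitrary normed space that \<open>smooth_premanifold\<close> requires to be of
  finite dimension. The class \<open>euclidean_space\<close> is not used because it excludes dimension
  zero, i.e. discrete groups.\<close>

record ('a, 'e) smooth_space =
  mtop :: "'a topology"
  charts :: "('a set \<times> ('a \<Rightarrow> 'e)) set"

abbreviation points :: "('a, 'e, 'z) smooth_space_scheme \<Rightarrow> 'a set" where
  "points M \<equiv> topspace (mtop M)"

definition second_countable_space :: "'a topology \<Rightarrow> bool" where
  "second_countable_space X \<longleftrightarrow>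
     (\<exists>\<B>. countable \<B> \<and> (\<forall>B\<in>\<B>. openin X B) \<and>
          (\<forall>W x. openin X W \<and> x \<in> W \<longrightarrow> (\<exists>B\<in>\<B>. x \<in> B \<and> B \<subseteq> W)))"

definition smooth_atlas :: "'a topology \<Rightarrow> ('a set \<times> ('a \<Rightarrow> 'e::real_normed_vector)) set \<Rightarrow> bool" where
  "smooth_atlas X A \<longleftrightarrow>
     (\<forall>(U, c)\<in>A. openin X U \<and> open (c ` U) \<and>
        homeomorphic_map (subtopology X U) (top_of_set (c ` U)) c) \<and>
     (\<Union>(U, c)\<in>A. U) = topspace X \<and>
     (\<forall>(U, c)\<in>A. \<forall>(V, d)\<in>A. smooth_on (c ` (U \<inter> V)) (d \<circ> inv_into U c))"

text \<open>A premanifold is a smooth manifold except that it may fail to be Hausdorff. For a noncompact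
  group, gluing along adjoint maps can destroy the Hausdorff property: let the reals act on the
  punctured plane by \<open>t\<cdot>(x, y) = (exp t * x, exp (-t) * y)\<close>, with the cover \<open>U 1 = {y \<noteq> 0}\<close>,
  \<open>U 2 = {x \<noteq> 0}\<close> and \<open>\<phi> 1 2 (x, y) = - ln \<bar>x * y\<bar>\<close>; then \<open>(0, 1)\<close> in \<open>U 1\<close> and \<open>(1, 0)\<close> in \<open>U 2\<close>
  cannot be separated.\<close>

definition smooth_premanifold :: "('a, 'e::real_normed_vector) smooth_space \<Rightarrow> bool" where
  "smooth_premanifold M \<longleftrightarrow>
     (\<exists>B::'e set. finite B \<and> span B = UNIV) \<and>
     second_countable_space (mtop M) \<and> smooth_atlas (mtop M) (charts M)"

definition smooth_manifold :: "('a, 'e::real_normed_vector) smooth_space \<Rightarrow> bool" where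
  "smooth_manifold M \<longleftrightarrow> smooth_premanifold M \<and> Hausdorff_space (mtop M)"

definition open_submanifold :: "('a, 'e) smooth_space \<Rightarrow> 'a set \<Rightarrow> ('a, 'e) smooth_space" where
  "open_submanifold M W =
     \<lparr>mtop = subtopology (mtop M) W, charts = (\<lambda>(U, c). (U \<inter> W, c)) ` charts M\<rparr>"

definition product_manifold ::
  "('a, 'e) smooth_space \<Rightarrow> ('b, 'f) smooth_space \<Rightarrow> ('a \<times> 'b, 'e \<times> 'f) smooth_space" where
  "product_manifold M N =
     \<lparr>mtop = prod_topology (mtop M) (mtop N),
      charts = {(U \<times> V, map_prod c d) | U c V d. (U, c) \<in> charts M \<and> (V, d) \<in> charts N}\<rparr>"

definition smooth_map ::
  "('a, 'e::real_normed_vector) smooth_space \<Rightarrow> ('b, 'f::real_normed_vector) smooth_space \<Rightarrow>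
   ('a \<Rightarrow> 'b) \<Rightarrow> bool" where
  "smooth_map M N f \<longleftrightarrow> continuous_map (mtop M) (mtop N) f \<and>
     (\<forall>(U, c)\<in>charts M. \<forall>(V, d)\<in>charts N.
        smooth_on (c ` (U \<inter> f -` V)) (d \<circ> f \<circ> inv_into U c))"

definition submersion ::
  "('a, 'e::real_normed_vector) smooth_space \<Rightarrow> ('b, 'f::real_normed_vector) smooth_space \<Rightarrow>
   ('a \<Rightarrow> 'b) \<Rightarrow> bool" where
  "submersion M N f \<longleftrightarrow> smooth_map M N f \<and>
     (\<forall>(U, c)\<in>charts M. \<forall>(V, d)\<in>charts N. \<forall>p\<in>U \<inter> f -` V.
        surj (frechet_derivative (d \<circ> f \<circ> inv_into U c) (at (c p))))"

definition diffeomorphism ::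
  "('a, 'e::real_normed_vector) smooth_space \<Rightarrow> ('b, 'f::real_normed_vector) smooth_space \<Rightarrow>
   ('a \<Rightarrow> 'b) \<Rightarrow> bool" where
  "diffeomorphism M N f \<longleftrightarrow> bij_betw f (points M) (points N) \<and>
     smooth_map M N f \<and> smooth_map N M (inv_into (points M) f)"


section \<open>Lie groups and smooth actions\<close>

definition lie_group :: "'g monoid \<Rightarrow> ('g, 'f::real_normed_vector) smooth_space \<Rightarrow> bool" where
  "lie_group G \<G> \<longleftrightarrow> group G \<and> carrier G = points \<G> \<and> smooth_manifold \<G> \<and>
     smooth_map (product_manifold \<G> \<G>) \<G> (\<lambda>(g, h). g \<otimes>\<^bsub>G\<^esub> h) \<and>
     smooth_map \<G> \<G> (\<lambda>g. inv\<^bsub>G\<^esub> g)"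

text \<open>Following the library's \<open>group_action\<close>, each \<open>act g\<close> is extensional, i.e. undefined
  outside the points of \<open>M\<close>.\<close>

definition smooth_action ::
  "'g monoid \<Rightarrow> ('g, 'f::real_normed_vector) smooth_space \<Rightarrow>
   ('a, 'e::real_normed_vector) smooth_space \<Rightarrow> ('g \<Rightarrow> 'a \<Rightarrow> 'a) \<Rightarrow> bool" where
  "smooth_action G \<G> M act \<longleftrightarrow> group_action G (points M) act \<and>
     smooth_map (product_manifold \<G> M) M (\<lambda>(g, x). act g x)"

definition free_action :: "'g monoid \<Rightarrow> 'a set \<Rightarrow> ('g \<Rightarrow> 'a \<Rightarrow> 'a) \<Rightarrow> bool" where
  "free_action G X act \<longleftrightarrow> (\<forall>g\<in>carrier G. \<forall>x\<in>X. act g x = x \<longrightarrow> g = \<one>\<^bsub>G\<^esub>)"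

definition G_premanifold ::
  "'g monoid \<Rightarrow> ('g, 'f::real_normed_vector) smooth_space \<Rightarrow>
   ('a, 'e::real_normed_vector) smooth_space \<Rightarrow> ('g \<Rightarrow> 'a \<Rightarrow> 'a) \<Rightarrow> bool" where
  "G_premanifold G \<G> M act \<longleftrightarrow> smooth_premanifold M \<and> smooth_action G \<G> M act"

definition G_manifold ::
  "'g monoid \<Rightarrow> ('g, 'f::real_normed_vector) smooth_space \<Rightarrow>
   ('a, 'e::real_normed_vector) smooth_space \<Rightarrow> ('g \<Rightarrow> 'a \<Rightarrow> 'a) \<Rightarrow> bool" where
  "G_manifold G \<G> M act \<longleftrightarrow> smooth_manifold M \<and> smooth_action G \<G> M act"

definition equivariant ::
  "'g monoid \<Rightarrow> 'a set \<Rightarrow> ('g \<Rightarrow> 'a \<Rightarrow> 'a) \<Rightarrow> ('g \<Rightarrow> 'b \<Rightarrow> 'b) \<Rightarrow> ('a \<Rightarrow> 'b) \<Rightarrow> bool" where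
  "equivariant G X act act' f \<longleftrightarrow> (\<forall>g\<in>carrier G. \<forall>x\<in>X. f (act g x) = act' g (f x))"

text \<open>The principal action is written as a left action \<open>(s, p) \<mapsto> p s\<^sup>-\<^sup>1\<close>, so that the fibre
  of a local trivialisation \<open>t\<close> carries left translation.\<close>

definition principal_bundle ::
  "'g monoid \<Rightarrow> ('g, 'f::real_normed_vector) smooth_space \<Rightarrow>
   ('p, 'k::real_normed_vector) smooth_space \<Rightarrow> ('a, 'e::real_normed_vector) smooth_space \<Rightarrow>
   ('p \<Rightarrow> 'a) \<Rightarrow> ('g \<Rightarrow> 'p \<Rightarrow> 'p) \<Rightarrow> bool" where
  "principal_bundle G \<G> P M proj pact \<longleftrightarrow>
     smooth_manifold P \<and> smooth_manifold M \<and> smooth_map P M proj \<and> smooth_action G \<G> P pact \<and>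
     (\<forall>x\<in>points M. \<exists>V t. openin (mtop M) V \<and> x \<in> V \<and>
        diffeomorphism (product_manifold (open_submanifold M V) \<G>)
          (open_submanifold P (points P \<inter> proj -` V)) t \<and>
        (\<forall>y\<in>V. \<forall>g\<in>carrier G. proj (t (y, g)) = y \<and>
           (\<forall>s\<in>carrier G. t (y, s \<otimes>\<^bsub>G\<^esub> g) = pact s (t (y, g)))))"


section \<open>Quotients and gluing\<close>

text \<open>\<open>C\<close> is a partition of the underlying set of \<open>X\<close>; the open sets are those with open
  preimage in \<open>X\<close>.\<close>

definition quotient_topology :: "'a topology \<Rightarrow> 'a set set \<Rightarrow> 'a set topology" where
  "quotient_topology X C = topology (\<lambda>\<U>. \<U> \<subseteq> C \<and> openin X (\<Union>\<U>))"

lemma openin_quotient_topology: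
  assumes "disjoint C"
  shows "openin (quotient_topology X C) \<U> \<longleftrightarrow> \<U> \<subseteq> C \<and> openin X (\<Union>\<U>)"
proof -
  have Int: "\<Union>(S \<inter> T) = \<Union>S \<inter> \<Union>T" if "S \<subseteq> C" "T \<subseteq> C" for S T
  proof (rule antisym)
    show "\<Union>S \<inter> \<Union>T \<subseteq> \<Union>(S \<inter> T)"
    proof
      fix x assume "x \<in> \<Union>S \<inter> \<Union>T"
      then obtain s t where st: "s \<in> S" "x \<in> s" "t \<in> T" "x \<in> t" by auto
      then have "s \<in> C" "t \<in> C" using that by auto
      then have "s = t" using assms st unfolding disjoint_def by (metis IntI emptyE)
      then show "x \<in> \<Union>(S \<inter> T)" using st by auto
    qed
  qed auto
  have Un: "\<Union>(\<Union>\<K>) = \<Union>(Union ` \<K>)" for \<K> :: "'a set set set"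
    by auto
  have "istopology (\<lambda>\<U>. \<U> \<subseteq> C \<and> openin X (\<Union>\<U>))"
    unfolding istopology_def
  proof (intro conjI allI impI)
    fix S T assume S: "S \<subseteq> C \<and> openin X (\<Union>S)" and T: "T \<subseteq> C \<and> openin X (\<Union>T)"
    show "S \<inter> T \<subseteq> C" using S by (metis le_infI1)
    show "openin X (\<Union>(S \<inter> T))" using S T by (metis Int openin_Int)
  next
    fix \<K> assume K: "\<forall>K\<in>\<K>. K \<subseteq> C \<and> openin X (\<Union>K)"
    then show "\<Union>\<K> \<subseteq> C" by (metis Union_least)
    have "openin X (\<Union>(Union ` \<K>))" using K by (intro openin_Union) (metis imageE)
    then show "openin X (\<Union>(\<Union>\<K>))" by (metis Un)
  qed
  then show ?thesis by (simp add: quotient_topology_def)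
qed

text \<open>Gluing of \<open>X i\<close>, \<open>i \<in> I\<close>: the point \<open>x\<close> of \<open>A i j\<close>, seen in \<open>X i\<close>, is identified with
  \<open>f i j x\<close>, seen in \<open>X j\<close>.\<close>

definition glue_equiv ::
  "'i set \<Rightarrow> ('i \<Rightarrow> 'i \<Rightarrow> 'a set) \<Rightarrow> ('i \<Rightarrow> 'i \<Rightarrow> 'a \<Rightarrow> 'a) \<Rightarrow> (('i \<times> 'a) \<times> ('i \<times> 'a)) set" where
  "glue_equiv I A f =
     {(u, v). equivclp (\<lambda>(i, x) (j, y). i \<in> I \<and> j \<in> I \<and> x \<in> A i j \<and> y = f i j x) u v}"

text \<open>The chart \<open>(V, c)\<close> of \<open>X i\<close> becomes a chart of the glued space whose domain consists of
  the classes that have a (necessarily unique) representative in \<open>V\<close>.\<close>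

definition glue ::
  "'i set \<Rightarrow> ('i \<Rightarrow> ('a, 'e) smooth_space) \<Rightarrow> ('i \<Rightarrow> 'i \<Rightarrow> 'a set) \<Rightarrow> ('i \<Rightarrow> 'i \<Rightarrow> 'a \<Rightarrow> 'a) \<Rightarrow>
   (('i \<times> 'a) set, 'e) smooth_space" where
  "glue I X A f =
     \<lparr>mtop = quotient_topology (sum_topology (\<lambda>i. mtop (X i)) I)
        ((SIGMA i:I. points (X i)) // glue_equiv I A f),
      charts = {((\<lambda>x. glue_equiv I A f `` {(i, x)}) ` V, \<lambda>p. c (THE x. (i, x) \<in> p)) | i V c.
        i \<in> I \<and> (V, c) \<in> charts (X i)}\<rparr>"

text \<open>The action on a glued space \<open>N\<close> that acts by \<open>a\<close> on every piece. If \<open>a\<close> preserves the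
  pieces and commutes with the gluing maps, the image of a class is again a class.\<close>

definition patched_action ::
  "('i \<times> 'a) set set \<Rightarrow> ('g \<Rightarrow> 'a \<Rightarrow> 'a) \<Rightarrow> 'g \<Rightarrow> ('i \<times> 'a) set \<Rightarrow> ('i \<times> 'a) set" where
  "patched_action N a g = (\<lambda>p\<in>N. (\<lambda>(i, x). (i, a g x)) ` p)"

text \<open>The action induced on a set \<open>C\<close> of orbits of another action that commutes with \<open>a\<close>.\<close>

definition induced_action :: "'a set set \<Rightarrow> ('g \<Rightarrow> 'a \<Rightarrow> 'a) \<Rightarrow> 'g \<Rightarrow> 'a set \<Rightarrow> 'a set" where
  "induced_action C a g = (\<lambda>c\<in>C. a g ` c)"


section \<open>Star-collections\<close>

definition invariant_open_cover ::
  "'g monoid \<Rightarrow> ('a, 'e) smooth_space \<Rightarrow> ('g \<Rightarrow> 'a \<Rightarrow> 'a) \<Rightarrow> 'i set \<Rightarrow> ('i \<Rightarrow> 'a set) \<Rightarrow> bool" where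
  "invariant_open_cover G M act I U \<longleftrightarrow>
     (\<forall>i\<in>I. openin (mtop M) (U i) \<and> (\<forall>g\<in>carrier G. \<forall>x\<in>U i. act g x \<in> U i)) \<and>
     (\<Union>i\<in>I. U i) = points M"

definition star_collection ::
  "'g monoid \<Rightarrow> ('g, 'f::real_normed_vector) smooth_space \<Rightarrow>
   ('a, 'e::real_normed_vector) smooth_space \<Rightarrow> ('g \<Rightarrow> 'a \<Rightarrow> 'a) \<Rightarrow> 'i set \<Rightarrow> ('i \<Rightarrow> 'a set) \<Rightarrow>
   ('i \<Rightarrow> 'i \<Rightarrow> 'a \<Rightarrow> 'g) \<Rightarrow> bool" where
  "star_collection G \<G> M act I U \<phi> \<longleftrightarrow>
     (\<forall>i\<in>I. \<forall>j\<in>I. smooth_map (open_submanifold M (U i \<inter> U j)) \<G> (\<phi> i j)) \<and>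
     (\<forall>i\<in>I. \<forall>j\<in>I. \<forall>k\<in>I. \<forall>x\<in>U i \<inter> U j \<inter> U k.
        \<phi> i j x \<otimes>\<^bsub>G\<^esub> \<phi> j k x \<otimes>\<^bsub>G\<^esub> \<phi> k i x = \<phi> i i x \<and> \<phi> i i x = \<one>\<^bsub>G\<^esub>) \<and>
     (\<forall>i\<in>I. \<forall>j\<in>I. \<forall>g\<in>carrier G. \<forall>x\<in>U i \<inter> U j.
        \<phi> i j (act g x) = g \<otimes>\<^bsub>G\<^esub> \<phi> i j x \<otimes>\<^bsub>G\<^esub> inv\<^bsub>G\<^esub> g)"

definition adjoint_map ::
  "('g \<Rightarrow> 'a \<Rightarrow> 'a) \<Rightarrow> ('i \<Rightarrow> 'i \<Rightarrow> 'a \<Rightarrow> 'g) \<Rightarrow> 'i \<Rightarrow> 'i \<Rightarrow> 'a \<Rightarrow> 'a" where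
  "adjoint_map act \<phi> i j x = act (\<phi> i j x) x"

definition star_space ::
  "('a, 'e) smooth_space \<Rightarrow> ('g \<Rightarrow> 'a \<Rightarrow> 'a) \<Rightarrow> 'i set \<Rightarrow> ('i \<Rightarrow> 'a set) \<Rightarrow>
   ('i \<Rightarrow> 'i \<Rightarrow> 'a \<Rightarrow> 'g) \<Rightarrow> (('i \<times> 'a) set, 'e) smooth_space" where
  "star_space M act I U \<phi> =
     glue I (\<lambda>i. open_submanifold M (U i)) (\<lambda>i j. U i \<inter> U j) (adjoint_map act \<phi>)"

definition star_bundle ::
  "'g monoid \<Rightarrow> ('g, 'f) smooth_space \<Rightarrow> ('a, 'e) smooth_space \<Rightarrow> 'i set \<Rightarrow> ('i \<Rightarrow> 'a set) \<Rightarrow>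
   ('i \<Rightarrow> 'i \<Rightarrow> 'a \<Rightarrow> 'g) \<Rightarrow> (('i \<times> 'a \<times> 'g) set, 'e \<times> 'f) smooth_space" where
  "star_bundle G \<G> M I U \<phi> =
     glue I (\<lambda>i. product_manifold (open_submanifold M (U i)) \<G>)
       (\<lambda>i j. (U i \<inter> U j) \<times> carrier G) (\<lambda>i j (x, g). (x, g \<otimes>\<^bsub>G\<^esub> \<phi> i j x))"

definition star_proj :: "('i \<times> 'a \<times> 'g) set \<Rightarrow> 'a" where
  "star_proj p = (THE x. \<exists>i g. (i, x, g) \<in> p)"

text \<open>\<open>(s, p) \<mapsto> p s\<^sup>-\<^sup>1\<close>, which is \<open>(x, g) \<mapsto> (x, s g)\<close> on \<open>U i \<times> G\<close>.\<close>

definition star_principal_action ::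
  "'g monoid \<Rightarrow> ('i \<times> 'a \<times> 'g) set set \<Rightarrow> 'g \<Rightarrow> ('i \<times> 'a \<times> 'g) set \<Rightarrow> ('i \<times> 'a \<times> 'g) set" where
  "star_principal_action G P = patched_action P (\<lambda>s (x, g). (x, s \<otimes>\<^bsub>G\<^esub> g))"

end

theory Submission
  imports Defs
begin

text \<open>On \<open>U i \<times> G\<close> the star action is \<open>t \<star> (x, g) = (t x, g t\<^sup>-\<^sup>1)\<close>. Because
  \<open>\<phi> i j (t x) = t \<phi> i j x t\<^sup>-\<^sup>1\<close>, it is compatible with the identification of \<open>(x, g)\<close> and
  \<open>(x, g \<phi> i j x)\<close>, and it clearly commutes with left translation of \<open>g\<close>. Its orbits are the
  fibres of \<open>\<Phi> : P \<rightarrow> M'\<close>, \<open>(x, g) \<mapsto> g x\<close>, which is well defined since \<open>(x, g \<phi> i j x)\<close> is mapped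
  to \<open>g \<phi> i j x x = \<phi> i j (g x) (g x)\<close>, and which turns left translation into the action on \<open>M'\<close>.
  The local sections \<open>y \<mapsto> (g\<^sup>-\<^sup>1 y, g)\<close> show that \<open>\<Phi>\<close> is open and a submersion, so \<open>P/\<star>\<close> is
  homeomorphic to \<open>M'\<close> and inherits its charts. As the adjoint maps preserve orbits, there is a
  continuous map \<open>M' \<rightarrow> M/G\<close>, and points with the same image have representatives in a
  common Hausdorff piece \<open>U i\<close>; so \<open>M'\<close> is Hausdorff whenever \<open>M/G\<close> is.\<close>


section \<open>Calculus of smooth functions\<close>

text \<open>The shape of the star action has a simple origin: on \<open>U i \<times> G\<close> the
  shear that sends \<open>(x, g)\<close> to \<open>(g x, g)\<close> turns the star action of
  \<open>t\<close> into \<open>(y, g) \<mapsto> (y, g t\<^sup>-\<^sup>1)\<close>. So star moves the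
  second factor alone, which makes it free, and forgetting that factor leaves the piece
  \<open>U i\<close> of \<open>M'\<close>.

  The orbit space may fail to be Hausdorff, so a quotient theorem for proper free actions is no
  help. The charts of \<open>P/\<star>\<close> are therefore taken over from \<open>M'\<close>,
  whose own charts come directly from the gluing, and no slices are constructed.

  Two features of the definitions shape the preparatory work. Smoothness is phrased by iterated
  directional derivatives on an arbitrary finite-dimensional normed space, so the chain rule needs
  bounded coordinates of that space. Atlases are not maximal, so every map has to be controlled in
  all pairs of given charts. The gluing itself is treated abstractly because it is needed both for
  \<open>P\<close> and for \<open>M'\<close>, and patched actions are needed for three different
  formulas.\<close>

text \<open>On an open set the derivative at a point depends only on nearby values, so equality on
  \<open>S\<close> passes to the directional derivatives. Both functions vary in the induction
  because it is applied to those derivatives.\<close>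

lemma Ck_on_cong:
  assumes "open S" "\<And>x. x \<in> S \<Longrightarrow> f x = g x" "Ck_on k S f"
  shows "Ck_on k S g"
  using assms(2,3)
proof (induction k arbitrary: f g)
  case 0
  then show ?case by (simp cong: continuous_on_cong)
next
  case (Suc k)
  have D: "(f has_derivative F) (at x) \<longleftrightarrow> (g has_derivative F) (at x)" if "x \<in> S" for F x
    using Suc.prems(1) that
    by (metis assms(1) has_derivative_transform_within_open)
  have "g differentiable (at x)" if "x \<in> S" for x
    using Suc.prems(2) D that by (auto simp: differentiable_def)
  moreover have "frechet_derivative f (at x) = frechet_derivative g (at x)" if "x \<in> S" for x
    using D that by (simp add: frechet_derivative_def)
  then have "Ck_on k S (\<lambda>x. frechet_derivative g (at x) v)" for v
    using Suc.IH[of "\<lambda>x. frechet_derivative f (at x) v" "\<lambda>x. frechet_derivative g (at x) v"]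
      Suc.prems(2) by auto
  ultimately show ?case by auto
qed

lemma Ck_on_subset: "Ck_on k S f \<Longrightarrow> T \<subseteq> S \<Longrightarrow> Ck_on k T f"
  by (induction k arbitrary: f) (auto intro: continuous_on_subset)

lemma Ck_on_local:
  assumes "\<And>x. x \<in> S \<Longrightarrow> \<exists>T. open T \<and> x \<in> T \<and> Ck_on k T f"
  shows "Ck_on k S f"
  using assms
proof (induction k arbitrary: f)
  case 0
  then have "\<forall>x\<in>S. isCont f x"
    by (metis Ck_on.simps(1) continuous_on_eq_continuous_at)
  then show ?case by (simp add: continuous_at_imp_continuous_on)
next
  case (Suc k)
  have "Ck_on k S (\<lambda>x. frechet_derivative f (at x) v)" for v
  proof (rule Suc.IH)
    fix x assume "x \<in> S"
    then show "\<exists>T. open T \<and> x \<in> T \<and> Ck_on k T (\<lambda>x. frechet_derivative f (at x) v)"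
      using Suc.prems by fastforce
  qed
  moreover have "f differentiable (at x)" if "x \<in> S" for x
    using Suc.prems[OF that] by auto
  ultimately show ?case by auto
qed

text \<open>Only the bottom level has content: differentiability gives continuity. Higher levels
  apply the induction hypothesis to the directional derivatives.\<close>

lemma Ck_on_Suc_imp: "Ck_on (Suc k) S f \<Longrightarrow> Ck_on k S f"
proof (induction k arbitrary: f)
  case 0
  then have "f differentiable_on S"
    by (auto simp: differentiable_on_def intro: differentiable_at_withinI)
  then show ?case by (simp add: differentiable_imp_continuous_on)
next
  case (Suc k)
  then show ?case by (metis Ck_on.simps(2))
qed

text \<open>\<open>Ck_on\<close> refers to the chosen \<open>frechet_derivative\<close>; uniqueness
  of derivatives lets an explicit formula \<open>f'\<close> stand in for it. Each calculus rule
  below then only has to exhibit its formula.\<close>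

lemma Ck_on_SucI:
  assumes "open S" "\<And>x. x \<in> S \<Longrightarrow> (f has_derivative f' x) (at x)"
    and "\<And>v. Ck_on k S (\<lambda>x. f' x v)"
  shows "Ck_on (Suc k) S f"
proof -
  have "frechet_derivative f (at x) = f' x" if "x \<in> S" for x
    using assms(2)[OF that] frechet_derivative_at by metis
  then have "Ck_on k S (\<lambda>x. frechet_derivative f (at x) v)" for v
    using Ck_on_cong[OF assms(1), of "\<lambda>x. f' x v"] assms(3) by auto
  then show ?thesis using assms(2) by (auto simp: differentiable_def)
qed

lemma Ck_on_SucD:
  assumes "Ck_on (Suc k) S f" "x \<in> S"
  shows "(f has_derivative frechet_derivative f (at x)) (at x)"
  using assms by (simp add: frechet_derivative_works)

lemma Ck_on_const: "open S \<Longrightarrow> Ck_on k S (\<lambda>x. c)"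
proof (induction k arbitrary: c)
  case (Suc k)
  show ?case by (rule Ck_on_SucI[where f' = "\<lambda>_ _. 0"]) (use Suc in auto)
qed simp

lemma Ck_on_bounded_linear:
  assumes "bounded_linear h" "open S"
  shows "Ck_on k S f \<Longrightarrow> Ck_on k S (\<lambda>x. h (f x))"
proof (induction k arbitrary: f)
  case 0
  then show ?case using assms by (simp add: bounded_linear.continuous_on)
next
  case (Suc k)
  show ?case
  proof (rule Ck_on_SucI[OF assms(2)])
    show "((\<lambda>x. h (f x)) has_derivative (\<lambda>v. h (frechet_derivative f (at x) v))) (at x)"
      if "x \<in> S" for x
      using bounded_linear.has_derivative[OF assms(1) Ck_on_SucD[OF Suc.prems that]] .
    show "Ck_on k S (\<lambda>x. h (frechet_derivative f (at x) v))" for v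
      using Suc by simp
  qed
qed

lemma Ck_on_add:
  assumes "open S"
  shows "Ck_on k S f \<Longrightarrow> Ck_on k S g \<Longrightarrow> Ck_on k S (\<lambda>x. f x + g x)"
proof (induction k arbitrary: f g)
  case 0
  then show ?case by (simp add: continuous_on_add)
next
  case (Suc k)
  show ?case
  proof (rule Ck_on_SucI[OF assms])
    show "((\<lambda>x. f x + g x) has_derivative
      (\<lambda>v. frechet_derivative f (at x) v + frechet_derivative g (at x) v)) (at x)" if "x \<in> S" for x
      by (intro has_derivative_add Ck_on_SucD[OF Suc.prems(1) that] Ck_on_SucD[OF Suc.prems(2) that])
    show "Ck_on k S (\<lambda>x. frechet_derivative f (at x) v + frechet_derivative g (at x) v)" for v
      using Suc by simp
  qed
qed

lemma Ck_on_sum: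
  assumes "open S" "finite B" "\<And>b. b \<in> B \<Longrightarrow> Ck_on k S (f b)"
  shows "Ck_on k S (\<lambda>x. \<Sum>b\<in>B. f b x)"
  using assms(2,3)
  by (induction B rule: finite_induct) (auto intro: Ck_on_const Ck_on_add assms(1))

text \<open>Each summand of the product rule keeps one factor undifferentiated;
  \<open>Ck_on_Suc_imp\<close> lowers that factor to level \<open>k\<close>. Since the other factor
  has become a derivative, \<open>r\<close> and \<open>f\<close> both vary in the induction.\<close>

lemma Ck_on_scaleR:
  fixes r :: "'a::real_normed_vector \<Rightarrow> real"
  assumes "open S"
  shows "Ck_on k S r \<Longrightarrow> Ck_on k S f \<Longrightarrow> Ck_on k S (\<lambda>x. r x *\<^sub>R f x)"
proof (induction k arbitrary: r f)
  case 0
  then show ?case by (simp add: continuous_on_scaleR)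
next
  case (Suc k)
  show ?case
  proof (rule Ck_on_SucI[OF assms])
    show "((\<lambda>x. r x *\<^sub>R f x) has_derivative
      (\<lambda>v. r x *\<^sub>R frechet_derivative f (at x) v + frechet_derivative r (at x) v *\<^sub>R f x)) (at x)"
      if "x \<in> S" for x
      by (intro has_derivative_scaleR Ck_on_SucD[OF Suc.prems(1) that] Ck_on_SucD[OF Suc.prems(2) that])
    show "Ck_on k S
      (\<lambda>x. r x *\<^sub>R frechet_derivative f (at x) v + frechet_derivative r (at x) v *\<^sub>R f x)" for v
      using Suc Ck_on_Suc_imp[OF Suc.prems(1)] Ck_on_Suc_imp[OF Suc.prems(2)]
      by (intro Ck_on_add[OF assms] Suc.IH) auto
  qed
qed

lemma Ck_on_Pair:
  assumes "open S" "Ck_on k S f" "Ck_on k S g"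
  shows "Ck_on k S (\<lambda>x. (f x, g x))"
proof -
  have "bounded_linear (\<lambda>x. (x, 0))" "bounded_linear (\<lambda>y. (0, y))"
    by (auto intro: bounded_linear_Pair bounded_linear_ident bounded_linear_zero)
  then have "Ck_on k S (\<lambda>x. (f x, 0) + (0, g x))"
    using assms Ck_on_bounded_linear[of "\<lambda>x. (x, 0)" S k f]
      Ck_on_bounded_linear[of "\<lambda>x. (0, x)" S k g]
    by (intro Ck_on_add) auto
  then show ?thesis by simp
qed

section \<open>Bounded coordinates in finite-dimensional normed spaces\<close>

text \<open>This is the equivalence of the given norm with the sum norm of coefficients, and the
  source of bounded coordinate functionals. The bound for \<open>B\<close> makes
  \<open>span B\<close> closed, so a new independent vector \<open>a\<close> has positive distance
  from it; that distance controls the coefficient of \<open>a\<close>, and thereby the remaining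
  ones.\<close>

lemma independent_coefficients_bounded:
  fixes B :: "'a::real_normed_vector set"
  assumes "finite B" "independent B"
  shows "\<exists>C. \<forall>u. (\<Sum>b\<in>B. \<bar>u b\<bar>) \<le> C * norm (\<Sum>b\<in>B. u b *\<^sub>R b)"
  using assms
proof (induction B rule: finite_induct)
  case empty
  then show ?case by simp
next
  case (insert a B)
  have ind: "independent B" and a: "a \<notin> span B"
    using insert.prems insert.hyps by (auto simp: independent_insert)
  obtain C0 where C0: "\<And>u. (\<Sum>b\<in>B. \<bar>u b\<bar>) \<le> C0 * norm (\<Sum>b\<in>B. u b *\<^sub>R b)"
    using insert.IH[OF ind] by auto
  \<comment> \<open>The constant from the induction hypothesis may be zero or negative, as for empty
    \<open>B\<close>. It is enlarged because \<open>C\<close> is used as a divisor below.\<close>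
  define C where "C = \<bar>C0\<bar> + 1"
  have C: "C > 0" "\<And>u. (\<Sum>b\<in>B. \<bar>u b\<bar>) \<le> C * norm (\<Sum>b\<in>B. u b *\<^sub>R b)"
  proof -
    show "C > 0" by (simp add: C_def)
    show "(\<Sum>b\<in>B. \<bar>u b\<bar>) \<le> C * norm (\<Sum>b\<in>B. u b *\<^sub>R b)" for u
      by (rule order_trans[OF C0 mult_right_mono]) (auto simp: C_def)
  qed
  \<comment> \<open>Were the distance zero, points \<open>w n\<close> of \<open>span B\<close> would
    converge to \<open>a\<close>. The bound makes their coefficients Cauchy sequences, and the
    limits of these would express \<open>a\<close> by \<open>B\<close>.\<close>
  have "\<exists>\<delta>>0. \<forall>w\<in>span B. \<delta> \<le> norm (a - w)"
  proof (rule ccontr)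
    assume "\<not> ?thesis"
    moreover have "inverse (real (Suc n)) > 0" for n by simp
    ultimately have "\<exists>w\<in>span B. norm (a - w) < inverse (real (Suc n))" for n
      by (meson not_le)
    then obtain w where w: "\<And>n. w n \<in> span B" "\<And>n. norm (a - w n) < inverse (real (Suc n))"
      by metis
    have "\<exists>u. w n = (\<Sum>b\<in>B. u b *\<^sub>R b)" for n
      using w(1)[of n] span_finite[OF insert.hyps(1)] by auto
    then obtain u where u: "\<And>n. w n = (\<Sum>b\<in>B. u n b *\<^sub>R b)" by metis
    have lim: "w \<longlonglongrightarrow> a"
    proof -
      have "(\<lambda>n. norm (a - w n)) \<longlonglongrightarrow> 0"
        by (rule tendsto_sandwich[OF _ _ tendsto_const LIMSEQ_inverse_real_of_nat])
          (use w(2) in \<open>auto intro!: always_eventually less_imp_le\<close>)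
      then show ?thesis
        by (simp add: tendsto_iff dist_norm norm_minus_commute)
    qed
    then have Cau: "Cauchy w" by (rule LIMSEQ_imp_Cauchy)
    have "Cauchy (\<lambda>n. u n b)" if "b \<in> B" for b
    proof (rule metric_CauchyI)
      fix e :: real assume "e > 0"
      then obtain N where N: "\<And>m n. m \<ge> N \<Longrightarrow> n \<ge> N \<Longrightarrow> dist (w m) (w n) < e / C"
        using metric_CauchyD[OF Cau, of "e / C"] C(1) by auto
      have "dist (u m b) (u n b) < e" if mn: "m \<ge> N" "n \<ge> N" for m n
      proof -
        have "\<bar>u m b - u n b\<bar> \<le> (\<Sum>b\<in>B. \<bar>u m b - u n b\<bar>)"
          using \<open>b \<in> B\<close> insert.hyps(1) by (intro member_le_sum) auto
        also have "\<dots> \<le> C * norm (w m - w n)"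
          using C(2)[of "\<lambda>b. u m b - u n b"]
          by (simp add: u scaleR_left_diff_distrib sum_subtractf)
        also have "\<dots> < e"
          using N[OF mn] C(1) by (simp add: dist_norm field_simps)
        finally show ?thesis by (simp add: dist_norm)
      qed
      then show "\<exists>M. \<forall>m\<ge>M. \<forall>n\<ge>M. dist (u m b) (u n b) < e" by blast
    qed
    then have "\<exists>l. (\<lambda>n. u n b) \<longlonglongrightarrow> l" if "b \<in> B" for b
      using that Cauchy_convergent_iff convergent_def by blast
    then obtain l where l: "\<And>b. b \<in> B \<Longrightarrow> (\<lambda>n. u n b) \<longlonglongrightarrow> l b" by metis
    have "w \<longlonglongrightarrow> (\<Sum>b\<in>B. l b *\<^sub>R b)"
      unfolding u[abs_def] by (intro tendsto_intros l)
    then have "a = (\<Sum>b\<in>B. l b *\<^sub>R b)" using lim LIMSEQ_unique by blast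
    then have "a \<in> span B" by (auto intro: span_sum span_scale span_base)
    then show False using a by simp
  qed
  then obtain \<delta> where \<delta>: "\<delta> > 0" "\<And>w. w \<in> span B \<Longrightarrow> \<delta> \<le> norm (a - w)" by auto
  \<comment> \<open>With \<open>v\<close> the whole sum and \<open>w\<close> its part over
    \<open>B\<close>, the constant combines \<open>\<bar>u a\<bar> \<le> norm v / \<delta>\<close>
    with \<open>C\<close> times the estimate
    \<open>norm w \<le> (1 + norm a / \<delta>) * norm v\<close>.\<close>
  have "(\<Sum>b\<in>insert a B. \<bar>u b\<bar>) \<le> (1/\<delta> + C * (1 + norm a / \<delta>)) * norm (\<Sum>b\<in>insert a B. u b *\<^sub>R b)"
    for u
  proof -
    define w where "w = (\<Sum>b\<in>B. u b *\<^sub>R b)"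
    define v where "v = u a *\<^sub>R a + w"
    have w: "w \<in> span B" unfolding w_def by (auto intro: span_sum span_scale span_base)
    have 1: "\<bar>u a\<bar> * \<delta> \<le> norm v"
    proof (cases "u a = 0")
      case False
      have "v = u a *\<^sub>R (a - (- inverse (u a)) *\<^sub>R w)"
        using False by (simp add: v_def scaleR_right_diff_distrib scaleR_add_right)
      then have "norm v = \<bar>u a\<bar> * norm (a - (- inverse (u a)) *\<^sub>R w)"
        by (simp only: norm_scaleR)
      then show ?thesis
        using mult_left_mono[OF \<delta>(2)[OF span_scale[OF w]] abs_ge_zero] by (simp only:)
    qed simp
    then have 2: "\<bar>u a\<bar> \<le> norm v / \<delta>" using \<delta>(1) by (simp add: field_simps)
    have "norm w \<le> norm v + norm (u a *\<^sub>R a)"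
      using norm_triangle_ineq4[of v "u a *\<^sub>R a"] by (simp add: v_def)
    also have "\<dots> \<le> norm v + norm v / \<delta> * norm a"
      using mult_right_mono[OF 2 norm_ge_zero[of a]] by simp
    finally have "C * norm w \<le> C * (norm v + norm v / \<delta> * norm a)"
      using C(1) by (simp add: mult_left_mono)
    moreover have "(\<Sum>b\<in>B. \<bar>u b\<bar>) \<le> C * norm w" using C(2) by (simp add: w_def)
    ultimately have "\<bar>u a\<bar> + (\<Sum>b\<in>B. \<bar>u b\<bar>) \<le> norm v / \<delta> + C * (norm v + norm v / \<delta> * norm a)"
      using 2 by linarith
    also have "\<dots> = (1/\<delta> + C * (1 + norm a / \<delta>)) * norm v"
      by (simp add: algebra_simps add_divide_distrib)
    finally show ?thesis using insert.hyps by (simp add: v_def w_def)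
  qed
  then show ?case by blast
qed

text \<open>The finite spanning set demanded by \<open>smooth_premanifold\<close>, as a property of
  the model type alone, so that the calculus can assume it without mentioning a manifold.\<close>

definition finite_dimensional :: "'a::real_normed_vector itself \<Rightarrow> bool" where
  "finite_dimensional _ \<longleftrightarrow> (\<exists>B::'a set. finite B \<and> span B = UNIV)"

text \<open>A maximal independent subset of a finite spanning set is a basis. What matters is that
  its coordinate functionals are bounded, so that applying them preserves
  \<open>Ck_on\<close>.\<close>

lemma finite_dimensional_coordinates:
  assumes "finite_dimensional TYPE('a::real_normed_vector)"
  shows "\<exists>(B::'a set) \<rho>. finite B \<and> (\<forall>b\<in>B. bounded_linear (\<rho> b)) \<and> (\<forall>v. (\<Sum>b\<in>B. \<rho> b v *\<^sub>R b) = v)"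
proof -
  obtain B0 :: "'a set" where B0: "finite B0" "span B0 = UNIV"
    using assms unfolding finite_dimensional_def by blast
  obtain B where B: "B \<subseteq> B0" "independent B" "B0 \<subseteq> span B"
    using maximal_independent_subset by blast
  have fin: "finite B" using B(1) B0(1) finite_subset by blast
  have sp: "span B = UNIV" using span_mono[OF B(3)] B0(2) by (simp add: span_span top_unique)
  define \<rho> where "\<rho> = (\<lambda>b v. representation B v b)"
  have rep: "(\<Sum>b\<in>B. \<rho> b v *\<^sub>R b) = v" for v
    using sum_representation_eq[OF B(2) _ fin order_refl, of v] sp by (simp add: \<rho>_def)
  obtain C where C: "\<And>u. (\<Sum>b\<in>B. \<bar>u b\<bar>) \<le> C * norm (\<Sum>b\<in>B. u b *\<^sub>R b)"
    using independent_coefficients_bounded[OF fin B(2)] by auto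
  have "bounded_linear (\<rho> b)" if "b \<in> B" for b
  proof (rule bounded_linear_intro)
    show "\<rho> b (x + y) = \<rho> b x + \<rho> b y" for x y
      using representation_add[OF B(2), of y x] sp by (simp add: \<rho>_def)
    show "\<rho> b (r *\<^sub>R x) = r *\<^sub>R \<rho> b x" for r x
      using representation_scale[OF B(2), of x r] sp by (simp add: \<rho>_def)
    show "norm (\<rho> b x) \<le> norm x * C" for x
    proof -
      have "\<bar>\<rho> b x\<bar> \<le> (\<Sum>b\<in>B. \<bar>\<rho> b x\<bar>)" using that fin by (intro member_le_sum) auto
      then show ?thesis using C[of "\<lambda>b. \<rho> b x"] by (simp add: rep mult.commute)
    qed
  qed
  then show ?thesis using fin rep by blast
qed

text \<open>In the derivative \<open>g' (f x) (f' x v)\<close> the direction fed to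
  \<open>g'\<close> varies with \<open>x\<close>, while \<open>Ck_on\<close> controls
  \<open>g'\<close> only for a fixed direction. Expanding the direction in a finite basis gives a
  sum of products of scalar functions and derivatives in fixed directions, to which the induction
  hypothesis applies. This is where finite dimension enters.\<close>

lemma Ck_on_compose:
  fixes f :: "'a::real_normed_vector \<Rightarrow> 'b::real_normed_vector"
    and g :: "'b \<Rightarrow> 'c::real_normed_vector"
  assumes "finite_dimensional TYPE('b)" "open S" "f ` S \<subseteq> T"
  shows "Ck_on k T g \<Longrightarrow> Ck_on k S f \<Longrightarrow> Ck_on k S (\<lambda>x. g (f x))"
proof (induction k arbitrary: g)
  case 0
  then show ?case using assms(3) continuous_on_compose2 by auto
next
  case (Suc k)
  obtain B and \<rho> :: "'b \<Rightarrow> 'b \<Rightarrow> real" where B: "finite B"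
    and \<rho>: "\<And>b. b \<in> B \<Longrightarrow> bounded_linear (\<rho> b)" "\<And>v. (\<Sum>b\<in>B. \<rho> b v *\<^sub>R b) = v"
    using finite_dimensional_coordinates[OF assms(1)] by auto
  let ?f' = "\<lambda>x. frechet_derivative f (at x)" and ?g' = "\<lambda>y. frechet_derivative g (at y)"
  have expand: "?g' (f x) w = (\<Sum>b\<in>B. \<rho> b w *\<^sub>R ?g' (f x) b)" if "x \<in> S" for x w
  proof -
    have lin: "linear (?g' (f x))"
      by (rule has_derivative_linear[OF Ck_on_SucD[OF Suc.prems(1)]]) (use assms(3) that in auto)
    have "?g' (f x) w = ?g' (f x) (\<Sum>b\<in>B. \<rho> b w *\<^sub>R b)" by (simp only: \<rho>(2))
    also have "\<dots> = (\<Sum>b\<in>B. \<rho> b w *\<^sub>R ?g' (f x) b)"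
      by (simp only: linear_sum[OF lin] linear_scale[OF lin])
    finally show ?thesis .
  qed
  show ?case
  proof (rule Ck_on_SucI[OF assms(2)])
    show "((\<lambda>x. g (f x)) has_derivative (\<lambda>v. ?g' (f x) (?f' x v))) (at x)" if "x \<in> S" for x
    proof -
      have "f x \<in> T" using assms(3) that by auto
      then show ?thesis
        using diff_chain_at[OF Ck_on_SucD[OF Suc.prems(2) that] Ck_on_SucD[OF Suc.prems(1)]]
        by (simp add: o_def)
    qed
    show "Ck_on k S (\<lambda>x. ?g' (f x) (?f' x v))" for v
    proof (rule Ck_on_cong[OF assms(2)])
      show "(\<Sum>b\<in>B. \<rho> b (?f' x v) *\<^sub>R ?g' (f x) b) = ?g' (f x) (?f' x v)" if "x \<in> S" for x
        by (rule expand[OF that, symmetric])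
      show "Ck_on k S (\<lambda>x. \<Sum>b\<in>B. \<rho> b (?f' x v) *\<^sub>R ?g' (f x) b)"
      proof (intro Ck_on_sum[OF assms(2) B] Ck_on_scaleR[OF assms(2)])
        fix b assume b: "b \<in> B"
        show "Ck_on k S (\<lambda>x. \<rho> b (?f' x v))"
          using Suc.prems(2) by (intro Ck_on_bounded_linear[OF \<rho>(1)[OF b] assms(2)]) simp
        show "Ck_on k S (\<lambda>x. ?g' (f x) b)"
          using Suc.prems(1) by (intro Suc.IH Ck_on_Suc_imp[OF Suc.prems(2)]) simp
      qed
    qed
  qed
qed

section \<open>Rules for smooth functions\<close>

lemma smooth_on_cong:
  "open S \<Longrightarrow> (\<And>x. x \<in> S \<Longrightarrow> f x = g x) \<Longrightarrow> smooth_on S f \<Longrightarrow> smooth_on S g"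
  unfolding smooth_on_def by (metis Ck_on_cong)

lemma smooth_on_subset: "smooth_on S f \<Longrightarrow> T \<subseteq> S \<Longrightarrow> smooth_on T f"
  unfolding smooth_on_def by (metis Ck_on_subset)

lemma smooth_on_local:
  "(\<And>x. x \<in> S \<Longrightarrow> \<exists>T. open T \<and> x \<in> T \<and> smooth_on T f) \<Longrightarrow> smooth_on S f"
  unfolding smooth_on_def by (metis Ck_on_local)

lemma smooth_on_compose:
  fixes f :: "'a::real_normed_vector \<Rightarrow> 'b::real_normed_vector"
  assumes "finite_dimensional TYPE('b)" "open S" "f ` S \<subseteq> T" "smooth_on T g" "smooth_on S f"
  shows "smooth_on S (\<lambda>x. g (f x))"
  using Ck_on_compose[OF assms(1-3)] assms(4,5) unfolding smooth_on_def by blast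

lemma smooth_on_const: "open S \<Longrightarrow> smooth_on S (\<lambda>x. c)"
  by (simp add: smooth_on_def Ck_on_const)

lemma smooth_on_Pair:
  "open S \<Longrightarrow> smooth_on S f \<Longrightarrow> smooth_on S g \<Longrightarrow> smooth_on S (\<lambda>x. (f x, g x))"
  by (simp add: smooth_on_def Ck_on_Pair)

lemma smooth_on_bounded_linear:
  assumes "bounded_linear h" "open S"
  shows "smooth_on S h"
proof -
  have "Ck_on k S (\<lambda>x. x)" for k
  proof (cases k)
    case (Suc n)
    show ?thesis unfolding Suc
      by (rule Ck_on_SucI[OF assms(2)]) (auto intro: has_derivative_ident Ck_on_const assms(2))
  qed (simp add: continuous_on_id)
  then show ?thesis using Ck_on_bounded_linear[OF assms] by (simp add: smooth_on_def)
qed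

lemma smooth_on_has_derivative:
  "smooth_on S f \<Longrightarrow> x \<in> S \<Longrightarrow> (f has_derivative frechet_derivative f (at x)) (at x)"
  using Ck_on_SucD[of 0 S f x] unfolding smooth_on_def by blast


section \<open>Smooth maps\<close>

lemma continuous_map_locally:
  assumes "\<And>x. x \<in> topspace X \<Longrightarrow> \<exists>W. openin X W \<and> x \<in> W \<and> continuous_map (subtopology X W) Y f"
  shows "continuous_map X Y f"
  unfolding continuous_map_def
proof (intro conjI allI impI)
  show "f \<in> topspace X \<rightarrow> topspace Y"
  proof
    fix x assume "x \<in> topspace X"
    then obtain W where "x \<in> W" "x \<in> topspace X" "continuous_map (subtopology X W) Y f"
      using assms by blast
    then show "f x \<in> topspace Y" by (auto simp: continuous_map_def)
  qed
  fix V assume V: "openin Y V"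
  show "openin X {x \<in> topspace X. f x \<in> V}"
  proof (subst openin_subopen, intro ballI)
    fix x assume x: "x \<in> {x \<in> topspace X. f x \<in> V}"
    then obtain W where W: "openin X W" "x \<in> W" "continuous_map (subtopology X W) Y f"
      using assms by blast
    have "openin (subtopology X W) {x \<in> topspace (subtopology X W). f x \<in> V}"
      using W(3) V by (rule openin_continuous_map_preimage)
    then have "openin X {x \<in> topspace (subtopology X W). f x \<in> V}"
      using W(1) openin_trans_full by blast
    then show "\<exists>T. openin X T \<and> x \<in> T \<and> T \<subseteq> {x \<in> topspace X. f x \<in> V}"
      using x W(2) by (intro exI[of _ "{x \<in> topspace (subtopology X W). f x \<in> V}"]) auto
  qed
qed

lemma finite_dimensional_prod:
  assumes "finite_dimensional TYPE('a::real_normed_vector)"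
    and "finite_dimensional TYPE('b::real_normed_vector)"
  shows "finite_dimensional TYPE('a \<times> 'b)"
proof -
  obtain A :: "'a set" and B :: "'b set"
    where A: "finite A" "span A = UNIV" and B: "finite B" "span B = UNIV"
    using assms by (auto simp: finite_dimensional_def)
  let ?C = "(\<lambda>a. (a, 0)) ` A \<union> (\<lambda>b. (0, b)) ` B"
  have "(x, 0) \<in> span ?C" for x :: 'a
  proof -
    have "linear (\<lambda>a::'a. (a, 0::'b))" by (intro linearI) auto
    then have "(\<lambda>a. (a, 0)) ` span A = span ((\<lambda>a. (a, 0::'b)) ` A)"
      by (simp add: linear_span_image)
    then show ?thesis using A(2) span_mono[of "(\<lambda>a. (a, 0)) ` A" ?C] by auto
  qed
  moreover have "(0, y) \<in> span ?C" for y :: 'b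
  proof -
    have "linear (\<lambda>b::'b. (0::'a, b))" by (intro linearI) auto
    then have "(\<lambda>b. (0, b)) ` span B = span ((\<lambda>b. (0::'a, b)) ` B)"
      by (simp add: linear_span_image)
    then show ?thesis using B(2) span_mono[of "(\<lambda>b. (0, b)) ` B" ?C] by auto
  qed
  ultimately have "(x, 0) + (0, y) \<in> span ?C" for x :: 'a and y :: 'b
    by (intro span_add)
  then have "span ?C = UNIV" by auto
  then show ?thesis using A(1) B(1) unfolding finite_dimensional_def
    by (intro exI[of _ ?C]) auto
qed

lemma smooth_premanifold_finite_dimensional:
  "smooth_premanifold (M :: ('a, 'e::real_normed_vector) smooth_space) \<Longrightarrow> finite_dimensional TYPE('e)"
  by (simp add: smooth_premanifold_def finite_dimensional_def)

section \<open>Charts and atlases\<close>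

context
  fixes M :: "('a, 'e::real_normed_vector) smooth_space" and U c
  assumes M: "smooth_premanifold M" and Uc: "(U, c) \<in> charts M"
begin

lemma chart_openin: "openin (mtop M) U"
  and chart_open_image: "open (c ` U)"
  and chart_homeomorphic: "homeomorphic_map (subtopology (mtop M) U) (top_of_set (c ` U)) c"
  using M Uc by (auto simp: smooth_premanifold_def smooth_atlas_def)

lemma chart_subset: "U \<subseteq> points M"
  using chart_openin by (rule openin_subset)

lemma chart_inj: "inj_on c U"
  using homeomorphic_imp_injective_map[OF chart_homeomorphic] chart_subset by (simp add: inf.absorb2)

lemma chart_inv [simp]: "x \<in> U \<Longrightarrow> inv_into U c (c x) = x"
  using chart_inj by simp

lemma chart_continuous: "continuous_map (subtopology (mtop M) U) euclidean c"
  using homeomorphic_imp_continuous_map[OF chart_homeomorphic] continuous_map_into_fulltopology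
  by blast

lemma chart_openin_image:
  assumes "openin (mtop M) W" "W \<subseteq> U"
  shows "open (c ` W)"
proof -
  have "openin (subtopology (mtop M) U) W"
    using assms by (simp add: openin_open_subtopology[OF chart_openin])
  then have "openin (top_of_set (c ` U)) (c ` W)"
    using homeomorphic_imp_open_map[OF chart_homeomorphic] unfolding open_map_def by blast
  then show ?thesis using openin_open_trans[OF _ chart_open_image] by blast
qed

lemma chart_inv_continuous: "continuous_map (top_of_set (c ` U)) (mtop M) (inv_into U c)"
proof -
  obtain g where g: "homeomorphic_maps (subtopology (mtop M) U) (top_of_set (c ` U)) c g"
    using chart_homeomorphic homeomorphic_map_maps by blast
  then have "continuous_map (top_of_set (c ` U)) (mtop M) g"
    by (auto simp: homeomorphic_maps_def intro: continuous_map_into_fulltopology)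
  moreover have "g y = inv_into U c y" if "y \<in> topspace (top_of_set (c ` U))" for y
    using g that chart_subset by (auto simp: homeomorphic_maps_def)
  ultimately show ?thesis by (rule continuous_map_eq)
qed

lemma chart_transition:
  assumes Vd: "(V, d) \<in> charts M"
  shows "smooth_on (c ` (U \<inter> V)) (d \<circ> inv_into U c)"
proof -
  have "\<forall>(U, c)\<in>charts M. \<forall>(V, d)\<in>charts M. smooth_on (c ` (U \<inter> V)) (d \<circ> inv_into U c)"
    using M by (simp add: smooth_premanifold_def smooth_atlas_def)
  from bspec[OF this Uc, unfolded case_prod_conv, THEN bspec, OF Vd] show ?thesis by simp
qed

end

lemma chart_exists:
  assumes "smooth_premanifold M" "p \<in> points M"
  obtains U c where "(U, c) \<in> charts M" "p \<in> U"
proof -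
  have "p \<in> (\<Union>(U, c)\<in>charts M. U)"
    using assms by (simp add: smooth_premanifold_def smooth_atlas_def)
  then show ?thesis using that by auto
qed

text \<open>An injective, continuous and open map is a homeomorphism onto its image. The
  homeomorphism condition is thus split into three that can be checked separately for restricted,
  product, transported and glued charts.\<close>

lemma smooth_atlasI:
  assumes "\<And>U c. (U, c) \<in> A \<Longrightarrow> openin X U"
    and "\<And>U c. (U, c) \<in> A \<Longrightarrow> inj_on c U"
    and "\<And>U c. (U, c) \<in> A \<Longrightarrow> continuous_map (subtopology X U) euclidean c"
    and "\<And>U c W. (U, c) \<in> A \<Longrightarrow> openin X W \<Longrightarrow> W \<subseteq> U \<Longrightarrow> open (c ` W)"
    and "\<And>x. x \<in> topspace X \<Longrightarrow> \<exists>(U, c)\<in>A. x \<in> U"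
    and "\<And>U c V d. (U, c) \<in> A \<Longrightarrow> (V, d) \<in> A \<Longrightarrow> smooth_on (c ` (U \<inter> V)) (d \<circ> inv_into U c)"
  shows "smooth_atlas X A"
proof -
  have "homeomorphic_map (subtopology X U) (top_of_set (c ` U)) c" if Uc: "(U, c) \<in> A" for U c
  proof (rule bijective_open_imp_homeomorphic_map)
    have sub: "U \<subseteq> topspace X" using assms(1)[OF Uc] by (rule openin_subset)
    show "continuous_map (subtopology X U) (top_of_set (c ` U)) c"
      using assms(3)[OF Uc] by (auto simp: continuous_map_in_subtopology)
    show "open_map (subtopology X U) (top_of_set (c ` U)) c"
      unfolding open_map_def
    proof (intro allI impI)
      fix W assume W: "openin (subtopology X U) W"
      then have "openin X W" "W \<subseteq> U"
        using assms(1)[OF Uc] openin_trans_full openin_subset[OF W] by auto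
      then show "openin (top_of_set (c ` U)) (c ` W)"
        using assms(4)[OF Uc] by (auto intro: open_subset)
    qed
    show "c ` topspace (subtopology X U) = topspace (top_of_set (c ` U))"
      and "inj_on c (topspace (subtopology X U))"
      using sub assms(2)[OF Uc] by (auto simp: inf.absorb2)
  qed
  moreover have "open (c ` U)" if "(U, c) \<in> A" for U c
    using assms(1,4)[OF that] by blast
  moreover have "(\<Union>(U, c)\<in>A. U) = topspace X"
    using assms(1)[THEN openin_subset] assms(5) by fastforce
  ultimately show ?thesis using assms(1,6) unfolding smooth_atlas_def by fastforce
qed

section \<open>Criteria for smooth maps\<close>

lemma smooth_map_continuous: "smooth_map M N f \<Longrightarrow> continuous_map (mtop M) (mtop N) f"
  by (simp add: smooth_map_def)

lemma smooth_map_in_points: "smooth_map M N f \<Longrightarrow> x \<in> points M \<Longrightarrow> f x \<in> points N"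
  using smooth_map_continuous continuous_map_funspace by fastforce

lemma smooth_map_openin_preimage:
  "smooth_map M N f \<Longrightarrow> openin (mtop N) V \<Longrightarrow> openin (mtop M) {x \<in> points M. f x \<in> V}"
  using smooth_map_continuous openin_continuous_map_preimage by blast

lemma smooth_mapD:
  "smooth_map M N f \<Longrightarrow> (U, c) \<in> charts M \<Longrightarrow> (V, d) \<in> charts N \<Longrightarrow>
    smooth_on (c ` (U \<inter> f -` V)) (\<lambda>x. d (f (inv_into U c x)))"
  by (fastforce simp: smooth_map_def o_def)

text \<open>Transition maps are smooth, so one well-chosen pair of charts around each point decides
  smoothness in every pair. Continuity of \<open>f\<close> results from level 0 of
  \<open>smooth_on\<close>, because \<open>W\<close> is mapped into a single chart domain.\<close>

lemma smooth_mapI: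
  fixes M :: "('a, 'e::real_normed_vector) smooth_space"
    and N :: "('b, 'f::real_normed_vector) smooth_space"
  assumes M: "smooth_premanifold M" and N: "smooth_premanifold N"
    and loc: "\<And>p. p \<in> points M \<Longrightarrow> \<exists>U c V d W. (U, c) \<in> charts M \<and> (V, d) \<in> charts N \<and>
      openin (mtop M) W \<and> p \<in> W \<and> W \<subseteq> U \<and> f ` W \<subseteq> V \<and>
      smooth_on (c ` W) (\<lambda>x. d (f (inv_into U c x)))"
  shows "smooth_map M N f"
proof -
  note fd = M[THEN smooth_premanifold_finite_dimensional] N[THEN smooth_premanifold_finite_dimensional]
  have cont: "continuous_map (mtop M) (mtop N) f"
  proof (rule continuous_map_locally)
    fix p assume "p \<in> points M"
    then obtain U c V d W where *: "(U, c) \<in> charts M" "(V, d) \<in> charts N"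
      "openin (mtop M) W" "p \<in> W" "W \<subseteq> U" "f ` W \<subseteq> V"
      "smooth_on (c ` W) (\<lambda>x. d (f (inv_into U c x)))"
      using loc by blast
    have 1: "continuous_map (subtopology (mtop M) W) (top_of_set (c ` W)) c"
      using continuous_map_from_subtopology_mono[OF chart_continuous[OF M *(1)] *(5)]
      by (auto simp: continuous_map_in_subtopology)
    have "continuous_on (c ` W) (\<lambda>x. d (f (inv_into U c x)))"
      using *(7)[unfolded smooth_on_def, THEN spec[of _ 0]] by simp
    moreover have "(\<lambda>x. d (f (inv_into U c x))) ` (c ` W) \<subseteq> d ` V"
      using *(5,6) chart_inv[OF M *(1)] by (auto simp: subset_iff)
    ultimately have 2: "continuous_map (top_of_set (c ` W)) (top_of_set (d ` V))
        (\<lambda>x. d (f (inv_into U c x)))"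
      by (auto simp: continuous_map_in_subtopology)
    \<comment> \<open>Near \<open>p\<close> the map is recovered from its coordinate expression by
      composing with a chart before and an inverse chart after.\<close>
    have "continuous_map (subtopology (mtop M) W) (mtop N)
        (inv_into V d \<circ> (\<lambda>x. d (f (inv_into U c x))) \<circ> c)"
      using 1 2 chart_inv_continuous[OF N *(2)] by (intro continuous_map_compose)
    then have "continuous_map (subtopology (mtop M) W) (mtop N) f"
    proof (rule continuous_map_eq)
      fix x assume "x \<in> topspace (subtopology (mtop M) W)"
      then have "x \<in> U" "f x \<in> V" using *(5,6) by auto
      then show "(inv_into V d \<circ> (\<lambda>x. d (f (inv_into U c x))) \<circ> c) x = f x"
        using chart_inv[OF M *(1)] chart_inv[OF N *(2)] by simp
    qed
    then show "\<exists>W. openin (mtop M) W \<and> p \<in> W \<and> continuous_map (subtopology (mtop M) W) (mtop N) f"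
      using * by blast
  qed
  have "smooth_on (c' ` (U' \<inter> f -` V')) (d' \<circ> f \<circ> inv_into U' c')"
    if U': "(U', c') \<in> charts M" and V': "(V', d') \<in> charts N" for U' c' V' d'
  proof (rule smooth_on_local)
    fix z assume "z \<in> c' ` (U' \<inter> f -` V')"
    then obtain p where p: "p \<in> U'" "f p \<in> V'" "z = c' p" by auto
    then have "p \<in> points M" using chart_subset[OF M U'] by auto
    then obtain U c V d W where *: "(U, c) \<in> charts M" "(V, d) \<in> charts N"
      "openin (mtop M) W" "p \<in> W" "W \<subseteq> U" "f ` W \<subseteq> V"
      "smooth_on (c ` W) (\<lambda>x. d (f (inv_into U c x)))"
      using loc by blast
    \<comment> \<open>On \<open>T\<close> the given pair of charts and the pair supplied by
      \<open>loc\<close> are both available.\<close>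
    define T where "T = W \<inter> U' \<inter> {x \<in> points M. f x \<in> V'}"
    have T: "openin (mtop M) T" "p \<in> T"
      using *(3,4) p \<open>p \<in> points M\<close> chart_openin[OF M U'] chart_openin[OF N V'] cont
      unfolding T_def by (auto intro!: openin_Int openin_continuous_map_preimage)
    have TU: "x \<in> W" "x \<in> U'" "x \<in> U" "f x \<in> V'" "f x \<in> V" if "x \<in> T" for x
      using that *(5,6) by (auto simp: T_def)
    have op: "open (c' ` T)"
      using chart_openin_image[OF M U' T(1)] by (auto simp: T_def)
    have inv: "inv_into U' c' (c' x) = x" "inv_into U c (c x) = x" "inv_into V d (d (f x)) = f x"
      if "x \<in> T" for x
      using TU[OF that] chart_inv[OF M U'] chart_inv[OF M *(1)] chart_inv[OF N *(2)] by auto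
    have s1: "smooth_on (c' ` T) (\<lambda>x. c (inv_into U' c' x))"
      by (rule smooth_on_subset[OF chart_transition[OF M U' *(1), unfolded o_def]]) (use TU in blast)
    have s2: "smooth_on (c' ` T) (\<lambda>x. d (f (inv_into U c (c (inv_into U' c' x)))))"
      by (rule smooth_on_compose[OF fd(1) op _ *(7) s1]) (use TU inv in auto)
    \<comment> \<open>In the arbitrary pair of charts the map is the known expression with a
      transition map on either side.\<close>
    have "smooth_on (c' ` T) (\<lambda>x. d' (inv_into V d (d (f (inv_into U c (c (inv_into U' c' x)))))))"
      by (rule smooth_on_compose[OF fd(2) op _ chart_transition[OF N *(2) V', unfolded o_def] s2])
        (use TU inv in auto)
    then have "smooth_on (c' ` T) (d' \<circ> f \<circ> inv_into U' c')"
      by (rule smooth_on_cong[OF op, rotated]) (use inv in auto)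
    then show "\<exists>T. open T \<and> z \<in> T \<and> smooth_on T (d' \<circ> f \<circ> inv_into U' c')"
      using op T(2) p(3) by blast
  qed
  then show ?thesis using cont by (auto simp: smooth_map_def)
qed

lemma smooth_map_compose:
  fixes M :: "('a, 'e::real_normed_vector) smooth_space"
    and N :: "('b, 'f::real_normed_vector) smooth_space"
    and K :: "('c, 'g::real_normed_vector) smooth_space"
  assumes M: "smooth_premanifold M" and N: "smooth_premanifold N" and K: "smooth_premanifold K"
    and f: "smooth_map M N f" and g: "smooth_map N K g"
  shows "smooth_map M K (\<lambda>x. g (f x))"
proof (rule smooth_mapI[OF M K])
  fix p assume p: "p \<in> points M"
  obtain U c where U: "(U, c) \<in> charts M" "p \<in> U" using chart_exists[OF M p] .
  obtain V d where V: "(V, d) \<in> charts N" "f p \<in> V"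
    using chart_exists[OF N smooth_map_in_points[OF f p]] .
  obtain X e where X: "(X, e) \<in> charts K" "g (f p) \<in> X"
    using chart_exists[OF K smooth_map_in_points[OF g smooth_map_in_points[OF f p]]] .
  define V' where "V' = V \<inter> {y \<in> points N. g y \<in> X}"
  define W where "W = U \<inter> {x \<in> points M. f x \<in> V'}"
  have V': "openin (mtop N) V'"
    unfolding V'_def
    by (intro openin_Int chart_openin[OF N V(1)] smooth_map_openin_preimage[OF g] chart_openin[OF K X(1)])
  have W: "openin (mtop M) W" "p \<in> W" "W \<subseteq> U"
  proof -
    show "openin (mtop M) W"
      unfolding W_def
      by (intro openin_Int chart_openin[OF M U(1)] smooth_map_openin_preimage[OF f] V')
    show "p \<in> W" "W \<subseteq> U"
      using U V X p smooth_map_in_points[OF f p] by (auto simp: W_def V'_def)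
  qed
  have op: "open (c ` W)" using chart_openin_image[OF M U(1) W(1,3)] .
  have in_W: "x \<in> U" "f x \<in> V" "g (f x) \<in> X" if "x \<in> W" for x
    using that by (auto simp: W_def V'_def)
  have inv: "inv_into U c (c x) = x" "inv_into V d (d (f x)) = f x" if "x \<in> W" for x
    using in_W[OF that] chart_inv[OF M U(1)] chart_inv[OF N V(1)] by auto
  have s1: "smooth_on (c ` W) (\<lambda>x. d (f (inv_into U c x)))"
    by (rule smooth_on_subset[OF smooth_mapD[OF f U(1) V(1)]]) (use in_W in auto)
  have "smooth_on (c ` W) (\<lambda>x. e (g (inv_into V d (d (f (inv_into U c x))))))"
    by (rule smooth_on_compose[OF smooth_premanifold_finite_dimensional[OF N] op _
          smooth_mapD[OF g V(1) X(1)] s1]) (use in_W inv in auto)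
  then have "smooth_on (c ` W) (\<lambda>x. e (g (f (inv_into U c x))))"
    by (rule smooth_on_cong[OF op, rotated]) (use inv in auto)
  moreover have "(\<lambda>x. g (f x)) ` W \<subseteq> X" using in_W by auto
  ultimately show "\<exists>U c V d W. (U, c) \<in> charts M \<and> (V, d) \<in> charts K \<and> openin (mtop M) W \<and> p \<in> W \<and>
      W \<subseteq> U \<and> (\<lambda>x. g (f x)) ` W \<subseteq> V \<and> smooth_on (c ` W) (\<lambda>x. d (g (f (inv_into U c x))))"
    using U(1) X(1) W by blast
qed

section \<open>Open submanifolds, restriction and localisation\<close>

lemma points_open_submanifold [simp]: "points (open_submanifold M W) = points M \<inter> W"
  by (simp add: open_submanifold_def)

lemma mtop_open_submanifold: "mtop (open_submanifold M W) = subtopology (mtop M) W"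
  by (simp add: open_submanifold_def)

text \<open>The inverse of a chart is written with \<open>inv_into\<close> and so depends on the
  domain. This lets the inverses of a chart and of its restriction be exchanged.\<close>

lemma inv_into_inj_subset: "inj_on c U \<Longrightarrow> x \<in> V \<Longrightarrow> V \<subseteq> U \<Longrightarrow> inv_into V c (c x) = x"
  by (meson inj_on_subset inv_into_f_f)

lemma second_countable_space_iff: "second_countable_space X \<longleftrightarrow> second_countable X"
  by (simp add: second_countable_space_def second_countable_def)

lemma smooth_premanifold_open_submanifold:
  assumes M: "smooth_premanifold M" and W: "openin (mtop M) W"
  shows "smooth_premanifold (open_submanifold M W)"
proof -
  have "second_countable_space (subtopology (mtop M) W)"
    using M second_countable_subtopology[of "mtop M" W]
    by (simp add: smooth_premanifold_def second_countable_space_iff)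
  moreover have "smooth_atlas (subtopology (mtop M) W) ((\<lambda>(U, c). (U \<inter> W, c)) ` charts M)"
  proof (rule smooth_atlasI)
    fix U c assume "(U, c) \<in> (\<lambda>(U, c). (U \<inter> W, c)) ` charts M"
    then obtain U' where U': "(U', c) \<in> charts M" and U: "U = U' \<inter> W" by auto
    show op: "openin (subtopology (mtop M) W) U"
      using chart_openin[OF M U'] W U by (auto simp: openin_open_subtopology)
    show inj: "inj_on c U" using chart_inj[OF M U'] U inj_on_subset by blast
    have "subtopology (subtopology (mtop M) W) U = subtopology (subtopology (mtop M) U') U"
      using U by (simp add: subtopology_subtopology inf.left_commute inf.commute)
    then show "continuous_map (subtopology (subtopology (mtop M) W) U) euclidean c"
      using continuous_map_from_subtopology[OF chart_continuous[OF M U']] by simp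
    show "open (c ` T)" if "openin (subtopology (mtop M) W) T" "T \<subseteq> U" for T
      using chart_openin_image[OF M U', of T] that U by (auto simp: openin_open_subtopology[OF W])
    fix V d assume "(V, d) \<in> (\<lambda>(U, c). (U \<inter> W, c)) ` charts M"
    then obtain V' where V': "(V', d) \<in> charts M" and V: "V = V' \<inter> W" by auto
    show "smooth_on (c ` (U \<inter> V)) (d \<circ> inv_into U c)"
    proof (rule smooth_on_cong)
      show "open (c ` (U \<inter> V))"
        using U V W chart_openin[OF M U'] chart_openin[OF M V']
        by (intro chart_openin_image[OF M U']) auto
      show "smooth_on (c ` (U \<inter> V)) (d \<circ> inv_into U' c)"
        by (rule smooth_on_subset[OF chart_transition[OF M U' V']]) (use U V in auto)
      show "(d \<circ> inv_into U' c) x = (d \<circ> inv_into U c) x" if "x \<in> c ` (U \<inter> V)" for x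
        using that U inj chart_inv[OF M U'] by auto
    qed
  next
    fix x assume "x \<in> topspace (subtopology (mtop M) W)"
    then have x: "x \<in> points M" "x \<in> W" by auto
    obtain U c where "(U, c) \<in> charts M" "x \<in> U" using chart_exists[OF M x(1)] .
    then show "\<exists>(U, c)\<in>(\<lambda>(U, c). (U \<inter> W, c)) ` charts M. x \<in> U"
      using x(2) by (intro bexI[of _ "(U \<inter> W, c)"]) (auto intro: rev_image_eqI)
  qed
  ultimately show ?thesis
    using M by (simp add: smooth_premanifold_def open_submanifold_def)
qed

lemma charts_open_submanifold:
  "charts (open_submanifold M W) = (\<lambda>(U, c). (U \<inter> W, c)) ` charts M"
  by (simp add: open_submanifold_def)

lemma smooth_map_id:
  assumes M: "smooth_premanifold M"
  shows "smooth_map M M (\<lambda>x. x)"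
proof (rule smooth_mapI[OF M M])
  fix p assume "p \<in> points M"
  then obtain U c where U: "(U, c) \<in> charts M" "p \<in> U" using chart_exists[OF M] by metis
  have "smooth_on (c ` U) (\<lambda>x. c (inv_into U c x))"
    using chart_transition[OF M U(1) U(1)] by (simp add: o_def)
  then show "\<exists>U c V d W. (U, c) \<in> charts M \<and> (V, d) \<in> charts M \<and> openin (mtop M) W \<and> p \<in> W \<and>
      W \<subseteq> U \<and> (\<lambda>x. x) ` W \<subseteq> V \<and> smooth_on (c ` W) (\<lambda>x. d (inv_into U c x))"
    using U chart_openin[OF M U(1)] by (metis image_ident order_refl)
qed

lemma smooth_map_const:
  assumes M: "smooth_premanifold M" and N: "smooth_premanifold N" and a: "a \<in> points N"
  shows "smooth_map M N (\<lambda>x. a)"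
proof (rule smooth_mapI[OF M N])
  fix p assume "p \<in> points M"
  then obtain U c where U: "(U, c) \<in> charts M" "p \<in> U" using chart_exists[OF M] by metis
  obtain V d where V: "(V, d) \<in> charts N" "a \<in> V" using chart_exists[OF N a] .
  show "\<exists>U c V d W. (U, c) \<in> charts M \<and> (V, d) \<in> charts N \<and> openin (mtop M) W \<and> p \<in> W \<and>
      W \<subseteq> U \<and> (\<lambda>x. a) ` W \<subseteq> V \<and> smooth_on (c ` W) (\<lambda>x. d a)"
    using U V chart_openin[OF M U(1)] smooth_on_const[OF chart_open_image[OF M U(1)]]
    by (intro exI[of _ U] exI[of _ c] exI[of _ V] exI[of _ d]) auto
qed

text \<open>The local representative \<open>h\<close> is a separate function, since a map on a glued
  space typically has a formula that is meaningful only on one piece.\<close>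

lemma smooth_map_locally:
  assumes M: "smooth_premanifold M" and N: "smooth_premanifold N"
    and loc: "\<And>p. p \<in> points M \<Longrightarrow> \<exists>W h. openin (mtop M) W \<and> p \<in> W \<and>
      smooth_map (open_submanifold M W) N h \<and> (\<forall>x\<in>W. h x = f x)"
  shows "smooth_map M N f"
proof (rule smooth_mapI[OF M N])
  fix p assume p: "p \<in> points M"
  then obtain W h where W: "openin (mtop M) W" "p \<in> W"
    and h: "smooth_map (open_submanifold M W) N h" "\<And>x. x \<in> W \<Longrightarrow> h x = f x"
    using loc by metis
  obtain U c where U: "(U, c) \<in> charts M" "p \<in> U" using chart_exists[OF M p] .
  have p': "p \<in> points (open_submanifold M W)" using p W(2) by simp
  obtain V d where V: "(V, d) \<in> charts N" "h p \<in> V"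
    using chart_exists[OF N smooth_map_in_points[OF h(1) p']] .
  define T where "T = U \<inter> {x \<in> points (open_submanifold M W). h x \<in> V}"
  have sub: "T \<subseteq> U" "T \<subseteq> W" "\<And>x. x \<in> T \<Longrightarrow> f x \<in> V" "p \<in> T"
    using U(2) V(2) p' h(2) by (auto simp: T_def)
  have "openin (mtop M) {x \<in> points (open_submanifold M W). h x \<in> V}"
    using smooth_map_openin_preimage[OF h(1) chart_openin[OF N V(1)]]
    by (simp add: mtop_open_submanifold openin_open_subtopology[OF W(1)])
  then have op: "openin (mtop M) T"
    unfolding T_def by (intro openin_Int chart_openin[OF M U(1)])
  have "(U \<inter> W, c) \<in> charts (open_submanifold M W)"
    using U(1) by (force simp: charts_open_submanifold)
  from smooth_mapD[OF h(1) this V(1)]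
  have "smooth_on (c ` T) (\<lambda>x. d (h (inv_into (U \<inter> W) c x)))"
    by (rule smooth_on_subset) (use T_def in auto)
  then have "smooth_on (c ` T) (\<lambda>x. d (f (inv_into U c x)))"
  proof (rule smooth_on_cong[OF chart_openin_image[OF M U(1) op sub(1)], rotated])
    fix z assume "z \<in> c ` T"
    then obtain x where x: "z = c x" "x \<in> U" "x \<in> W" using sub by auto
    have "inv_into (U \<inter> W) c (c x) = x"
      by (rule inv_into_inj_subset[OF chart_inj[OF M U(1)]]) (use x in auto)
    then show "d (h (inv_into (U \<inter> W) c z)) = d (f (inv_into U c z))"
      using x h(2) chart_inv[OF M U(1)] by simp
  qed
  then show "\<exists>U c V d W. (U, c) \<in> charts M \<and> (V, d) \<in> charts N \<and> openin (mtop M) W \<and> p \<in> W \<and>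
      W \<subseteq> U \<and> f ` W \<subseteq> V \<and> smooth_on (c ` W) (\<lambda>x. d (f (inv_into U c x)))"
    using U(1) V(1) op sub by blast
qed

text \<open>Functions are total, with arbitrary values off \<open>points M\<close>. The local
  criterion, with the whole space as neighbourhood, shows that smoothness ignores them.\<close>

lemma smooth_map_cong:
  assumes M: "smooth_premanifold M" and N: "smooth_premanifold N"
    and f: "smooth_map M N f" and eq: "\<And>x. x \<in> points M \<Longrightarrow> f x = g x"
  shows "smooth_map M N g"
proof (rule smooth_map_locally[OF M N])
  have "open_submanifold M (points M) = M"
  proof -
    have "U \<inter> points M = U" if "(U, c) \<in> charts M" for U c
      using chart_subset[OF M that] by auto
    then have "(\<lambda>(U, c). (U \<inter> points M, c)) ` charts M = (\<lambda>x. x) ` charts M"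
      by (intro image_cong) auto
    then show ?thesis by (simp add: open_submanifold_def)
  qed
  then show "\<exists>W h. openin (mtop M) W \<and> p \<in> W \<and> smooth_map (open_submanifold M W) N h \<and>
      (\<forall>x\<in>W. h x = g x)" if "p \<in> points M" for p
    using f eq that by (intro exI[of _ "points M"] exI[of _ f]) auto
qed

lemma smooth_map_restrict_domain:
  assumes M: "smooth_premanifold M" and N: "smooth_premanifold N"
    and f: "smooth_map M N f" and W: "openin (mtop M) W"
  shows "smooth_map (open_submanifold M W) N f"
proof (rule smooth_mapI[OF smooth_premanifold_open_submanifold[OF M W] N])
  note MW = smooth_premanifold_open_submanifold[OF M W]
  fix p assume p: "p \<in> points (open_submanifold M W)"
  then obtain U c where U: "(U, c) \<in> charts M" "p \<in> U" using chart_exists[OF M] by auto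
  obtain V d where V: "(V, d) \<in> charts N" "f p \<in> V"
    using chart_exists[OF N smooth_map_in_points[OF f]] p by auto
  define T where "T = U \<inter> W \<inter> {x \<in> points M. f x \<in> V}"
  have op: "openin (mtop M) T"
    unfolding T_def
    by (intro openin_Int chart_openin[OF M U(1)] W smooth_map_openin_preimage[OF f] chart_openin[OF N V(1)])
  have "smooth_on (c ` T) (\<lambda>x. d (f (inv_into U c x)))"
    by (rule smooth_on_subset[OF smooth_mapD[OF f U(1) V(1)]]) (auto simp: T_def)
  then have "smooth_on (c ` T) (\<lambda>x. d (f (inv_into (U \<inter> W) c x)))"
  proof (rule smooth_on_cong[OF chart_openin_image[OF M U(1) op], rotated 2])
    fix z assume "z \<in> c ` T"
    then obtain x where x: "z = c x" "x \<in> U" "x \<in> W" by (auto simp: T_def)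
    have "inv_into (U \<inter> W) c (c x) = x"
      by (rule inv_into_inj_subset[OF chart_inj[OF M U(1)]]) (use x in auto)
    then show "d (f (inv_into U c z)) = d (f (inv_into (U \<inter> W) c z))"
      using x chart_inv[OF M U(1)] by simp
  qed (auto simp: T_def)
  moreover have "(U \<inter> W, c) \<in> charts (open_submanifold M W)"
    using U(1) by (force simp: charts_open_submanifold)
  moreover have "openin (mtop (open_submanifold M W)) T"
    using op by (auto simp: mtop_open_submanifold openin_open_subtopology[OF W] T_def)
  moreover have "p \<in> T" "T \<subseteq> U \<inter> W" "f ` T \<subseteq> V"
    using p U(2) V(2) by (auto simp: T_def)
  ultimately show "\<exists>U c V d S. (U, c) \<in> charts (open_submanifold M W) \<and> (V, d) \<in> charts N \<and>
      openin (mtop (open_submanifold M W)) S \<and> p \<in> S \<and> S \<subseteq> U \<and> f ` S \<subseteq> V \<and>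
      smooth_on (c ` S) (\<lambda>x. d (f (inv_into U c x)))"
    using V(1) by blast
qed

lemma smooth_map_restrict_codomain:
  assumes M: "smooth_premanifold M" and N: "smooth_premanifold N"
    and f: "smooth_map M N f" and W: "openin (mtop N) W" "\<And>x. x \<in> points M \<Longrightarrow> f x \<in> W"
  shows "smooth_map M (open_submanifold N W) f"
proof (rule smooth_mapI[OF M smooth_premanifold_open_submanifold[OF N W(1)]])
  fix p assume p: "p \<in> points M"
  obtain U c where U: "(U, c) \<in> charts M" "p \<in> U" using chart_exists[OF M p] .
  obtain V d where V: "(V, d) \<in> charts N" "f p \<in> V"
    using chart_exists[OF N smooth_map_in_points[OF f p]] .
  define T where "T = U \<inter> {x \<in> points M. f x \<in> V}"
  have "openin (mtop M) T"
    unfolding T_def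
    by (intro openin_Int chart_openin[OF M U(1)] smooth_map_openin_preimage[OF f] chart_openin[OF N V(1)])
  moreover have "smooth_on (c ` T) (\<lambda>x. d (f (inv_into U c x)))"
    by (rule smooth_on_subset[OF smooth_mapD[OF f U(1) V(1)]]) (auto simp: T_def)
  moreover have "(V \<inter> W, d) \<in> charts (open_submanifold N W)"
    using V(1) by (force simp: charts_open_submanifold)
  moreover have "p \<in> T" "T \<subseteq> U" "f ` T \<subseteq> V \<inter> W"
    using p U(2) V(2) W(2) by (auto simp: T_def)
  ultimately show "\<exists>U c V d S. (U, c) \<in> charts M \<and> (V, d) \<in> charts (open_submanifold N W) \<and>
      openin (mtop M) S \<and> p \<in> S \<and> S \<subseteq> U \<and> f ` S \<subseteq> V \<and>
      smooth_on (c ` S) (\<lambda>x. d (f (inv_into U c x)))"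
    using U(1) by blast
qed

section \<open>Products\<close>

lemma second_countable_prod_topology:
  assumes "second_countable X" "second_countable Y"
  shows "second_countable (prod_topology X Y)"
proof -
  obtain \<A> where \<A>: "countable \<A>" "\<forall>A\<in>\<A>. openin X A"
    "\<And>U x. openin X U \<Longrightarrow> x \<in> U \<Longrightarrow> \<exists>A\<in>\<A>. x \<in> A \<and> A \<subseteq> U"
    using assms(1) unfolding second_countable_def by auto
  obtain \<B> where \<B>: "countable \<B>" "\<forall>B\<in>\<B>. openin Y B"
    "\<And>U y. openin Y U \<Longrightarrow> y \<in> U \<Longrightarrow> \<exists>B\<in>\<B>. y \<in> B \<and> B \<subseteq> U"
    using assms(2) unfolding second_countable_def by auto
  show ?thesis
    unfolding second_countable_def
  proof (intro exI[of _ "(\<lambda>(A, B). A \<times> B) ` (\<A> \<times> \<B>)"] conjI ballI allI impI)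
    show "countable ((\<lambda>(A, B). A \<times> B) ` (\<A> \<times> \<B>))" using \<A>(1) \<B>(1) by simp
    show "openin (prod_topology X Y) V" if "V \<in> (\<lambda>(A, B). A \<times> B) ` (\<A> \<times> \<B>)" for V
      using that \<A>(2) \<B>(2) by (auto simp: openin_prod_Times_iff)
    show "\<exists>V\<in>(\<lambda>(A, B). A \<times> B) ` (\<A> \<times> \<B>). p \<in> V \<and> V \<subseteq> W"
      if W: "openin (prod_topology X Y) W \<and> p \<in> W" for W p
    proof -
      obtain x y where p: "p = (x, y)" by (cases p)
      obtain S T where ST: "openin X S" "openin Y T" "x \<in> S" "y \<in> T" "S \<times> T \<subseteq> W"
        using W unfolding p openin_prod_topology_alt by meson
      obtain A B where "A \<in> \<A>" "x \<in> A" "A \<subseteq> S" "B \<in> \<B>" "y \<in> B" "B \<subseteq> T"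
        using \<A>(3)[OF ST(1,3)] \<B>(3)[OF ST(2,4)] by auto
      then show ?thesis
        using ST(5) p by (intro bexI[of _ "A \<times> B"]) auto
    qed
  qed
qed

lemma mtop_product_manifold: "mtop (product_manifold M N) = prod_topology (mtop M) (mtop N)"
  by (simp add: product_manifold_def)

lemma points_product_manifold [simp]: "points (product_manifold M N) = points M \<times> points N"
  by (simp add: product_manifold_def)

lemma charts_product_manifold:
  "(W, e) \<in> charts (product_manifold M N) \<longleftrightarrow>
    (\<exists>U c V d. W = U \<times> V \<and> e = map_prod c d \<and> (U, c) \<in> charts M \<and> (V, d) \<in> charts N)"
  by (auto simp: product_manifold_def)

lemma inv_into_map_prod:
  assumes "inj_on c U" "inj_on d V" "z \<in> c ` U \<times> d ` V"
  shows "inv_into (U \<times> V) (map_prod c d) z = (inv_into U c (fst z), inv_into V d (snd z))"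
proof -
  obtain x y where "z = map_prod c d (x, y)" "x \<in> U" "y \<in> V" using assms(3) by auto
  moreover have "inv_into (U \<times> V) (map_prod c d) (map_prod c d (x, y)) = (x, y)"
    by (rule inv_into_f_f[OF map_prod_inj_on[OF assms(1,2)]]) (use calculation in auto)
  ultimately show ?thesis using assms(1,2) by simp
qed

lemma smooth_on_fst: "open S \<Longrightarrow> smooth_on S fst"
  by (rule smooth_on_bounded_linear[OF bounded_linear_fst])

lemma smooth_on_snd: "open S \<Longrightarrow> smooth_on S snd"
  by (rule smooth_on_bounded_linear[OF bounded_linear_snd])

lemma smooth_premanifold_product:
  fixes M :: "('a, 'e::real_normed_vector) smooth_space"
    and N :: "('b, 'f::real_normed_vector) smooth_space"
  assumes M: "smooth_premanifold M" and N: "smooth_premanifold N"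
  shows "smooth_premanifold (product_manifold M N)"
proof -
  note fd = M[THEN smooth_premanifold_finite_dimensional] N[THEN smooth_premanifold_finite_dimensional]
  have "second_countable_space (prod_topology (mtop M) (mtop N))"
    using M N by (simp add: smooth_premanifold_def second_countable_space_iff second_countable_prod_topology)
  moreover have "smooth_atlas (prod_topology (mtop M) (mtop N)) (charts (product_manifold M N))"
  proof (rule smooth_atlasI)
    fix W e assume "(W, e) \<in> charts (product_manifold M N)"
    then obtain U c V d where We: "W = U \<times> V" "e = map_prod c d"
      and U: "(U, c) \<in> charts M" and V: "(V, d) \<in> charts N"
      unfolding charts_product_manifold by blast
    note inj = chart_inj[OF M U] chart_inj[OF N V]
    show "openin (prod_topology (mtop M) (mtop N)) W"
      using chart_openin[OF M U] chart_openin[OF N V] by (simp add: We openin_prod_Times_iff)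
    show "inj_on e W"
      unfolding We by (rule map_prod_inj_on[OF inj])
    have "continuous_map (prod_topology (subtopology (mtop M) U) (subtopology (mtop N) V)) euclidean
        (\<lambda>z. (c (fst z), d (snd z)))"
      unfolding prod_topology_euclidean[symmetric]
      by (intro continuous_map_pairedI
          continuous_map_compose[OF continuous_map_fst chart_continuous[OF M U], unfolded o_def]
          continuous_map_compose[OF continuous_map_snd chart_continuous[OF N V], unfolded o_def])
    then show "continuous_map (subtopology (prod_topology (mtop M) (mtop N)) W) euclidean e"
      by (simp add: We subtopology_Times map_prod_def case_prod_unfold)
    show "open (e ` T)" if T: "openin (prod_topology (mtop M) (mtop N)) T" "T \<subseteq> W" for T
    proof (rule topological_space_class.openI)
      fix z assume "z \<in> e ` T"
      then obtain x y where xy: "(x, y) \<in> T" "z = (c x, d y)" by (auto simp: We)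
      then obtain A B where AB: "openin (mtop M) A" "openin (mtop N) B" "x \<in> A" "y \<in> B" "A \<times> B \<subseteq> T"
        using T(1) unfolding openin_prod_topology_alt by meson
      then have "A \<subseteq> U" "B \<subseteq> V" using T(2) We(1) by auto
      then have "open (c ` A \<times> d ` B)"
        by (intro open_Times chart_openin_image[OF M U AB(1)] chart_openin_image[OF N V AB(2)])
      moreover have "c ` A \<times> d ` B \<subseteq> e ` T"
        using AB(5) by (force simp: We)
      moreover have "z \<in> c ` A \<times> d ` B" using AB(3,4) xy(2) by auto
      ultimately show "\<exists>S. open S \<and> z \<in> S \<and> S \<subseteq> e ` T" by blast
    qed
    fix W' e' assume "(W', e') \<in> charts (product_manifold M N)"
    then obtain U' c' V' d' where We': "W' = U' \<times> V'" "e' = map_prod c' d'"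
      and U': "(U', c') \<in> charts M" and V': "(V', d') \<in> charts N"
      unfolding charts_product_manifold by blast
    let ?S = "c ` (U \<inter> U')" and ?T = "d ` (V \<inter> V')"
    have S: "open ?S" and T: "open ?T"
      using chart_openin[OF M U] chart_openin[OF M U'] chart_openin[OF N V] chart_openin[OF N V']
      by (auto intro: chart_openin_image[OF M U] chart_openin_image[OF N V])
    then have ST: "open (?S \<times> ?T)" by (rule open_Times)
    have "smooth_on (?S \<times> ?T) (\<lambda>z. c' (inv_into U c (fst z)))"
      by (rule smooth_on_compose[OF fd(1) ST _ chart_transition[OF M U U', unfolded o_def]
            smooth_on_fst[OF ST]]) auto
    moreover have "smooth_on (?S \<times> ?T) (\<lambda>z. d' (inv_into V d (snd z)))"
      by (rule smooth_on_compose[OF fd(2) ST _ chart_transition[OF N V V', unfolded o_def]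
            smooth_on_snd[OF ST]]) auto
    ultimately have "smooth_on (?S \<times> ?T)
        (\<lambda>z. (c' (inv_into U c (fst z)), d' (inv_into V d (snd z))))"
      by (rule smooth_on_Pair[OF ST])
    then have "smooth_on (?S \<times> ?T) (e' \<circ> inv_into W e)"
    proof (rule smooth_on_cong[OF ST, rotated])
      fix z assume "z \<in> ?S \<times> ?T"
      then have "z \<in> c ` U \<times> d ` V" by auto
      then show "(c' (inv_into U c (fst z)), d' (inv_into V d (snd z))) = (e' \<circ> inv_into W e) z"
        by (simp add: We We' inv_into_map_prod[OF inj])
    qed
    moreover have "e ` (W \<inter> W') = ?S \<times> ?T"
      by (simp add: We We' Times_Int_Times map_prod_surj_on)
    ultimately show "smooth_on (e ` (W \<inter> W')) (e' \<circ> inv_into W e)" by simp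
  next
    fix p assume "p \<in> topspace (prod_topology (mtop M) (mtop N))"
    then have p: "fst p \<in> points M" "snd p \<in> points N" by auto
    obtain U c where U: "(U, c) \<in> charts M" "fst p \<in> U" using chart_exists[OF M p(1)] .
    obtain V d where V: "(V, d) \<in> charts N" "snd p \<in> V" using chart_exists[OF N p(2)] .
    have "(U \<times> V, map_prod c d) \<in> charts (product_manifold M N)"
      using U(1) V(1) unfolding charts_product_manifold by blast
    then show "\<exists>(W, e)\<in>charts (product_manifold M N). p \<in> W"
      using U(2) V(2) by (intro bexI[of _ "(U \<times> V, map_prod c d)"]) (auto simp: mem_Times_iff)
  qed
  moreover have "\<exists>B::('e \<times> 'f) set. finite B \<and> span B = UNIV"
    using finite_dimensional_prod[OF fd] by (simp add: finite_dimensional_def)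
  ultimately show ?thesis by (simp add: smooth_premanifold_def mtop_product_manifold)
qed

lemma smooth_map_fst:
  assumes M: "smooth_premanifold M" and N: "smooth_premanifold N"
  shows "smooth_map (product_manifold M N) M fst"
proof (rule smooth_mapI[OF smooth_premanifold_product[OF M N] M])
  fix p assume p: "p \<in> points (product_manifold M N)"
  then have p': "fst p \<in> points M" "snd p \<in> points N" by auto
  obtain U c where U: "(U, c) \<in> charts M" "fst p \<in> U" using chart_exists[OF M p'(1)] .
  obtain V d where V: "(V, d) \<in> charts N" "snd p \<in> V" using chart_exists[OF N p'(2)] .
  have ch: "(U \<times> V, map_prod c d) \<in> charts (product_manifold M N)"
    using U(1) V(1) unfolding charts_product_manifold by blast
  note op = chart_openin[OF smooth_premanifold_product[OF M N] ch]
    chart_open_image[OF smooth_premanifold_product[OF M N] ch]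
  have "smooth_on (map_prod c d ` (U \<times> V)) (\<lambda>x. c (fst (inv_into (U \<times> V) (map_prod c d) x)))"
    by (rule smooth_on_cong[OF op(2) _ smooth_on_fst[OF op(2)]])
      (auto simp: inv_into_map_prod[OF chart_inj[OF M U(1)] chart_inj[OF N V(1)]] chart_inv[OF M U(1)])
  moreover have "fst ` (U \<times> V) \<subseteq> U" "p \<in> U \<times> V" using U(2) V(2) by (auto simp: mem_Times_iff)
  ultimately show "\<exists>W e V d S. (W, e) \<in> charts (product_manifold M N) \<and> (V, d) \<in> charts M \<and>
      openin (mtop (product_manifold M N)) S \<and> p \<in> S \<and> S \<subseteq> W \<and> fst ` S \<subseteq> V \<and>
      smooth_on (e ` S) (\<lambda>x. d (fst (inv_into W e x)))"
    using ch U(1) op(1) by blast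
qed

lemma smooth_map_snd:
  assumes M: "smooth_premanifold M" and N: "smooth_premanifold N"
  shows "smooth_map (product_manifold M N) N snd"
proof (rule smooth_mapI[OF smooth_premanifold_product[OF M N] N])
  fix p assume p: "p \<in> points (product_manifold M N)"
  then have p': "fst p \<in> points M" "snd p \<in> points N" by auto
  obtain U c where U: "(U, c) \<in> charts M" "fst p \<in> U" using chart_exists[OF M p'(1)] .
  obtain V d where V: "(V, d) \<in> charts N" "snd p \<in> V" using chart_exists[OF N p'(2)] .
  have ch: "(U \<times> V, map_prod c d) \<in> charts (product_manifold M N)"
    using U(1) V(1) unfolding charts_product_manifold by blast
  note op = chart_openin[OF smooth_premanifold_product[OF M N] ch]
    chart_open_image[OF smooth_premanifold_product[OF M N] ch]
  have "smooth_on (map_prod c d ` (U \<times> V)) (\<lambda>x. d (snd (inv_into (U \<times> V) (map_prod c d) x)))"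
    by (rule smooth_on_cong[OF op(2) _ smooth_on_snd[OF op(2)]])
      (auto simp: inv_into_map_prod[OF chart_inj[OF M U(1)] chart_inj[OF N V(1)]] chart_inv[OF N V(1)])
  moreover have "snd ` (U \<times> V) \<subseteq> V" "p \<in> U \<times> V" using U(2) V(2) by (auto simp: mem_Times_iff)
  ultimately show "\<exists>W e V d S. (W, e) \<in> charts (product_manifold M N) \<and> (V, d) \<in> charts N \<and>
      openin (mtop (product_manifold M N)) S \<and> p \<in> S \<and> S \<subseteq> W \<and> snd ` S \<subseteq> V \<and>
      smooth_on (e ` S) (\<lambda>x. d (snd (inv_into W e x)))"
    using ch V(1) op(1) by blast
qed

lemma smooth_map_Pair:
  assumes K: "smooth_premanifold K" and M: "smooth_premanifold M" and N: "smooth_premanifold N"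
    and f: "smooth_map K M f" and g: "smooth_map K N g"
  shows "smooth_map K (product_manifold M N) (\<lambda>x. (f x, g x))"
proof (rule smooth_mapI[OF K smooth_premanifold_product[OF M N]])
  fix p assume p: "p \<in> points K"
  obtain W e where W: "(W, e) \<in> charts K" "p \<in> W" using chart_exists[OF K p] .
  obtain U c where U: "(U, c) \<in> charts M" "f p \<in> U"
    using chart_exists[OF M smooth_map_in_points[OF f p]] .
  obtain V d where V: "(V, d) \<in> charts N" "g p \<in> V"
    using chart_exists[OF N smooth_map_in_points[OF g p]] .
  define S where "S = W \<inter> {x \<in> points K. f x \<in> U} \<inter> {x \<in> points K. g x \<in> V}"
  have op: "openin (mtop K) S"
    unfolding S_def
    by (intro openin_Int chart_openin[OF K W(1)] smooth_map_openin_preimage[OF f]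
        smooth_map_openin_preimage[OF g] chart_openin[OF M U(1)] chart_openin[OF N V(1)])
  have S: "p \<in> S" "S \<subseteq> W" "(\<lambda>x. (f x, g x)) ` S \<subseteq> U \<times> V"
    using p W(2) U(2) V(2) by (auto simp: S_def)
  have "smooth_on (e ` S) (\<lambda>x. (c (f (inv_into W e x)), d (g (inv_into W e x))))"
    by (intro smooth_on_Pair chart_openin_image[OF K W(1) op S(2)]
        smooth_on_subset[OF smooth_mapD[OF f W(1) U(1)]]
        smooth_on_subset[OF smooth_mapD[OF g W(1) V(1)]]) (auto simp: S_def)
  then have "smooth_on (e ` S) (\<lambda>x. map_prod c d (f (inv_into W e x), g (inv_into W e x)))"
    by simp
  moreover have "(U \<times> V, map_prod c d) \<in> charts (product_manifold M N)"
    using U(1) V(1) unfolding charts_product_manifold by blast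
  ultimately show "\<exists>W e V d S. (W, e) \<in> charts K \<and> (V, d) \<in> charts (product_manifold M N) \<and>
      openin (mtop K) S \<and> p \<in> S \<and> S \<subseteq> W \<and> (\<lambda>x. (f x, g x)) ` S \<subseteq> V \<and>
      smooth_on (e ` S) (\<lambda>x. d (f (inv_into W e x), g (inv_into W e x)))"
    using W(1) op S by blast
qed

section \<open>Diffeomorphisms, submersions and local sections\<close>

text \<open>The definition speaks of \<open>inv_into (points M) f\<close>. An explicit two-sided
  inverse \<open>g\<close> agrees with it on \<open>points N\<close>, so smoothness can be checked
  for \<open>g\<close>.\<close>

lemma diffeomorphismI:
  assumes M: "smooth_premanifold M" and N: "smooth_premanifold N"
    and f: "smooth_map M N f" and g: "smooth_map N M g"
    and gf: "\<And>x. x \<in> points M \<Longrightarrow> g (f x) = x" and fg: "\<And>y. y \<in> points N \<Longrightarrow> f (g y) = y"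
  shows "diffeomorphism M N f"
proof -
  have bij: "bij_betw f (points M) (points N)"
    by (rule bij_betwI[where g = g]) (use smooth_map_in_points[OF f] smooth_map_in_points[OF g] gf fg in auto)
  have "g y = inv_into (points M) f y" if "y \<in> points N" for y
    using bij_betw_inv_into_left[OF bij smooth_map_in_points[OF g that]] fg[OF that] by simp
  then have "smooth_map N M (inv_into (points M) f)"
    by (rule smooth_map_cong[OF N M g])
  then show ?thesis using bij f by (simp add: diffeomorphism_def)
qed

text \<open>Differentiating \<open>f (\<sigma> y) = y\<close> in charts exhibits a right inverse of
  the derivative of \<open>f\<close> at \<open>p\<close>, so that derivative is surjective.\<close>

lemma submersionI:
  fixes M :: "('a, 'e::real_normed_vector) smooth_space"
    and N :: "('b, 'f::real_normed_vector) smooth_space"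
  assumes M: "smooth_premanifold M" and N: "smooth_premanifold N" and f: "smooth_map M N f"
    and sec: "\<And>p. p \<in> points M \<Longrightarrow> \<exists>W \<sigma>. openin (mtop N) W \<and> f p \<in> W \<and>
      smooth_map (open_submanifold N W) M \<sigma> \<and> \<sigma> (f p) = p \<and> (\<forall>y\<in>W. f (\<sigma> y) = y)"
  shows "submersion M N f"
  unfolding submersion_def
proof (intro conjI f ballI, clarify)
  fix U c V d p assume U: "(U, c) \<in> charts M" and V: "(V, d) \<in> charts N" and p: "p \<in> U" "f p \<in> V"
  have pM: "p \<in> points M" using p(1) chart_subset[OF M U] by auto
  then obtain W \<sigma> where W: "openin (mtop N) W" "f p \<in> W"
    and \<sigma>: "smooth_map (open_submanifold N W) M \<sigma>" "\<sigma> (f p) = p" "\<And>y. y \<in> W \<Longrightarrow> f (\<sigma> y) = y"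
    using sec[OF pM] by metis
  \<comment> \<open>These are \<open>f\<close> and the section in coordinates. The second uses the
    chart restricted to \<open>V \<inter> W\<close>, because the section is smooth on the open
    submanifold \<open>W\<close> only.\<close>
  let ?A = "\<lambda>x. d (f (inv_into U c x))" and ?B = "\<lambda>y. c (\<sigma> (inv_into (V \<inter> W) d y))"
  have fp: "f p \<in> points N" using smooth_map_in_points[OF f pM] .
  have inv: "inv_into (V \<inter> W) d (d y) = y" if "y \<in> V \<inter> W" for y
    by (rule inv_into_inj_subset[OF chart_inj[OF N V]]) (use that in auto)
  have VW: "(V \<inter> W, d) \<in> charts (open_submanifold N W)"
    using V by (force simp: charts_open_submanifold)
  have B0: "?B (d (f p)) = c p" using inv p(2) W(2) \<sigma>(2) by simp
  have A': "(?A has_derivative frechet_derivative ?A (at (c p))) (at (?B (d (f p))))"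
    unfolding B0 by (rule smooth_on_has_derivative[OF smooth_mapD[OF f U V]]) (use p in auto)
  have B': "(?B has_derivative frechet_derivative ?B (at (d (f p)))) (at (d (f p)))"
    by (rule smooth_on_has_derivative[OF smooth_mapD[OF \<sigma>(1) VW U]]) (use p W(2) \<sigma>(2) in auto)
  define S where "S = V \<inter> {y \<in> points (open_submanifold N W). \<sigma> y \<in> U}"
  have "openin (mtop N) {y \<in> points (open_submanifold N W). \<sigma> y \<in> U}"
    using smooth_map_openin_preimage[OF \<sigma>(1) chart_openin[OF M U]]
    by (simp add: mtop_open_submanifold openin_open_subtopology[OF W(1)])
  then have "openin (mtop N) S"
    unfolding S_def by (intro openin_Int chart_openin[OF N V])
  then have op: "open (d ` S)" by (rule chart_openin_image[OF N V]) (auto simp: S_def)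
  have "((\<lambda>y. ?A (?B y)) has_derivative (\<lambda>v. v)) (at (d (f p)))"
  proof (rule has_derivative_transform_within_open[OF has_derivative_ident op])
    show "d (f p) \<in> d ` S" using p W(2) fp \<sigma>(2) by (auto simp: S_def)
    show "y = ?A (?B y)" if "y \<in> d ` S" for y
      using that inv \<sigma>(3) chart_inv[OF M U] by (auto simp: S_def)
  qed
  moreover have "((\<lambda>y. ?A (?B y)) has_derivative
      (frechet_derivative ?A (at (c p)) \<circ> frechet_derivative ?B (at (d (f p))))) (at (d (f p)))"
    using diff_chain_at[OF B' A'] by (simp add: o_def)
  ultimately have "frechet_derivative ?A (at (c p)) \<circ> frechet_derivative ?B (at (d (f p))) = (\<lambda>v. v)"
    using has_derivative_unique by blast
  then have "surj (frechet_derivative ?A (at (c p)))"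
    by (metis comp_apply surjI)
  then show "surj (frechet_derivative (d \<circ> f \<circ> inv_into U c) (at (c p)))"
    by (simp add: o_def)
qed

lemma open_map_if_local_sections:
  assumes f: "f \<in> topspace X \<rightarrow> topspace Y"
    and sec: "\<And>p. p \<in> topspace X \<Longrightarrow> \<exists>W \<sigma>. openin Y W \<and> f p \<in> W \<and>
      continuous_map (subtopology Y W) X \<sigma> \<and> \<sigma> (f p) = p \<and> (\<forall>y\<in>W. f (\<sigma> y) = y)"
  shows "open_map X Y f"
  unfolding open_map_def
proof (intro allI impI, subst openin_subopen, clarify)
  fix S p assume S: "openin X S" "p \<in> S"
  then have p: "p \<in> topspace X" using openin_subset by blast
  then obtain W \<sigma> where W: "openin Y W" "f p \<in> W" and \<sigma>: "continuous_map (subtopology Y W) X \<sigma>"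
    "\<sigma> (f p) = p" "\<And>y. y \<in> W \<Longrightarrow> f (\<sigma> y) = y"
    using sec[OF p] by metis
  let ?T = "{y \<in> topspace (subtopology Y W). \<sigma> y \<in> S}"
  have "openin Y ?T"
    using openin_continuous_map_preimage[OF \<sigma>(1) S(1)] by (simp add: openin_open_subtopology[OF W(1)])
  moreover have "f p \<in> ?T" using W(2) \<sigma>(2) S(2) f p by auto
  moreover have "?T \<subseteq> f ` S" using \<sigma>(3) by (force simp: image_iff)
  ultimately show "\<exists>T. openin Y T \<and> f p \<in> T \<and> T \<subseteq> f ` S" by blast
qed

section \<open>Transport of a smooth structure along a homeomorphism\<close>

text \<open>The pullback of an atlas along \<open>F\<close>. Domains are cut down to
  \<open>Y\<close> because \<open>F\<close> has arbitrary values elsewhere.\<close>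

definition transport_charts ::
  "'b set \<Rightarrow> ('b \<Rightarrow> 'a) \<Rightarrow> ('a set \<times> ('a \<Rightarrow> 'e)) set \<Rightarrow> ('b set \<times> ('b \<Rightarrow> 'e)) set" where
  "transport_charts Y F A = (\<lambda>(V, c). ({q \<in> Y. F q \<in> V}, c \<circ> F)) ` A"

context
  fixes N :: "('a, 'e::real_normed_vector) smooth_space" and X :: "'b topology" and F H Q
  assumes N: "smooth_premanifold N" and FH: "homeomorphic_maps X (mtop N) F H"
  defines "Q \<equiv> \<lparr>mtop = X, charts = transport_charts (topspace X) F (charts N)\<rparr>"
begin

lemma transport_inv:
  assumes V: "(V, c) \<in> charts N" and z: "z \<in> c ` V"
  shows "inv_into {q \<in> topspace X. F q \<in> V} (c \<circ> F) z = H (inv_into V c z)"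
proof -
  obtain y where y: "y \<in> V" "z = c y" using z by auto
  have yN: "y \<in> points N" using y(1) chart_subset[OF N V] by auto
  have inj: "inj_on (c \<circ> F) {q \<in> topspace X. F q \<in> V}"
  proof (rule comp_inj_on)
    show "inj_on F {q \<in> topspace X. F q \<in> V}"
      using FH by (auto simp: homeomorphic_maps_def intro: inj_on_inverseI)
    show "inj_on c (F ` {q \<in> topspace X. F q \<in> V})"
      using chart_inj[OF N V] by (rule inj_on_subset) auto
  qed
  have H: "H y \<in> topspace X" "F (H y) = y"
    using FH yN by (auto simp: homeomorphic_maps_def continuous_map_def)
  have "inv_into {q \<in> topspace X. F q \<in> V} (c \<circ> F) ((c \<circ> F) (H y)) = H y"
    by (rule inv_into_f_f[OF inj]) (use H y in auto)
  then show ?thesis using H y chart_inv[OF N V] by simp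
qed

lemma transport_premanifold: "smooth_premanifold Q"
proof -
  have cF: "continuous_map X (mtop N) F" and cH: "continuous_map (mtop N) X H"
    and HF: "\<And>q. q \<in> topspace X \<Longrightarrow> H (F q) = q" and FHy: "\<And>y. y \<in> points N \<Longrightarrow> F (H y) = y"
    using FH by (auto simp: homeomorphic_maps_def)
  have "X homeomorphic_space mtop N" using FH homeomorphic_space_def by blast
  then have "second_countable_space X"
    using N homeomorphic_space_second_countability[of X "mtop N"]
    by (simp add: smooth_premanifold_def second_countable_space_iff)
  moreover have "smooth_atlas X (transport_charts (topspace X) F (charts N))"
  proof (rule smooth_atlasI)
    fix U e assume "(U, e) \<in> transport_charts (topspace X) F (charts N)"
    then obtain V c where V: "(V, c) \<in> charts N" and U: "U = {q \<in> topspace X. F q \<in> V}" and e: "e = c \<circ> F"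
      by (auto simp: transport_charts_def)
    show "openin X U"
      unfolding U by (rule openin_continuous_map_preimage[OF cF chart_openin[OF N V]])
    show "inj_on e U"
      using chart_inj[OF N V] HF by (auto simp: U e inj_on_def) metis
    show "continuous_map (subtopology X U) euclidean e"
      unfolding e
    proof (rule continuous_map_compose[OF _ chart_continuous[OF N V]])
      show "continuous_map (subtopology X U) (subtopology (mtop N) V) F"
        using continuous_map_from_subtopology[OF cF, of U] by (auto simp: continuous_map_in_subtopology U)
    qed
    show "open (e ` W)" if W: "openin X W" "W \<subseteq> U" for W
    proof -
      have sub: "W \<subseteq> topspace X" using W(1) by (rule openin_subset)
      have "F ` W = {y \<in> points N. H y \<in> W}"
      proof (intro equalityI subsetI)
        fix y assume "y \<in> F ` W"
        then show "y \<in> {y \<in> points N. H y \<in> W}"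
          using sub HF continuous_map_funspace[OF cF] by auto
      next
        fix y assume "y \<in> {y \<in> points N. H y \<in> W}"
        then show "y \<in> F ` W" using FHy by (metis (mono_tags, lifting) image_eqI mem_Collect_eq)
      qed
      then have "openin (mtop N) (F ` W)"
        using openin_continuous_map_preimage[OF cH W(1)] by simp
      then have "open (c ` F ` W)"
        by (rule chart_openin_image[OF N V]) (use W(2) U in auto)
      then show ?thesis by (simp add: e image_comp)
    qed
    fix U' e' assume "(U', e') \<in> transport_charts (topspace X) F (charts N)"
    then obtain V' c' where V': "(V', c') \<in> charts N" and U': "U' = {q \<in> topspace X. F q \<in> V'}"
      and e': "e' = c' \<circ> F"
      by (auto simp: transport_charts_def)
    \<comment> \<open>\<open>F\<close> carries the overlap of two pulled-back domains onto
      \<open>V \<inter> V'\<close>, so the transition maps of the new atlas are those of the old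
      one.\<close>
    have img: "e ` (U \<inter> U') = c ` (V \<inter> V')"
    proof -
      have "F ` (U \<inter> U') = V \<inter> V'"
      proof (intro equalityI subsetI)
        fix y assume y: "y \<in> V \<inter> V'"
        then have "y \<in> points N" using chart_subset[OF N V] by auto
        then have "F (H y) = y" "H y \<in> topspace X" using FHy continuous_map_funspace[OF cH] by auto
        then show "y \<in> F ` (U \<inter> U')"
          using y by (intro rev_image_eqI[of "H y"]) (auto simp: U U')
      qed (auto simp: U U')
      then show ?thesis by (metis e image_comp)
    qed
    show "smooth_on (e ` (U \<inter> U')) (e' \<circ> inv_into U e)"
    proof (rule smooth_on_cong[OF _ _ chart_transition[OF N V V', folded img]])
      show "open (e ` (U \<inter> U'))"
        unfolding img using chart_openin[OF N V] chart_openin[OF N V']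
        by (intro chart_openin_image[OF N V]) auto
      fix z assume "z \<in> e ` (U \<inter> U')"
      then have z: "z \<in> c ` V" unfolding img by auto
      then have "inv_into V c z \<in> points N" using chart_subset[OF N V] inv_into_into[OF z] by auto
      then show "(c' \<circ> inv_into V c) z = (e' \<circ> inv_into U e) z"
        using transport_inv[OF V z] FHy by (simp add: U e e')
    qed
  next
    fix q assume q: "q \<in> topspace X"
    then obtain V c where "(V, c) \<in> charts N" "F q \<in> V"
      using chart_exists[OF N, of "F q"] continuous_map_funspace[OF cF] by auto
    then show "\<exists>(U, c)\<in>transport_charts (topspace X) F (charts N). q \<in> U"
      using q by (intro bexI[of _ "({q \<in> topspace X. F q \<in> V}, c \<circ> F)"])
        (auto simp: transport_charts_def intro: rev_image_eqI)
  qed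
  ultimately show ?thesis using N by (simp add: smooth_premanifold_def Q_def)
qed

lemma transport_smooth: "smooth_map Q N F"
proof (rule smooth_mapI[OF transport_premanifold N])
  have cF: "continuous_map X (mtop N) F" and FHy: "\<And>y. y \<in> points N \<Longrightarrow> F (H y) = y"
    using FH by (auto simp: homeomorphic_maps_def)
  fix q assume q: "q \<in> points Q"
  then obtain V c where V: "(V, c) \<in> charts N" "F q \<in> V"
    using chart_exists[OF N, of "F q"] continuous_map_funspace[OF cF] by (auto simp: Q_def)
  let ?U = "{q \<in> topspace X. F q \<in> V}"
  have U: "(?U, c \<circ> F) \<in> charts Q"
    using V(1) by (auto simp: Q_def transport_charts_def intro: rev_image_eqI)
  note op = chart_openin[OF transport_premanifold U] chart_open_image[OF transport_premanifold U]
  have "smooth_on ((c \<circ> F) ` ?U) (\<lambda>x. c (F (inv_into ?U (c \<circ> F) x)))"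
    using chart_transition[OF transport_premanifold U U] by (simp add: o_def)
  moreover have "F ` ?U \<subseteq> V" "q \<in> ?U" using q V(2) by (auto simp: Q_def)
  ultimately show "\<exists>U c V d W. (U, c) \<in> charts Q \<and> (V, d) \<in> charts N \<and> openin (mtop Q) W \<and> q \<in> W \<and>
      W \<subseteq> U \<and> F ` W \<subseteq> V \<and> smooth_on (c ` W) (\<lambda>x. d (F (inv_into U c x)))"
    using U V(1) op by blast
qed

lemma transport_inverse_smooth: "smooth_map N Q H"
proof (rule smooth_mapI[OF N transport_premanifold])
  have cH: "continuous_map (mtop N) X H" and FHy: "\<And>y. y \<in> points N \<Longrightarrow> F (H y) = y"
    using FH by (auto simp: homeomorphic_maps_def)
  fix y assume y: "y \<in> points N"
  obtain V c where V: "(V, c) \<in> charts N" "y \<in> V" using chart_exists[OF N y] .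
  let ?U = "{q \<in> topspace X. F q \<in> V}"
  have U: "(?U, c \<circ> F) \<in> charts Q"
    using V(1) by (auto simp: Q_def transport_charts_def intro: rev_image_eqI)
  have "smooth_on (c ` V) (\<lambda>x. c (inv_into V c x))"
    using chart_transition[OF N V(1) V(1)] by (simp add: o_def)
  then have "smooth_on (c ` V) (\<lambda>x. (c \<circ> F) (H (inv_into V c x)))"
    by (rule smooth_on_cong[OF chart_open_image[OF N V(1)], rotated])
      (use chart_inv[OF N V(1)] FHy chart_subset[OF N V(1)] in auto)
  moreover have "H ` V \<subseteq> ?U"
    using chart_subset[OF N V(1)] FHy continuous_map_funspace[OF cH] by auto
  ultimately show "\<exists>U c V d W. (U, c) \<in> charts N \<and> (V, d) \<in> charts Q \<and> openin (mtop N) W \<and> y \<in> W \<and>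
      W \<subseteq> U \<and> H ` W \<subseteq> V \<and> smooth_on (c ` W) (\<lambda>x. d (H (inv_into U c x)))"
    using U V chart_openin[OF N V(1)] by blast
qed

end

text \<open>The library's \<open>group_action\<close> is a homomorphism into the group of bijections
  of \<open>E\<close>. Bijectivity of \<open>act g\<close> comes from its two-sided inverse
  \<open>act (inv g)\<close>, and extensionality makes equality on \<open>E\<close> an equality of
  functions.\<close>

lemma group_actionI:
  assumes G: "group G"
    and ext: "\<And>g. g \<in> carrier G \<Longrightarrow> act g \<in> extensional E"
    and closed: "\<And>g x. g \<in> carrier G \<Longrightarrow> x \<in> E \<Longrightarrow> act g x \<in> E"
    and one: "\<And>x. x \<in> E \<Longrightarrow> act \<one>\<^bsub>G\<^esub> x = x"
    and mult: "\<And>g h x. g \<in> carrier G \<Longrightarrow> h \<in> carrier G \<Longrightarrow> x \<in> E \<Longrightarrow>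
      act (g \<otimes>\<^bsub>G\<^esub> h) x = act g (act h x)"
  shows "group_action G E act"
proof -
  interpret group G by (rule G)
  have inv: "act (inv\<^bsub>G\<^esub> g) (act g x) = x" "act g (act (inv\<^bsub>G\<^esub> g) x) = x"
    if "g \<in> carrier G" "x \<in> E" for g x
    using that mult[of "inv\<^bsub>G\<^esub> g" g x] mult[of g "inv\<^bsub>G\<^esub> g" x] one by auto
  have Bij: "act g \<in> Bij E" if g: "g \<in> carrier G" for g
    unfolding Bij_def
  proof (intro IntI ext g CollectI)
    show "bij_betw (act g) E E"
      by (rule bij_betwI[where g = "act (inv\<^bsub>G\<^esub> g)"]) (use g inv closed in auto)
  qed
  have "act \<in> hom G (BijGroup E)"
  proof (rule homI)
    show "act g \<in> carrier (BijGroup E)" if "g \<in> carrier G" for g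
      using Bij[OF that] by (simp add: BijGroup_def)
    show "act (g \<otimes>\<^bsub>G\<^esub> h) = act g \<otimes>\<^bsub>BijGroup E\<^esub> act h" if g: "g \<in> carrier G" and h: "h \<in> carrier G" for g h
    proof -
      have "act (g \<otimes>\<^bsub>G\<^esub> h) = compose E (act g) (act h)"
        by (rule extensionalityI[of _ E]) (use g h ext mult in \<open>auto simp: compose_def\<close>)
      then show ?thesis using Bij[OF g] Bij[OF h] by (simp add: BijGroup_def)
    qed
  qed
  then show ?thesis
    by (simp add: group_action_def group_hom_def group_hom_axioms_def G group_BijGroup)
qed


section \<open>Gluing\<close>

lemma topspace_quotient_topology:
  assumes "disjoint C" "openin X (\<Union>C)"
  shows "topspace (quotient_topology X C) = C"
  using assms by (auto simp: topspace_def openin_quotient_topology)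

text \<open>The case \<open>k = i\<close> of \<open>cocycle\<close> makes \<open>f j i\<close> the
  inverse of \<open>f i j\<close>. As \<open>I\<close> may be uncountable, second countability of
  the glued space rests on \<open>countable_cover\<close>. The model space has its own assumption
  because for empty \<open>I\<close> the pieces say nothing about it.\<close>

locale gluing =
  fixes I :: "'i set" and X :: "'i \<Rightarrow> ('a, 'e::real_normed_vector) smooth_space"
    and A :: "'i \<Rightarrow> 'i \<Rightarrow> 'a set" and f :: "'i \<Rightarrow> 'i \<Rightarrow> 'a \<Rightarrow> 'a"
  assumes premanifold: "i \<in> I \<Longrightarrow> smooth_premanifold (X i)"
    and A_open: "i \<in> I \<Longrightarrow> j \<in> I \<Longrightarrow> openin (mtop (X i)) (A i j)"
    and A_refl: "i \<in> I \<Longrightarrow> A i i = points (X i)"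
    and f_refl: "i \<in> I \<Longrightarrow> x \<in> points (X i) \<Longrightarrow> f i i x = x"
    and f_in: "i \<in> I \<Longrightarrow> j \<in> I \<Longrightarrow> x \<in> A i j \<Longrightarrow> f i j x \<in> A j i"
    and cocycle: "i \<in> I \<Longrightarrow> j \<in> I \<Longrightarrow> k \<in> I \<Longrightarrow> x \<in> A i j \<Longrightarrow> f i j x \<in> A j k \<Longrightarrow>
      x \<in> A i k \<and> f j k (f i j x) = f i k x"
    and f_smooth: "i \<in> I \<Longrightarrow> j \<in> I \<Longrightarrow>
      smooth_map (open_submanifold (X i) (A i j)) (X j) (f i j)"
    and model_finite_dimensional: "finite_dimensional TYPE('e)"
    and countable_cover: "\<exists>J\<subseteq>I. countable J \<and> (\<forall>i\<in>I. \<forall>x\<in>points (X i). \<exists>j\<in>J. x \<in> A i j)"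
begin

abbreviation N :: "(('i \<times> 'a) set, 'e) smooth_space" where "N \<equiv> glue I X A f"

definition cls :: "'i \<Rightarrow> 'a \<Rightarrow> ('i \<times> 'a) set" where "cls i x = glue_equiv I A f `` {(i, x)}"

text \<open>The form with \<open>THE\<close> is the one used by the charts in \<open>glue\<close>.
  It is determined for classes that meet piece \<open>i\<close>, since a class has at most one
  representative there.\<close>

definition rep :: "'i \<Rightarrow> ('i \<times> 'a) set \<Rightarrow> 'a" where "rep i p = (THE x. (i, x) \<in> p)"

abbreviation piece :: "'i \<Rightarrow> ('i \<times> 'a) set set" where "piece i \<equiv> cls i ` points (X i)"

lemma A_subset: "i \<in> I \<Longrightarrow> j \<in> I \<Longrightarrow> A i j \<subseteq> points (X i)"
  by (rule openin_subset[OF A_open])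

lemma f_points: "i \<in> I \<Longrightarrow> j \<in> I \<Longrightarrow> x \<in> A i j \<Longrightarrow> f i j x \<in> points (X j)"
  using f_in A_subset by blast

lemma f_inverse: "i \<in> I \<Longrightarrow> j \<in> I \<Longrightarrow> x \<in> A i j \<Longrightarrow> f j i (f i j x) = x"
  using cocycle[of i j i x] f_in[of i j x] f_refl A_subset by (simp add: subset_iff)

text \<open>The cocycle condition makes the generating relation symmetric and transitive already, so
  the generated equivalence adds only the diagonal. The diagonal has to be listed because it also
  contains pairs that are no points of any piece.\<close>

lemma glue_equiv_iff:
  "((i, x), (j, y)) \<in> glue_equiv I A f \<longleftrightarrow>
    (i, x) = (j, y) \<or> i \<in> I \<and> j \<in> I \<and> x \<in> A i j \<and> y = f i j x"
proof -
  let ?r = "\<lambda>(i, x) (j, y). i \<in> I \<and> j \<in> I \<and> x \<in> A i j \<and> y = f i j x"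
  have sym: "?r v u" if "?r u v" for u v
    using that f_in f_inverse by (auto split: prod.splits)
  have trans: "?r u w" if "?r u v" "?r v w" for u v w
    using that cocycle by (auto split: prod.splits)
  have "u = v \<or> ?r u v" if "equivclp ?r u v" for u v
    using that
  proof (induction rule: equivclp_induct)
    case base
    then show ?case by simp
  next
    case (step v w)
    then have "?r v w" using sym by blast
    with step.IH show ?case using trans by blast
  qed
  moreover have "equivclp ?r u v" if "u = v \<or> ?r u v" for u v
    using that by (auto intro: r_into_equivclp)
  ultimately have "equivclp ?r u v \<longleftrightarrow> u = v \<or> ?r u v" for u v by blast
  then show ?thesis by (simp add: glue_equiv_def)
qed

lemma mem_cls:
  "i \<in> I \<Longrightarrow> x \<in> points (X i) \<Longrightarrow> (j, y) \<in> cls i x \<longleftrightarrow> j \<in> I \<and> x \<in> A i j \<and> y = f i j x"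
  using A_refl f_refl by (auto simp: cls_def glue_equiv_iff)

lemma cls_self: "i \<in> I \<Longrightarrow> x \<in> points (X i) \<Longrightarrow> (i, x) \<in> cls i x"
  by (simp add: mem_cls A_refl f_refl)

lemma cls_f:
  assumes "i \<in> I" "j \<in> I" "x \<in> A i j"
  shows "cls j (f i j x) = cls i x"
proof -
  have x: "x \<in> points (X i)" "f i j x \<in> points (X j)"
    using assms A_subset f_points by blast+
  have "(k, z) \<in> cls j (f i j x) \<longleftrightarrow> (k, z) \<in> cls i x" for k z
    using cocycle[OF assms(1,2) _ assms(3), of k] cocycle[OF assms(2,1) _ f_in[OF assms], of k]
      f_inverse[OF assms] by (auto simp: mem_cls[OF assms(1) x(1)] mem_cls[OF assms(2) x(2)])
  then show ?thesis by auto
qed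

lemma cls_eq_iff:
  assumes "i \<in> I" "j \<in> I" "x \<in> points (X i)" "y \<in> points (X j)"
  shows "cls i x = cls j y \<longleftrightarrow> x \<in> A i j \<and> y = f i j x"
  using cls_f[OF assms(1,2)] cls_self[OF assms(2,4)] mem_cls[OF assms(1,3), of j y] by auto

lemma rep_cls_overlap:
  "i \<in> I \<Longrightarrow> j \<in> I \<Longrightarrow> x \<in> A i j \<Longrightarrow> rep j (cls i x) = f i j x"
  using A_subset[of i j] by (auto simp: rep_def mem_cls subset_iff)

lemma rep_cls [simp]: "i \<in> I \<Longrightarrow> x \<in> points (X i) \<Longrightarrow> rep i (cls i x) = x"
  by (simp add: rep_cls_overlap A_refl f_refl)

definition glued :: "('i \<times> 'a) set set" where
  "glued = quotient (Sigma I (\<lambda>i. points (X i))) (glue_equiv I A f)"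

lemma glued_eq: "glued = (\<Union>i\<in>I. piece i)"
  by (auto simp: glued_def quotient_def cls_def)

lemma glued_memD:
  assumes "p \<in> glued" "(i, x) \<in> p"
  shows "i \<in> I \<and> x \<in> points (X i) \<and> p = cls i x"
proof -
  obtain j y where j: "j \<in> I" "y \<in> points (X j)" "p = cls j y"
    using assms(1) by (auto simp: glued_eq)
  then have "i \<in> I" "y \<in> A j i" "x = f j i y" using assms(2) mem_cls by auto
  then show ?thesis using j f_points cls_f by auto
qed

lemma disjoint_glued: "disjoint glued"
  unfolding disjoint_def
proof (intro ballI impI)
  fix p q assume pq: "p \<in> glued" "q \<in> glued" "p \<noteq> q"
  have False if "(i, x) \<in> p" "(i, x) \<in> q" for i x
    using glued_memD[OF pq(1) that(1)] glued_memD[OF pq(2) that(2)] pq(3) by simp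
  then show "p \<inter> q = {}" by auto
qed

lemma Union_glued: "\<Union>glued = (SIGMA i:I. points (X i))"
proof (rule Set.set_eqI)
  fix z :: "'i \<times> 'a"
  obtain i x where z: "z = (i, x)" by (cases z)
  show "z \<in> \<Union>glued \<longleftrightarrow> z \<in> (SIGMA i:I. points (X i))"
  proof
    assume "z \<in> \<Union>glued"
    then show "z \<in> (SIGMA i:I. points (X i))" using glued_memD by (auto simp: z)
  next
    assume "z \<in> (SIGMA i:I. points (X i))"
    then have "i \<in> I" "x \<in> points (X i)" by (auto simp: z)
    then show "z \<in> \<Union>glued"
      using cls_self by (intro UnionI[of "cls i x"]) (auto simp: z glued_eq)
  qed
qed

section \<open>Topology of the glued space\<close>

text \<open>The slice at \<open>i\<close> of a union of classes consists of the points whose class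
  belongs to the given set. This turns the quotient topology of the disjoint union into a test on
  each piece.\<close>

lemma openin_N:
  "openin (mtop N) W \<longleftrightarrow> W \<subseteq> glued \<and> (\<forall>i\<in>I. openin (mtop (X i)) {x \<in> points (X i). cls i x \<in> W})"
proof -
  have "{x. (i, x) \<in> \<Union>W} = {x \<in> points (X i). cls i x \<in> W}" if "W \<subseteq> glued" "i \<in> I" for i
  proof (intro equalityI subsetI)
    fix x assume "x \<in> {x. (i, x) \<in> \<Union>W}"
    then obtain p where "p \<in> W" "(i, x) \<in> p" by auto
    then show "x \<in> {x \<in> points (X i). cls i x \<in> W}"
      using glued_memD[of p i x] that(1) by auto
  next
    fix x assume "x \<in> {x \<in> points (X i). cls i x \<in> W}"
    then show "x \<in> {x. (i, x) \<in> \<Union>W}" using cls_self[OF that(2), of x] by auto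
  qed
  moreover have "\<Union>W \<subseteq> (SIGMA i:I. points (X i))" if "W \<subseteq> glued"
    using that Union_glued by auto
  ultimately show ?thesis
    unfolding glue_def
    by (simp add: openin_quotient_topology[OF disjoint_glued] openin_sum_topology
        comp_def flip: glued_def cong: conj_cong)
qed

lemma points_N: "points N = glued"
proof -
  have "openin (sum_topology (\<lambda>i. mtop (X i)) I) (\<Union>glued)"
    using openin_topspace[of "sum_topology (\<lambda>i. mtop (X i)) I"] by (simp add: Union_glued comp_def)
  then show ?thesis
    unfolding glue_def by (simp add: topspace_quotient_topology[OF disjoint_glued] flip: glued_def)
qed

lemma cls_in: "i \<in> I \<Longrightarrow> x \<in> points (X i) \<Longrightarrow> cls i x \<in> points N"
  by (auto simp: points_N glued_eq)

lemma pointsE: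
  assumes "p \<in> points N"
  obtains i x where "i \<in> I" "x \<in> points (X i)" "p = cls i x"
  using assms by (auto simp: points_N glued_eq)

text \<open>Seen in piece \<open>j\<close>, the image of \<open>W\<close> is the preimage of
  \<open>W\<close> under the gluing map \<open>f j i\<close> on \<open>A j i\<close>, which is open
  by continuity. Hence pieces sit in the glued space as open subsets.\<close>

lemma openin_cls_image:
  assumes i: "i \<in> I" and W: "openin (mtop (X i)) W"
  shows "openin (mtop N) (cls i ` W)"
  unfolding openin_N
proof (intro conjI ballI)
  have sub: "W \<subseteq> points (X i)" using W by (rule openin_subset)
  then show "cls i ` W \<subseteq> glued" using i by (auto simp: glued_eq)
  fix j assume j: "j \<in> I"
  have "{x \<in> points (X j). cls j x \<in> cls i ` W} = {x \<in> A j i. f j i x \<in> W}"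
  proof (intro equalityI subsetI)
    fix x assume "x \<in> {x \<in> points (X j). cls j x \<in> cls i ` W}"
    then obtain y where "x \<in> points (X j)" "y \<in> W" "cls j x = cls i y" by auto
    then show "x \<in> {x \<in> A j i. f j i x \<in> W}"
      using cls_eq_iff[OF j i, of x y] sub by auto
  next
    fix x assume x: "x \<in> {x \<in> A j i. f j i x \<in> W}"
    then have "cls j x = cls i (f j i x)" using cls_f[OF j i, of x] by simp
    then show "x \<in> {x \<in> points (X j). cls j x \<in> cls i ` W}"
      using x A_subset[OF j i] by auto
  qed
  moreover have "points (open_submanifold (X j) (A j i)) = A j i"
    using A_subset[OF j i] by auto
  then have "openin (mtop (X j)) {x \<in> A j i. f j i x \<in> W}"
    using smooth_map_openin_preimage[OF f_smooth[OF j i] W]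
    by (simp only: mtop_open_submanifold openin_open_subtopology[OF A_open[OF j i]])
  ultimately show "openin (mtop (X j)) {x \<in> points (X j). cls j x \<in> cls i ` W}" by simp
qed

lemma openin_piece: "i \<in> I \<Longrightarrow> openin (mtop N) (piece i)"
  by (rule openin_cls_image) auto

lemma continuous_map_from_glue:
  assumes "\<And>i. i \<in> I \<Longrightarrow> continuous_map (mtop (X i)) Y (\<lambda>x. h (cls i x))"
  shows "continuous_map (mtop N) Y h"
  unfolding continuous_map_def
proof (intro conjI allI impI)
  show "h \<in> points N \<rightarrow> topspace Y"
    using assms continuous_map_funspace by (fastforce elim!: pointsE)
  fix V assume V: "openin Y V"
  have "{x \<in> points (X i). cls i x \<in> {p \<in> points N. h p \<in> V}} = {x \<in> points (X i). h (cls i x) \<in> V}"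
    if "i \<in> I" for i
    using cls_in[OF that] by auto
  then show "openin (mtop N) {p \<in> points N. h p \<in> V}"
    using openin_continuous_map_preimage[OF assms V] by (auto simp: openin_N points_N)
qed

lemma continuous_rep:
  assumes i: "i \<in> I" and V: "V \<subseteq> points (X i)"
  shows "continuous_map (subtopology (mtop N) (cls i ` V)) (subtopology (mtop (X i)) V) (rep i)"
proof -
  have "continuous_map (subtopology (mtop N) (cls i ` V)) (mtop (X i)) (rep i)"
    unfolding continuous_map_def
  proof (intro conjI allI impI)
    show "rep i \<in> topspace (subtopology (mtop N) (cls i ` V)) \<rightarrow> points (X i)"
      using i V by auto
    fix W assume W: "openin (mtop (X i)) W"
    have "{p \<in> topspace (subtopology (mtop N) (cls i ` V)). rep i p \<in> W} = cls i ` W \<inter> cls i ` V"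
      using i V cls_in[OF i] openin_subset[OF W] by (auto simp: subset_iff)
    then show "openin (subtopology (mtop N) (cls i ` V))
        {p \<in> topspace (subtopology (mtop N) (cls i ` V)). rep i p \<in> W}"
      using openin_cls_image[OF i W] by (auto simp: openin_subtopology)
  qed
  then show ?thesis using i V by (auto simp: continuous_map_in_subtopology subset_iff)
qed

section \<open>Smooth structure of the glued space\<close>

lemma charts_N:
  "(W, e) \<in> charts N \<longleftrightarrow>
    (\<exists>i V c. i \<in> I \<and> (V, c) \<in> charts (X i) \<and> W = cls i ` V \<and> e = (\<lambda>p. c (rep i p)))"
  by (auto simp: glue_def cls_def rep_def)

text \<open>The pieces with index in a countable \<open>J\<close> cover the glued space, and images
  of open sets of a piece are open. So the images of countable bases of these pieces together form a
  countable base.\<close>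

lemma second_countable_N: "second_countable (mtop N)"
proof -
  obtain J where J: "J \<subseteq> I" "countable J" "\<And>i x. i \<in> I \<Longrightarrow> x \<in> points (X i) \<Longrightarrow> \<exists>j\<in>J. x \<in> A i j"
    using countable_cover by auto
  have "\<exists>\<B>. countable \<B> \<and> (\<forall>B\<in>\<B>. openin (mtop (X i)) B) \<and>
      (\<forall>U x. openin (mtop (X i)) U \<and> x \<in> U \<longrightarrow> (\<exists>B\<in>\<B>. x \<in> B \<and> B \<subseteq> U))" if "i \<in> I" for i
    using premanifold[OF that] by (simp add: smooth_premanifold_def second_countable_space_def)
  then obtain \<B> where \<B>: "\<And>i. i \<in> I \<Longrightarrow> countable (\<B> i)"
    "\<And>i B. i \<in> I \<Longrightarrow> B \<in> \<B> i \<Longrightarrow> openin (mtop (X i)) B"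
    "\<And>i U x. i \<in> I \<Longrightarrow> openin (mtop (X i)) U \<Longrightarrow> x \<in> U \<Longrightarrow> \<exists>B\<in>\<B> i. x \<in> B \<and> B \<subseteq> U"
    by metis
  show ?thesis
    unfolding second_countable_def
  proof (intro exI[of _ "\<Union>j\<in>J. (\<lambda>B. cls j ` B) ` \<B> j"] conjI ballI allI impI)
    show "countable (\<Union>j\<in>J. (\<lambda>B. cls j ` B) ` \<B> j)"
      using J(1,2) \<B>(1) by (intro countable_UN countable_image) auto
    show "openin (mtop N) V" if "V \<in> (\<Union>j\<in>J. (\<lambda>B. cls j ` B) ` \<B> j)" for V
      using that J(1) \<B>(2) openin_cls_image by auto
    fix W p assume W: "openin (mtop N) W \<and> p \<in> W"
    then have "p \<in> points N" using openin_subset by blast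
    then obtain i x where i: "i \<in> I" "x \<in> points (X i)" "p = cls i x" by (rule pointsE)
    then obtain j where j: "j \<in> J" "x \<in> A i j" using J(3) by blast
    then have jI: "j \<in> I" and y: "f i j x \<in> points (X j)" "p = cls j (f i j x)"
      using J(1) i f_points cls_f by auto
    have "openin (mtop (X j)) {y \<in> points (X j). cls j y \<in> W}"
      using W jI by (auto simp: openin_N)
    then obtain B where "B \<in> \<B> j" "f i j x \<in> B" "B \<subseteq> {y \<in> points (X j). cls j y \<in> W}"
      using \<B>(3)[OF jI, of "{y \<in> points (X j). cls j y \<in> W}" "f i j x"] y W by auto
    then show "\<exists>V\<in>\<Union>j\<in>J. (\<lambda>B. cls j ` B) ` \<B> j. p \<in> V \<and> V \<subseteq> W"
      using j(1) y(2) by (intro bexI[of _ "cls j ` B"]) auto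
  qed
qed

lemma inv_into_glued_chart:
  assumes i: "i \<in> I" and V: "(V, c) \<in> charts (X i)" and x: "x \<in> V"
  shows "inv_into (cls i ` V) (\<lambda>p. c (rep i p)) (c x) = cls i x"
proof -
  have sub: "V \<subseteq> points (X i)" using chart_subset[OF premanifold[OF i] V] .
  have "inj_on (\<lambda>p. c (rep i p)) (cls i ` V)"
    using chart_inj[OF premanifold[OF i] V] i sub by (auto simp: inj_on_def subset_iff)
  then have "inv_into (cls i ` V) (\<lambda>p. c (rep i p)) (c (rep i (cls i x))) = cls i x"
    using x by (intro inv_into_f_f) auto
  then show ?thesis using i sub x by (simp add: subset_iff)
qed

text \<open>Between charts from pieces \<open>i\<close> and \<open>j\<close> the transition map is
  the coordinate expression of \<open>f i j\<close>, so compatibility of the glued charts is the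
  smoothness of the gluing maps.\<close>

lemma premanifold_N: "smooth_premanifold N"
proof -
  have "smooth_atlas (mtop N) (charts N)"
  proof (rule smooth_atlasI)
    fix W e assume "(W, e) \<in> charts N"
    then obtain i V c where i: "i \<in> I" and V: "(V, c) \<in> charts (X i)"
      and We: "W = cls i ` V" "e = (\<lambda>p. c (rep i p))"
      by (auto simp: charts_N)
    note Xi = premanifold[OF i]
    have sub: "V \<subseteq> points (X i)" using chart_subset[OF Xi V] .
    show "openin (mtop N) W"
      unfolding We by (rule openin_cls_image[OF i chart_openin[OF Xi V]])
    show inj: "inj_on e W"
      using chart_inj[OF Xi V] i sub by (auto simp: We inj_on_def subset_iff)
    show "continuous_map (subtopology (mtop N) W) euclidean e"
      unfolding We
      using continuous_map_compose[OF continuous_rep[OF i sub] chart_continuous[OF Xi V]]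
      by (simp add: o_def)
    show "open (e ` T)" if T: "openin (mtop N) T" "T \<subseteq> W" for T
    proof -
      have "e ` T = c ` (V \<inter> {x \<in> points (X i). cls i x \<in> T})"
        using T(2) i sub by (force simp: We image_iff subset_iff)
      moreover have "openin (mtop (X i)) (V \<inter> {x \<in> points (X i). cls i x \<in> T})"
        using T(1) i chart_openin[OF Xi V] by (intro openin_Int) (auto simp: openin_N)
      ultimately show ?thesis using chart_openin_image[OF Xi V] by auto
    qed
    fix W' e' assume "(W', e') \<in> charts N"
    then obtain j V' c' where j: "j \<in> I" and V': "(V', c') \<in> charts (X j)"
      and We': "W' = cls j ` V'" "e' = (\<lambda>p. c' (rep j p))"
      by (auto simp: charts_N)
    note Xj = premanifold[OF j]
    have sub': "V' \<subseteq> points (X j)" using chart_subset[OF Xj V'] .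
    \<comment> \<open>The overlap of the two glued charts, seen in piece \<open>i\<close>: a class
      lies in both exactly when \<open>f i j\<close> carries its representative in \<open>V\<close>
      into \<open>V'\<close>.\<close>
    define S where "S = V \<inter> {x \<in> points (open_submanifold (X i) (A i j)). f i j x \<in> V'}"
    have S: "x \<in> V" "x \<in> A i j" "f i j x \<in> V'" if "x \<in> S" for x
      using that by (auto simp: S_def)
    have "W \<inter> W' = cls i ` S"
    proof (intro equalityI subsetI)
      fix p assume "p \<in> W \<inter> W'"
      then obtain x y where "x \<in> V" "y \<in> V'" "p = cls i x" "p = cls j y" by (auto simp: We We')
      then show "p \<in> cls i ` S"
        using cls_eq_iff[OF i j, of x y] sub sub' by (auto simp: S_def)
    next
      fix p assume "p \<in> cls i ` S"
      then obtain x where x: "x \<in> S" "p = cls i x" by auto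
      then have "p = cls j (f i j x)" using S cls_f[OF i j] by simp
      then show "p \<in> W \<inter> W'" using S[OF x(1)] x(2) by (auto simp: We We')
    qed
    moreover have "e ` cls i ` S = c ` S"
      using S sub i by (force simp: We image_image subset_iff cong: image_cong_simp)
    ultimately have img: "e ` (W \<inter> W') = c ` S" by simp
    have "openin (mtop (X i)) {x \<in> points (open_submanifold (X i) (A i j)). f i j x \<in> V'}"
      using smooth_map_openin_preimage[OF f_smooth[OF i j] chart_openin[OF Xj V']]
      by (simp add: mtop_open_submanifold openin_open_subtopology[OF A_open[OF i j]])
    then have "openin (mtop (X i)) S"
      unfolding S_def by (intro openin_Int chart_openin[OF Xi V])
    then have op: "open (c ` S)" by (rule chart_openin_image[OF Xi V]) (auto simp: S_def)
    have "(V \<inter> A i j, c) \<in> charts (open_submanifold (X i) (A i j))"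
      using V by (force simp: charts_open_submanifold)
    from smooth_mapD[OF f_smooth[OF i j] this V']
    have "smooth_on (c ` S) (\<lambda>z. c' (f i j (inv_into (V \<inter> A i j) c z)))"
      by (rule smooth_on_subset) (use S in auto)
    then show "smooth_on (e ` (W \<inter> W')) (e' \<circ> inv_into W e)"
      unfolding img
    proof (rule smooth_on_cong[OF op, rotated])
      fix z assume "z \<in> c ` S"
      then obtain x where x: "z = c x" "x \<in> S" by auto
      have "inv_into (V \<inter> A i j) c (c x) = x"
        by (rule inv_into_inj_subset[OF chart_inj[OF Xi V]]) (use S[OF x(2)] in auto)
      moreover have "inv_into W e (c x) = cls i x"
        unfolding We by (rule inv_into_glued_chart[OF i V S(1)[OF x(2)]])
      ultimately show "c' (f i j (inv_into (V \<inter> A i j) c z)) = (e' \<circ> inv_into W e) z"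
        using S[OF x(2)] rep_cls_overlap[OF i j] by (simp add: x(1) We')
    qed
  next
    fix p assume "p \<in> points N"
    then obtain i x where i: "i \<in> I" "x \<in> points (X i)" "p = cls i x" by (rule pointsE)
    obtain V c where V: "(V, c) \<in> charts (X i)" "x \<in> V"
      using chart_exists[OF premanifold[OF i(1)] i(2)] .
    then have "(cls i ` V, \<lambda>p. c (rep i p)) \<in> charts N"
      using i(1) by (auto simp: charts_N)
    then show "\<exists>(U, c)\<in>charts N. p \<in> U"
      using V(2) i(3) by (intro bexI[of _ "(cls i ` V, \<lambda>p. c (rep i p))"]) auto
  qed
  then show ?thesis
    using model_finite_dimensional second_countable_N
    by (simp add: smooth_premanifold_def second_countable_space_iff finite_dimensional_def)
qed

lemma smooth_cls:
  assumes i: "i \<in> I"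
  shows "smooth_map (X i) N (cls i)"
proof (rule smooth_mapI[OF premanifold[OF i] premanifold_N])
  fix x assume "x \<in> points (X i)"
  then obtain V c where V: "(V, c) \<in> charts (X i)" "x \<in> V"
    using chart_exists[OF premanifold[OF i]] by metis
  have sub: "V \<subseteq> points (X i)" using chart_subset[OF premanifold[OF i] V(1)] .
  have "smooth_on (c ` V) (\<lambda>z. c (inv_into V c z))"
    using chart_transition[OF premanifold[OF i] V(1) V(1)] by (simp add: o_def)
  then have "smooth_on (c ` V) (\<lambda>z. c (rep i (cls i (inv_into V c z))))"
    by (rule smooth_on_cong[OF chart_open_image[OF premanifold[OF i] V(1)], rotated])
      (use chart_inv[OF premanifold[OF i] V(1)] sub i in auto)
  moreover have "(cls i ` V, \<lambda>p. c (rep i p)) \<in> charts N"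
    using V(1) i by (auto simp: charts_N)
  ultimately show "\<exists>U c V d W. (U, c) \<in> charts (X i) \<and> (V, d) \<in> charts N \<and> openin (mtop (X i)) W \<and>
      x \<in> W \<and> W \<subseteq> U \<and> cls i ` W \<subseteq> V \<and> smooth_on (c ` W) (\<lambda>z. d (cls i (inv_into U c z)))"
    using V chart_openin[OF premanifold[OF i] V(1)]
    by (intro exI[of _ V] exI[of _ c] exI[of _ "cls i ` V"] exI[of _ "\<lambda>p. c (rep i p)"]) auto
qed

lemma smooth_rep:
  assumes i: "i \<in> I"
  shows "smooth_map (open_submanifold N (piece i)) (X i) (rep i)"
proof (rule smooth_mapI[OF smooth_premanifold_open_submanifold[OF premanifold_N openin_piece[OF i]]
      premanifold[OF i]])
  fix p assume "p \<in> points (open_submanifold N (piece i))"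
  then obtain x where x: "x \<in> points (X i)" "p = cls i x" by auto
  obtain V c where V: "(V, c) \<in> charts (X i)" "x \<in> V"
    using chart_exists[OF premanifold[OF i] x(1)] .
  have sub: "V \<subseteq> points (X i)" using chart_subset[OF premanifold[OF i] V(1)] .
  let ?W = "cls i ` V" and ?e = "\<lambda>p. c (rep i p)"
  have W: "(?W, ?e) \<in> charts N" using V(1) i by (auto simp: charts_N)
  have "?W \<inter> piece i = ?W" using sub by auto
  then have W': "(?W, ?e) \<in> charts (open_submanifold N (piece i))"
    using W unfolding charts_open_submanifold by (intro rev_image_eqI) auto
  have op: "openin (mtop (open_submanifold N (piece i))) ?W"
    using chart_openin[OF smooth_premanifold_open_submanifold[OF premanifold_N openin_piece[OF i]] W'] .
  have "smooth_on (?e ` ?W) (\<lambda>z. c (rep i (inv_into ?W ?e z)))"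
    using chart_transition[OF premanifold_N W W] by (simp add: o_def)
  moreover have "rep i ` ?W \<subseteq> V" using i sub by (auto simp: subset_iff)
  ultimately show "\<exists>U c V d W. (U, c) \<in> charts (open_submanifold N (piece i)) \<and> (V, d) \<in> charts (X i) \<and>
      openin (mtop (open_submanifold N (piece i))) W \<and> p \<in> W \<and> W \<subseteq> U \<and> rep i ` W \<subseteq> V \<and>
      smooth_on (c ` W) (\<lambda>z. d (rep i (inv_into U c z)))"
    using V W' op x(2)
    by (intro exI[of _ ?W] exI[of _ ?e] exI[of _ V] exI[of _ c]) auto
qed

text \<open>On the open piece \<open>i\<close> the map \<open>h\<close> is its restriction to that
  piece preceded by \<open>rep i\<close>, the smooth inverse of \<open>cls i\<close>.\<close>

lemma smooth_map_from_glue: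
  assumes K: "smooth_premanifold K"
    and h: "\<And>i. i \<in> I \<Longrightarrow> smooth_map (X i) K (\<lambda>x. h (cls i x))"
  shows "smooth_map N K h"
proof (rule smooth_map_locally[OF premanifold_N K])
  fix p assume "p \<in> points N"
  then obtain i x where i: "i \<in> I" "x \<in> points (X i)" "p = cls i x" by (rule pointsE)
  have "smooth_map (open_submanifold N (piece i)) K (\<lambda>p. h (cls i (rep i p)))"
    by (rule smooth_map_compose[OF
          smooth_premanifold_open_submanifold[OF premanifold_N openin_piece[OF i(1)]]
          premanifold[OF i(1)] K smooth_rep[OF i(1)] h[OF i(1)]])
  then show "\<exists>W g. openin (mtop N) W \<and> p \<in> W \<and> smooth_map (open_submanifold N W) K g \<and> (\<forall>x\<in>W. g x = h x)"
    using openin_piece[OF i(1)] i by (intro exI[of _ "piece i"]) auto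
qed

text \<open>Classes with different images under \<open>h\<close> are separated by preimages. Classes
  with equal images have, by \<open>overlap\<close>, representatives in one piece; they are
  separated there, and \<open>cls i\<close> is injective and open. The lemma serves both
  \<open>P\<close> over \<open>M\<close> and \<open>M'\<close> over the orbit space of
  \<open>M\<close>.\<close>

lemma Hausdorff_glue:
  assumes Y: "Hausdorff_space Y" and h: "continuous_map (mtop N) Y h"
    and Xi: "\<And>i. i \<in> I \<Longrightarrow> Hausdorff_space (mtop (X i))"
    and overlap: "\<And>i j x y. i \<in> I \<Longrightarrow> j \<in> I \<Longrightarrow> x \<in> points (X i) \<Longrightarrow> y \<in> points (X j) \<Longrightarrow>
      h (cls i x) = h (cls j y) \<Longrightarrow> y \<in> A j i"
  shows "Hausdorff_space (mtop N)"
  unfolding Hausdorff_space_def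
proof (intro allI impI)
  fix p q assume pq: "p \<in> points N \<and> q \<in> points N \<and> p \<noteq> q"
  show "\<exists>U V. openin (mtop N) U \<and> openin (mtop N) V \<and> p \<in> U \<and> q \<in> V \<and> disjnt U V"
  proof (cases "h p = h q")
    case False
    moreover have "h p \<in> topspace Y" "h q \<in> topspace Y"
      using pq continuous_map_funspace[OF h] by auto
    ultimately obtain U V where UV: "openin Y U" "openin Y V" "h p \<in> U" "h q \<in> V" "disjnt U V"
      using Y[unfolded Hausdorff_space_def, rule_format, of "h p" "h q"] by auto
    then show ?thesis
      using openin_continuous_map_preimage[OF h UV(1)] openin_continuous_map_preimage[OF h UV(2)] pq
      by (intro exI[of _ "{p \<in> points N. h p \<in> U}"] exI[of _ "{p \<in> points N. h p \<in> V}"])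
        (auto simp: disjnt_iff)
  next
    case True
    obtain i x where i: "i \<in> I" "x \<in> points (X i)" "p = cls i x" using pq pointsE by metis
    obtain j y where j: "j \<in> I" "y \<in> points (X j)" "q = cls j y" using pq pointsE by metis
    define z where "z = f j i y"
    have "y \<in> A j i" using overlap i j True by blast
    then have z: "z \<in> points (X i)" "q = cls i z"
      using i(1) j f_points cls_f by (auto simp: z_def)
    then have "x \<noteq> z" using pq i(3) by auto
    then obtain U V where UV: "openin (mtop (X i)) U" "openin (mtop (X i)) V" "x \<in> U" "z \<in> V" "disjnt U V"
      using Xi[OF i(1), unfolded Hausdorff_space_def, rule_format, of x z] i(2) z(1) by auto
    have "disjnt (cls i ` U) (cls i ` V)"
    proof -
      have "u = v" if "u \<in> U" "v \<in> V" "cls i u = cls i v" for u v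
        using that openin_subset[OF UV(1)] openin_subset[OF UV(2)] rep_cls[OF i(1)]
        by (metis subsetD)
      then show ?thesis using UV(5) by (fastforce simp: disjnt_iff)
    qed
    then show ?thesis
      using openin_cls_image[OF i(1) UV(1)] openin_cls_image[OF i(1) UV(2)] UV(3,4) i(3) z(2)
      by (intro exI[of _ "cls i ` U"] exI[of _ "cls i ` V"]) auto
  qed
qed

end

section \<open>Patched actions on glued spaces\<close>

text \<open>One formula \<open>a\<close> is used on all pieces; preserving the overlaps and
  commuting with the gluing maps is what lets it descend to classes. The instances are the action on
  \<open>M'\<close>, the principal action and the star action.\<close>

locale gluing_action = gluing I X A f
  for I :: "'i set" and X :: "'i \<Rightarrow> ('a, 'e::real_normed_vector) smooth_space"
    and A :: "'i \<Rightarrow> 'i \<Rightarrow> 'a set" and f :: "'i \<Rightarrow> 'i \<Rightarrow> 'a \<Rightarrow> 'a" +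
  fixes G :: "'g monoid" and \<G> :: "('g, 'f::real_normed_vector) smooth_space" and a :: "'g \<Rightarrow> 'a \<Rightarrow> 'a"
  assumes lie: "lie_group G \<G>"
    and A_closed: "g \<in> carrier G \<Longrightarrow> i \<in> I \<Longrightarrow> j \<in> I \<Longrightarrow> x \<in> A i j \<Longrightarrow> a g x \<in> A i j"
    and a_one: "i \<in> I \<Longrightarrow> x \<in> points (X i) \<Longrightarrow> a \<one>\<^bsub>G\<^esub> x = x"
    and a_mult: "g \<in> carrier G \<Longrightarrow> h \<in> carrier G \<Longrightarrow> i \<in> I \<Longrightarrow> x \<in> points (X i) \<Longrightarrow>
      a (g \<otimes>\<^bsub>G\<^esub> h) x = a g (a h x)"
    and a_f: "g \<in> carrier G \<Longrightarrow> i \<in> I \<Longrightarrow> j \<in> I \<Longrightarrow> x \<in> A i j \<Longrightarrow> f i j (a g x) = a g (f i j x)"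
    and a_smooth: "i \<in> I \<Longrightarrow> smooth_map (product_manifold \<G> (X i)) (X i) (\<lambda>(g, x). a g x)"
begin

abbreviation pa :: "'g \<Rightarrow> ('i \<times> 'a) set \<Rightarrow> ('i \<times> 'a) set" where
  "pa \<equiv> patched_action (points N) a"

lemma group_G: "group G" and carrier_G: "carrier G = points \<G>"
  and premanifold_G: "smooth_premanifold \<G>"
  using lie by (auto simp: lie_group_def smooth_manifold_def)

lemma a_closed: "g \<in> carrier G \<Longrightarrow> i \<in> I \<Longrightarrow> x \<in> points (X i) \<Longrightarrow> a g x \<in> points (X i)"
  using A_closed[of g i i x] by (simp add: A_refl)

lemma A_closed_iff:
  assumes "g \<in> carrier G" "i \<in> I" "j \<in> I" "x \<in> points (X i)"
  shows "a g x \<in> A i j \<longleftrightarrow> x \<in> A i j"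
proof
  interpret group G by (rule group_G)
  assume "a g x \<in> A i j"
  then have "a (inv\<^bsub>G\<^esub> g) (a g x) \<in> A i j" using A_closed assms by simp
  moreover have "a (inv\<^bsub>G\<^esub> g) (a g x) = x"
    using a_mult[of "inv\<^bsub>G\<^esub> g" g i x] a_one assms by simp
  ultimately show "x \<in> A i j" by simp
qed (use A_closed assms in blast)

text \<open>For the image of a class to be a whole class, every representative of
  \<open>cls i (a g x)\<close> must be hit. This uses that \<open>a g x\<close> lies in an overlap
  only if \<open>x\<close> does, which \<open>A_closed_iff\<close> obtains from the inverse
  element.\<close>

lemma pa_cls:
  assumes "g \<in> carrier G" "i \<in> I" "x \<in> points (X i)"
  shows "pa g (cls i x) = cls i (a g x)"
proof -
  have "(j, y) \<in> (\<lambda>(i, x). (i, a g x)) ` cls i x \<longleftrightarrow> (j, y) \<in> cls i (a g x)" for j y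
    using mem_cls[OF assms(2,3)] mem_cls[OF assms(2) a_closed[OF assms]]
      A_closed_iff[OF assms(1,2) _ assms(3)] a_f[OF assms(1,2)]
    by (auto simp: image_iff split: prod.splits) force+
  then have "(\<lambda>(i, x). (i, a g x)) ` cls i x = cls i (a g x)"
    by (intro Set.set_eqI) (metis surj_pair)
  then show ?thesis using cls_in[OF assms(2,3)] by (simp add: patched_action_def)
qed

lemma pa_closed: "g \<in> carrier G \<Longrightarrow> p \<in> points N \<Longrightarrow> pa g p \<in> points N"
  by (elim pointsE) (simp add: pa_cls cls_in a_closed)

lemma pa_one: "p \<in> points N \<Longrightarrow> pa \<one>\<^bsub>G\<^esub> p = p"
  using group.is_monoid[OF group_G] by (elim pointsE) (simp add: pa_cls a_one monoid.one_closed)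

lemma pa_mult:
  assumes "g \<in> carrier G" "h \<in> carrier G" "p \<in> points N"
  shows "pa (g \<otimes>\<^bsub>G\<^esub> h) p = pa g (pa h p)"
proof -
  interpret group G by (rule group_G)
  show ?thesis using assms by (elim pointsE) (simp add: pa_cls a_mult a_closed)
qed

lemma pa_inv:
  assumes "g \<in> carrier G" "p \<in> points N"
  shows "pa g (pa (inv\<^bsub>G\<^esub> g) p) = p" "pa (inv\<^bsub>G\<^esub> g) (pa g p) = p"
proof -
  interpret group G by (rule group_G)
  show "pa g (pa (inv\<^bsub>G\<^esub> g) p) = p" "pa (inv\<^bsub>G\<^esub> g) (pa g p) = p"
    using assms pa_mult[of g "inv\<^bsub>G\<^esub> g" p] pa_mult[of "inv\<^bsub>G\<^esub> g" g p] pa_one by simp_all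
qed

lemma pa_group_action: "group_action G (points N) pa"
proof (rule group_actionI[OF group_G])
  show "pa g \<in> extensional (points N)" for g by (simp add: patched_action_def)
qed (simp_all add: pa_closed pa_one pa_mult)

lemma pa_smooth_action: "smooth_action G \<G> N pa"
proof -
  note GN = smooth_premanifold_product[OF premanifold_G premanifold_N]
  have "smooth_map (product_manifold \<G> N) N (\<lambda>(g, p). pa g p)"
  proof (rule smooth_map_locally[OF GN premanifold_N])
    fix z assume z: "z \<in> points (product_manifold \<G> N)"
    then obtain i x where i: "i \<in> I" "x \<in> points (X i)" "snd z = cls i x"
      by (auto elim: pointsE)
    \<comment> \<open>A piece is invariant, so a single index serves for a point and its image; on
      \<open>W\<close> the action is therefore \<open>cls i (a g (rep i p))\<close>, a composite of
      smooth maps.\<close>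
    define W where "W = carrier G \<times> piece i"
    have W: "openin (mtop (product_manifold \<G> N)) W"
      using openin_piece[OF i(1)]
      by (simp add: W_def mtop_product_manifold openin_prod_Times_iff carrier_G)
    let ?S = "open_submanifold (product_manifold \<G> N) W"
    note S = smooth_premanifold_open_submanifold[OF GN W]
    note Xi = premanifold[OF i(1)]
    note P = smooth_premanifold_open_submanifold[OF premanifold_N openin_piece[OF i(1)]]
    have 1: "smooth_map ?S \<G> fst"
      by (rule smooth_map_restrict_domain[OF GN premanifold_G
            smooth_map_fst[OF premanifold_G premanifold_N] W])
    have 2: "smooth_map ?S (open_submanifold N (piece i)) snd"
      by (rule smooth_map_restrict_codomain[OF S premanifold_N
            smooth_map_restrict_domain[OF GN premanifold_N smooth_map_snd[OF premanifold_G premanifold_N] W]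
            openin_piece[OF i(1)]]) (auto simp: W_def)
    have 3: "smooth_map ?S (product_manifold \<G> (X i)) (\<lambda>z. (fst z, rep i (snd z)))"
      by (rule smooth_map_Pair[OF S premanifold_G Xi 1 smooth_map_compose[OF S P Xi 2 smooth_rep[OF i(1)]]])
    have 4: "smooth_map ?S (X i) (\<lambda>z. (\<lambda>(g, x). a g x) (fst z, rep i (snd z)))"
      by (rule smooth_map_compose[OF S smooth_premanifold_product[OF premanifold_G Xi] Xi 3 a_smooth[OF i(1)]])
    have 5: "smooth_map ?S N (\<lambda>z. cls i ((\<lambda>(g, x). a g x) (fst z, rep i (snd z))))"
      by (rule smooth_map_compose[OF S Xi premanifold_N 4 smooth_cls[OF i(1)]])
    show "\<exists>W h. openin (mtop (product_manifold \<G> N)) W \<and> z \<in> W \<and>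
        smooth_map (open_submanifold (product_manifold \<G> N) W) N h \<and> (\<forall>z\<in>W. h z = (case z of (g, p) \<Rightarrow> pa g p))"
    proof (intro exI conjI)
      show "z \<in> W" using z i by (auto simp: W_def carrier_G mem_Times_iff)
      show "\<forall>z\<in>W. cls i ((\<lambda>(g, x). a g x) (fst z, rep i (snd z))) = (case z of (g, p) \<Rightarrow> pa g p)"
        using i(1) by (auto simp: W_def pa_cls)
    qed (fact W 5)+
  qed
  then show ?thesis using pa_group_action by (simp add: smooth_action_def)
qed

end


section \<open>Star-collections\<close>

lemma open_submanifold_twice:
  "open_submanifold (open_submanifold M V) W = open_submanifold M (V \<inter> W)"
  by (auto simp: open_submanifold_def subtopology_subtopology image_image case_prod_unfold Int_assoc
      intro!: image_cong)

lemma smooth_inclusion: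
  "smooth_premanifold M \<Longrightarrow> openin (mtop M) W \<Longrightarrow> smooth_map (open_submanifold M W) M (\<lambda>x. x)"
  by (rule smooth_map_restrict_domain[OF _ _ smooth_map_id])

text \<open>An open continuous surjection is a quotient map, so its fibres with the quotient
  topology form a copy of \<open>Y\<close>. The choice of a point in the fibre is harmless because
  \<open>\<Phi>\<close> is constant there.\<close>

lemma quotient_by_fibres:
  fixes X :: "'a topology" and Y :: "'b topology" and \<Phi> :: "'a \<Rightarrow> 'b"
  defines "H \<equiv> \<lambda>y. {x \<in> topspace X. \<Phi> x = y}"
  assumes cont: "continuous_map X Y \<Phi>" and op: "open_map X Y \<Phi>"
    and surj: "\<Phi> ` topspace X = topspace Y"
  shows "topspace (quotient_topology X (H ` topspace Y)) = H ` topspace Y"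
    and "homeomorphic_maps (quotient_topology X (H ` topspace Y)) Y (\<lambda>c. \<Phi> (SOME x. x \<in> c)) H"
proof -
  let ?C = "H ` topspace Y" and ?F = "\<lambda>c. \<Phi> (SOME x. x \<in> c)"
  have dis: "disjoint ?C" by (auto simp: disjoint_def H_def)
  have Un: "\<Union>?C = topspace X" using surj by (auto simp: H_def)
  then show top: "topspace (quotient_topology X ?C) = ?C"
    using topspace_quotient_topology[OF dis, of X] by simp
  have FH: "?F (H y) = y" if "y \<in> topspace Y" for y
  proof -
    have "y \<in> \<Phi> ` topspace X" using that surj by simp
    then obtain x where "x \<in> H y" by (auto simp: H_def)
    then have "(SOME x. x \<in> H y) \<in> H y" by (rule someI)
    then show ?thesis by (simp add: H_def)
  qed
  have "continuous_map (quotient_topology X ?C) Y ?F"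
    unfolding continuous_map_def
  proof (intro conjI allI impI)
    show "?F \<in> topspace (quotient_topology X ?C) \<rightarrow> topspace Y"
      unfolding top using FH by auto
    fix V assume V: "openin Y V"
    have "\<Union>{c \<in> ?C. ?F c \<in> V} = {x \<in> topspace X. \<Phi> x \<in> V}"
    proof (intro equalityI subsetI)
      fix x assume "x \<in> \<Union>{c \<in> ?C. ?F c \<in> V}"
      then obtain y where "y \<in> topspace Y" "x \<in> H y" "?F (H y) \<in> V" by auto
      then show "x \<in> {x \<in> topspace X. \<Phi> x \<in> V}" using FH by (simp add: H_def)
    next
      fix x assume x: "x \<in> {x \<in> topspace X. \<Phi> x \<in> V}"
      then have "\<Phi> x \<in> topspace Y" "x \<in> H (\<Phi> x)" using surj by (auto simp: H_def)
      then show "x \<in> \<Union>{c \<in> ?C. ?F c \<in> V}" using FH x by (intro UnionI[of "H (\<Phi> x)"]) auto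
    qed
    then show "openin (quotient_topology X ?C) {c \<in> topspace (quotient_topology X ?C). ?F c \<in> V}"
      using openin_continuous_map_preimage[OF cont V]
      by (auto simp: top openin_quotient_topology[OF dis])
  qed
  moreover have "continuous_map Y (quotient_topology X ?C) H"
    unfolding continuous_map_def
  proof (intro conjI allI impI)
    show "H \<in> topspace Y \<rightarrow> topspace (quotient_topology X ?C)" by (auto simp: top)
    fix \<U> assume "openin (quotient_topology X ?C) \<U>"
    then have U: "\<U> \<subseteq> ?C" "openin X (\<Union>\<U>)" by (auto simp: openin_quotient_topology[OF dis])
    \<comment> \<open>Openness of \<open>\<Phi>\<close> enters through this equation: the preimage
      of a set of fibres under \<open>H\<close> is the image of their union under
      \<open>\<Phi>\<close>.\<close>
    have "{y \<in> topspace Y. H y \<in> \<U>} = \<Phi> ` \<Union>\<U>"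
    proof (intro equalityI subsetI)
      fix y assume y: "y \<in> {y \<in> topspace Y. H y \<in> \<U>}"
      then obtain x where "x \<in> topspace X" "y = \<Phi> x" using surj by auto
      then have "x \<in> H y" by (simp add: H_def)
      then show "y \<in> \<Phi> ` \<Union>\<U>" using y \<open>y = \<Phi> x\<close> by blast
    next
      fix y assume "y \<in> \<Phi> ` \<Union>\<U>"
      then obtain x c where "x \<in> c" "c \<in> \<U>" "y = \<Phi> x" by auto
      moreover from this obtain z where "z \<in> topspace Y" "c = H z" using U(1) by auto
      ultimately show "y \<in> {y \<in> topspace Y. H y \<in> \<U>}" by (simp add: H_def)
    qed
    then show "openin Y {y \<in> topspace Y. H y \<in> \<U>}"
      using op U(2) by (simp add: open_map_def)
  qed
  ultimately show "homeomorphic_maps (quotient_topology X ?C) Y ?F H"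
    using FH by (auto simp: homeomorphic_maps_def top)
qed

section \<open>The data of a star-collection and the two gluings\<close>

locale star_gluing =
  fixes G :: "'g monoid" and \<G> :: "('g, 'f::real_normed_vector) smooth_space"
    and M :: "('m, 'e::real_normed_vector) smooth_space" and act :: "'g \<Rightarrow> 'm \<Rightarrow> 'm"
    and I :: "'i set" and U :: "'i \<Rightarrow> 'm set" and \<phi> :: "'i \<Rightarrow> 'i \<Rightarrow> 'm \<Rightarrow> 'g"
  assumes lie: "lie_group G \<G>" and M: "G_manifold G \<G> M act"
    and cover: "invariant_open_cover G M act I U" and star: "star_collection G \<G> M act I U \<phi>"
begin

sublocale grp: group G
  using lie by (simp add: lie_group_def)

lemma points_G [simp]: "points \<G> = carrier G" and premanifold_G: "smooth_premanifold \<G>"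
  and Hausdorff_G: "Hausdorff_space (mtop \<G>)"
  using lie by (auto simp: lie_group_def smooth_manifold_def)

lemma openin_carrier [simp]: "openin (mtop \<G>) (carrier G)"
  using openin_topspace[of "mtop \<G>"] by simp

lemma premanifold_M: "smooth_premanifold M" and Hausdorff_M: "Hausdorff_space (mtop M)"
  and action_M: "group_action G (points M) act"
  and smooth_act_M: "smooth_map (product_manifold \<G> M) M (\<lambda>(g, x). act g x)"
  using M by (auto simp: G_manifold_def smooth_manifold_def smooth_action_def)

lemma act_points: "g \<in> carrier G \<Longrightarrow> x \<in> points M \<Longrightarrow> act g x \<in> points M"
  using group_action.element_image[OF action_M] by blast

lemma act_one [simp]: "x \<in> points M \<Longrightarrow> act \<one>\<^bsub>G\<^esub> x = x"
  using group_action.id_eq_one[OF action_M] by (metis restrict_apply')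

lemma act_mult: "g \<in> carrier G \<Longrightarrow> h \<in> carrier G \<Longrightarrow> x \<in> points M \<Longrightarrow>
    act (g \<otimes>\<^bsub>G\<^esub> h) x = act g (act h x)"
  using group_action.composition_rule[OF action_M] by blast

lemma act_inv [simp]:
  assumes "g \<in> carrier G" "x \<in> points M"
  shows "act (inv\<^bsub>G\<^esub> g) (act g x) = x" "act g (act (inv\<^bsub>G\<^esub> g) x) = x"
  using assms act_mult[of "inv\<^bsub>G\<^esub> g" g x] act_mult[of g "inv\<^bsub>G\<^esub> g" x] by auto

lemma U_open: "i \<in> I \<Longrightarrow> openin (mtop M) (U i)"
  and U_act: "i \<in> I \<Longrightarrow> g \<in> carrier G \<Longrightarrow> x \<in> U i \<Longrightarrow> act g x \<in> U i"
  and U_cover: "(\<Union>i\<in>I. U i) = points M"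
  using cover by (auto simp: invariant_open_cover_def)

lemma U_points: "i \<in> I \<Longrightarrow> x \<in> U i \<Longrightarrow> x \<in> points M"
  using openin_subset[OF U_open] by blast

lemma U_act_iff:
  assumes "i \<in> I" "g \<in> carrier G" "x \<in> points M"
  shows "act g x \<in> U i \<longleftrightarrow> x \<in> U i"
  using U_act[OF assms(1), of "inv\<^bsub>G\<^esub> g" "act g x"] U_act[OF assms(1,2)] assms by auto

lemma phi_smooth: "i \<in> I \<Longrightarrow> j \<in> I \<Longrightarrow> smooth_map (open_submanifold M (U i \<inter> U j)) \<G> (\<phi> i j)"
  using star by (simp add: star_collection_def)

lemma phi_carrier: "i \<in> I \<Longrightarrow> j \<in> I \<Longrightarrow> x \<in> U i \<Longrightarrow> x \<in> U j \<Longrightarrow> \<phi> i j x \<in> carrier G"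
  using smooth_map_in_points[OF phi_smooth, of i j x] U_points by simp

lemma phi_refl: "i \<in> I \<Longrightarrow> x \<in> U i \<Longrightarrow> \<phi> i i x = \<one>\<^bsub>G\<^esub>"
  using star by (auto simp: star_collection_def)

lemma phi_triple: "i \<in> I \<Longrightarrow> j \<in> I \<Longrightarrow> k \<in> I \<Longrightarrow> x \<in> U i \<Longrightarrow> x \<in> U j \<Longrightarrow> x \<in> U k \<Longrightarrow>
    \<phi> i j x \<otimes>\<^bsub>G\<^esub> \<phi> j k x \<otimes>\<^bsub>G\<^esub> \<phi> k i x = \<one>\<^bsub>G\<^esub>"
  using star by (simp add: star_collection_def)

text \<open>The triple identity for \<open>i, k, i\<close> shows that \<open>\<phi> k i x\<close> is
  inverse to \<open>\<phi> i k x\<close>; cancelling it on the right in the identity for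
  \<open>i, j, k\<close> leaves the two-step form.\<close>

lemma phi_cocycle:
  assumes "i \<in> I" "j \<in> I" "k \<in> I" "x \<in> U i" "x \<in> U j" "x \<in> U k"
  shows "\<phi> i j x \<otimes>\<^bsub>G\<^esub> \<phi> j k x = \<phi> i k x"
proof -
  have "\<phi> i k x \<otimes>\<^bsub>G\<^esub> \<phi> k i x = \<one>\<^bsub>G\<^esub>"
    using phi_triple[of i k i x] phi_refl[of i x] assms phi_carrier by simp
  then have "\<phi> i j x \<otimes>\<^bsub>G\<^esub> \<phi> j k x \<otimes>\<^bsub>G\<^esub> \<phi> k i x = \<phi> i k x \<otimes>\<^bsub>G\<^esub> \<phi> k i x"
    using phi_triple[OF assms] by simp
  then show ?thesis
    using assms phi_carrier by (simp add: grp.right_cancel)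
qed

lemma phi_act: "i \<in> I \<Longrightarrow> j \<in> I \<Longrightarrow> g \<in> carrier G \<Longrightarrow> x \<in> U i \<Longrightarrow> x \<in> U j \<Longrightarrow>
    \<phi> i j (act g x) = g \<otimes>\<^bsub>G\<^esub> \<phi> i j x \<otimes>\<^bsub>G\<^esub> inv\<^bsub>G\<^esub> g"
  using star by (simp add: star_collection_def)

lemma smooth_mult:
  assumes "smooth_premanifold K" "smooth_map K \<G> \<gamma>" "smooth_map K \<G> \<delta>"
  shows "smooth_map K \<G> (\<lambda>z. \<gamma> z \<otimes>\<^bsub>G\<^esub> \<delta> z)"
proof -
  have "smooth_map (product_manifold \<G> \<G>) \<G> (\<lambda>(g, h). g \<otimes>\<^bsub>G\<^esub> h)"
    using lie by (simp add: lie_group_def)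
  from smooth_map_compose[OF assms(1) smooth_premanifold_product[OF premanifold_G premanifold_G]
      premanifold_G smooth_map_Pair[OF assms(1) premanifold_G premanifold_G assms(2,3)] this]
  show ?thesis by simp
qed

lemma smooth_inv:
  assumes "smooth_premanifold K" "smooth_map K \<G> \<gamma>"
  shows "smooth_map K \<G> (\<lambda>z. inv\<^bsub>G\<^esub> \<gamma> z)"
proof -
  have "smooth_map \<G> \<G> (\<lambda>g. inv\<^bsub>G\<^esub> g)" using lie by (simp add: lie_group_def)
  from smooth_map_compose[OF assms(1) premanifold_G premanifold_G assms(2) this]
  show ?thesis .
qed

lemma smooth_act:
  assumes "smooth_premanifold K" "smooth_map K \<G> \<gamma>" "smooth_map K M \<xi>"
  shows "smooth_map K M (\<lambda>z. act (\<gamma> z) (\<xi> z))"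
  using smooth_map_compose[OF assms(1) smooth_premanifold_product[OF premanifold_G premanifold_M]
      premanifold_M smooth_map_Pair[OF assms(1) premanifold_G premanifold_M assms(2,3)] smooth_act_M]
  by simp

abbreviation XM :: "'i \<Rightarrow> ('m, 'e) smooth_space" where "XM i \<equiv> open_submanifold M (U i)"

abbreviation XP :: "'i \<Rightarrow> ('m \<times> 'g, 'e \<times> 'f) smooth_space" where
  "XP i \<equiv> product_manifold (XM i) \<G>"

lemma premanifold_XM: "i \<in> I \<Longrightarrow> smooth_premanifold (XM i)"
  by (rule smooth_premanifold_open_submanifold[OF premanifold_M U_open])

lemma premanifold_XP: "i \<in> I \<Longrightarrow> smooth_premanifold (XP i)"
  by (rule smooth_premanifold_product[OF premanifold_XM premanifold_G])

lemma points_Int_U [simp]: "i \<in> I \<Longrightarrow> points M \<inter> U i = U i"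
  using U_points by auto

lemma smooth_act_XM:
  assumes K: "smooth_premanifold K" and i: "i \<in> I"
    and \<gamma>: "smooth_map K \<G> \<gamma>" and \<xi>: "smooth_map K (XM i) \<xi>"
  shows "smooth_map K (XM i) (\<lambda>z. act (\<gamma> z) (\<xi> z))"
proof (rule smooth_map_restrict_codomain[OF K premanifold_M _ U_open[OF i]])
  show "smooth_map K M (\<lambda>z. act (\<gamma> z) (\<xi> z))"
    by (rule smooth_act[OF K \<gamma> smooth_map_compose[OF K premanifold_XM[OF i] premanifold_M \<xi>
            smooth_inclusion[OF premanifold_M U_open[OF i]]]])
  show "act (\<gamma> z) (\<xi> z) \<in> U i" if "z \<in> points K" for z
    using smooth_map_in_points[OF \<gamma> that] smooth_map_in_points[OF \<xi> that] U_act[OF i] i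
    by simp
qed

text \<open>Second countability makes \<open>M\<close> a Lindelof space. Both gluings obtain
  \<open>countable_cover\<close> from this, the index set being arbitrary.\<close>

lemma countable_subcover:
  "\<exists>J\<subseteq>I. countable J \<and> (\<forall>x\<in>points M. \<exists>j\<in>J. x \<in> U j)"
proof -
  have "Lindelof_space (mtop M)"
    using premanifold_M second_countable_imp_Lindelof_space[of "mtop M"]
    by (simp add: smooth_premanifold_def second_countable_space_iff)
  moreover have "openin (mtop M) V" if "V \<in> U ` I" for V
    using that U_open by auto
  ultimately obtain \<V> where V: "countable \<V>" "\<V> \<subseteq> U ` I" "\<Union>\<V> = points M"
    using Lindelof_spaceD[of "mtop M" "U ` I"] U_cover by auto
  then obtain J where "countable J" "J \<subseteq> I" "\<V> = U ` J"
    using countable_subset_image[of \<V> U I] by blast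
  then show ?thesis using V(3) by (intro exI[of _ J]) auto
qed

text \<open>\<open>Q\<close> is the glued space \<open>M'\<close>; on the bundle \<open>P\<close>, \<open>PP\<close> is the principal action and \<open>PS\<close> the
  star action.\<close>

sublocale Q: gluing_action I XM "\<lambda>i j. U i \<inter> U j" "adjoint_map act \<phi>" G \<G> act
proof
  fix i assume i: "i \<in> I"
  show "smooth_premanifold (XM i)" using premanifold_XM[OF i] .
  show "U i \<inter> U i = points (XM i)" using i by simp
  show "adjoint_map act \<phi> i i x = x" if "x \<in> points (XM i)" for x
    using that i U_points by (simp add: adjoint_map_def phi_refl)
  show "act \<one>\<^bsub>G\<^esub> x = x" if "x \<in> points (XM i)" for x using that by simp
  show "act (g \<otimes>\<^bsub>G\<^esub> h) x = act g (act h x)"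
    if "g \<in> carrier G" "h \<in> carrier G" "x \<in> points (XM i)" for g h x
    using that by (simp add: act_mult)
  show "smooth_map (product_manifold \<G> (XM i)) (XM i) (\<lambda>(g, x). act g x)"
    using smooth_act_XM[OF smooth_premanifold_product[OF premanifold_G premanifold_XM[OF i]] i
        smooth_map_fst[OF premanifold_G premanifold_XM[OF i]] smooth_map_snd[OF premanifold_G premanifold_XM[OF i]]]
    by (simp add: case_prod_unfold)
  fix j assume j: "j \<in> I"
  show "openin (mtop (XM i)) (U i \<inter> U j)"
    using U_open[OF j] by (auto simp: mtop_open_submanifold openin_subtopology)
  show "adjoint_map act \<phi> i j x \<in> U j \<inter> U i" if "x \<in> U i \<inter> U j" for x
    using that i j by (auto simp: adjoint_map_def intro!: U_act phi_carrier)
  show "act g x \<in> U i \<inter> U j" if "g \<in> carrier G" "x \<in> U i \<inter> U j" for g x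
    using that i j by (auto intro: U_act)
  \<comment> \<open>The conjugation rule gives \<open>\<phi> i j (g x) g = g \<phi> i j x\<close>,
    so the adjoint maps are equivariant.\<close>
  show "adjoint_map act \<phi> i j (act g x) = act g (adjoint_map act \<phi> i j x)"
    if "g \<in> carrier G" "x \<in> U i \<inter> U j" for g x
    using that i j phi_carrier U_points
    by (simp add: adjoint_map_def phi_act act_points flip: act_mult) (simp add: grp.m_assoc)
  have S: "open_submanifold (XM i) (U i \<inter> U j) = open_submanifold M (U i \<inter> U j)"
    by (simp add: open_submanifold_twice)
  have op: "openin (mtop M) (U i \<inter> U j)" using U_open i j by auto
  note pS = smooth_premanifold_open_submanifold[OF premanifold_M op]
  show "smooth_map (open_submanifold (XM i) (U i \<inter> U j)) (XM j) (adjoint_map act \<phi> i j)"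
    unfolding S adjoint_map_def
    by (rule smooth_act_XM[OF pS j phi_smooth[OF i j] smooth_map_restrict_codomain[OF pS premanifold_M
            smooth_inclusion[OF premanifold_M op] U_open[OF j]]]) simp
  fix k x assume k: "k \<in> I" and x: "x \<in> U i \<inter> U j" "adjoint_map act \<phi> i j x \<in> U j \<inter> U k"
  \<comment> \<open>Since \<open>U k\<close> is invariant, the overlap condition on the moved point
    is a condition on \<open>x\<close> itself.\<close>
  have xk: "x \<in> U k"
    using x(2) U_act_iff[OF k phi_carrier[OF i j]] x(1) U_points[OF i] by (auto simp: adjoint_map_def)
  \<comment> \<open>\<open>\<phi> j k\<close> is evaluated at the point moved by
    \<open>\<phi> i j x\<close>, hence appears conjugated by that element. The trailing inverse
    cancels against the element that moved the point, leaving \<open>\<phi> i j x\<close> times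
    \<open>\<phi> j k x\<close> in the order of the cocycle rule.\<close>
  have "adjoint_map act \<phi> j k (adjoint_map act \<phi> i j x) =
      act (\<phi> i j x \<otimes>\<^bsub>G\<^esub> \<phi> j k x \<otimes>\<^bsub>G\<^esub> inv\<^bsub>G\<^esub> \<phi> i j x \<otimes>\<^bsub>G\<^esub> \<phi> i j x) x"
    using x(1) xk i j k phi_carrier U_points[OF i]
    by (simp add: adjoint_map_def phi_act act_mult)
  also have "\<phi> i j x \<otimes>\<^bsub>G\<^esub> \<phi> j k x \<otimes>\<^bsub>G\<^esub> inv\<^bsub>G\<^esub> \<phi> i j x \<otimes>\<^bsub>G\<^esub> \<phi> i j x = \<phi> i k x"
    using x(1) xk i j k phi_carrier phi_cocycle by (simp add: grp.m_assoc)
  finally show "x \<in> U i \<inter> U k \<and>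
      adjoint_map act \<phi> j k (adjoint_map act \<phi> i j x) = adjoint_map act \<phi> i k x"
    using x(1) xk by (simp add: adjoint_map_def)
next
  show "finite_dimensional TYPE('e)"
    using premanifold_M by (rule smooth_premanifold_finite_dimensional)
  show "\<exists>J\<subseteq>I. countable J \<and> (\<forall>i\<in>I. \<forall>x\<in>points (XM i). \<exists>j\<in>J. x \<in> U i \<inter> U j)"
  proof -
    obtain J where J: "J \<subseteq> I" "countable J" "\<And>x. x \<in> points M \<Longrightarrow> \<exists>j\<in>J. x \<in> U j"
      using countable_subcover by auto
    have "\<exists>j\<in>J. x \<in> U i \<inter> U j" if "i \<in> I" "x \<in> points (XM i)" for i x
      using that J(3)[of x] U_points[OF that(1), of x] by auto
    then show ?thesis using J(1,2) by blast
  qed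
  show "lie_group G \<G>" by (rule lie)
qed

abbreviation fP :: "'i \<Rightarrow> 'i \<Rightarrow> 'm \<times> 'g \<Rightarrow> 'm \<times> 'g" where
  "fP \<equiv> \<lambda>i j (x, g). (x, g \<otimes>\<^bsub>G\<^esub> \<phi> i j x)"

sublocale P: gluing I XP "\<lambda>i j. (U i \<inter> U j) \<times> carrier G" fP
proof
  fix i assume i: "i \<in> I"
  show "smooth_premanifold (XP i)" using premanifold_XP[OF i] .
  show "(U i \<inter> U i) \<times> carrier G = points (XP i)" using i by simp
  show "fP i i x = x" if "x \<in> points (XP i)" for x
    using that i by (auto simp: phi_refl)
  fix j assume j: "j \<in> I"
  have open_XM: "openin (mtop (XM i)) (U i \<inter> U j)"
    using U_open[OF j] by (auto simp: mtop_open_submanifold openin_subtopology)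
  then show A: "openin (mtop (XP i)) ((U i \<inter> U j) \<times> carrier G)"
    by (simp add: mtop_product_manifold openin_prod_Times_iff)
  show "fP i j x \<in> (U j \<inter> U i) \<times> carrier G" if "x \<in> (U i \<inter> U j) \<times> carrier G" for x
    using that i j by (auto intro!: phi_carrier)
  let ?S = "open_submanifold (XP i) ((U i \<inter> U j) \<times> carrier G)"
  note pS = smooth_premanifold_open_submanifold[OF premanifold_XP[OF i] A]
  have op: "openin (mtop M) (U i \<inter> U j)" using U_open i j by auto
  have fst_XM: "smooth_map ?S (XM i) fst"
    by (rule smooth_map_restrict_domain[OF premanifold_XP[OF i] premanifold_XM[OF i]
          smooth_map_fst[OF premanifold_XM[OF i] premanifold_G] A])
  have fst_M: "smooth_map ?S M fst"
    using smooth_map_compose[OF pS premanifold_XM[OF i] premanifold_M fst_XM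
        smooth_inclusion[OF premanifold_M U_open[OF i]]] .
  have fst_U: "smooth_map ?S (open_submanifold M (U i \<inter> U j)) fst"
    by (rule smooth_map_restrict_codomain[OF pS premanifold_M fst_M op]) auto
  have fst_j: "smooth_map ?S (XM j) fst"
    by (rule smooth_map_restrict_codomain[OF pS premanifold_M fst_M U_open[OF j]]) auto
  have snd: "smooth_map ?S \<G> snd"
    by (rule smooth_map_restrict_domain[OF premanifold_XP[OF i] premanifold_G
          smooth_map_snd[OF premanifold_XM[OF i] premanifold_G] A])
  have "smooth_map ?S \<G> (\<lambda>z. \<phi> i j (fst z))"
    by (rule smooth_map_compose[OF pS smooth_premanifold_open_submanifold[OF premanifold_M op]
          premanifold_G fst_U phi_smooth[OF i j]])
  from smooth_map_Pair[OF pS premanifold_XM[OF j] premanifold_G fst_j smooth_mult[OF pS snd this]]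
  show "smooth_map ?S (XP j) (fP i j)" by (simp add: case_prod_unfold)
  fix k x assume k: "k \<in> I" and x: "x \<in> (U i \<inter> U j) \<times> carrier G" "fP i j x \<in> (U j \<inter> U k) \<times> carrier G"
  then show "x \<in> (U i \<inter> U k) \<times> carrier G \<and> fP j k (fP i j x) = fP i k x"
    using i j phi_carrier by (auto simp: grp.m_assoc phi_cocycle)
next
  show "finite_dimensional TYPE('e \<times> 'f)"
    by (rule finite_dimensional_prod[OF smooth_premanifold_finite_dimensional[OF premanifold_M]
          smooth_premanifold_finite_dimensional[OF premanifold_G]])
  show "\<exists>J\<subseteq>I. countable J \<and>
      (\<forall>i\<in>I. \<forall>x\<in>points (XP i). \<exists>j\<in>J. x \<in> (U i \<inter> U j) \<times> carrier G)"
  proof -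
    obtain J where J: "J \<subseteq> I" "countable J" "\<And>x. x \<in> points M \<Longrightarrow> \<exists>j\<in>J. x \<in> U j"
      using countable_subcover by auto
    have "\<exists>j\<in>J. x \<in> (U i \<inter> U j) \<times> carrier G" if "i \<in> I" "x \<in> points (XP i)" for i x
      using that J(3)[of "fst x"] U_points[OF that(1), of "fst x"] by auto
    then show ?thesis using J(1,2) by blast
  qed
qed

sublocale PP: gluing_action I XP "\<lambda>i j. (U i \<inter> U j) \<times> carrier G" fP G \<G>
  "\<lambda>s (x, g). (x, s \<otimes>\<^bsub>G\<^esub> g)"
proof
  show "lie_group G \<G>" by (rule lie)
  fix i assume i: "i \<in> I"
  note p = smooth_premanifold_product[OF premanifold_G premanifold_XP[OF i]]
  note pr = smooth_map_fst[OF premanifold_G premanifold_XP[OF i]]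
    smooth_map_compose[OF p premanifold_XP[OF i] premanifold_XM[OF i]
      smooth_map_snd[OF premanifold_G premanifold_XP[OF i]] smooth_map_fst[OF premanifold_XM[OF i] premanifold_G]]
    smooth_map_compose[OF p premanifold_XP[OF i] premanifold_G
      smooth_map_snd[OF premanifold_G premanifold_XP[OF i]] smooth_map_snd[OF premanifold_XM[OF i] premanifold_G]]
  show "smooth_map (product_manifold \<G> (XP i)) (XP i) (\<lambda>(s, y). case y of (x, g) \<Rightarrow> (x, s \<otimes>\<^bsub>G\<^esub> g))"
    using smooth_map_Pair[OF p premanifold_XM[OF i] premanifold_G pr(2) smooth_mult[OF p pr(1,3)]]
    by (simp add: case_prod_unfold)
qed (auto simp: grp.m_assoc phi_carrier)

sublocale PS: gluing_action I XP "\<lambda>i j. (U i \<inter> U j) \<times> carrier G" fP G \<G>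
  "\<lambda>t (x, g). (act t x, g \<otimes>\<^bsub>G\<^esub> inv\<^bsub>G\<^esub> t)"
proof
  show "lie_group G \<G>" by (rule lie)
  fix i assume i: "i \<in> I"
  note p = smooth_premanifold_product[OF premanifold_G premanifold_XP[OF i]]
  note pr = smooth_map_fst[OF premanifold_G premanifold_XP[OF i]]
    smooth_map_compose[OF p premanifold_XP[OF i] premanifold_XM[OF i]
      smooth_map_snd[OF premanifold_G premanifold_XP[OF i]] smooth_map_fst[OF premanifold_XM[OF i] premanifold_G]]
    smooth_map_compose[OF p premanifold_XP[OF i] premanifold_G
      smooth_map_snd[OF premanifold_G premanifold_XP[OF i]] smooth_map_snd[OF premanifold_XM[OF i] premanifold_G]]
  show "smooth_map (product_manifold \<G> (XP i)) (XP i)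
      (\<lambda>(t, y). case y of (x, g) \<Rightarrow> (act t x, g \<otimes>\<^bsub>G\<^esub> inv\<^bsub>G\<^esub> t))"
    using smooth_map_Pair[OF p premanifold_XM[OF i] premanifold_G smooth_act_XM[OF p i pr(1,2)]
        smooth_mult[OF p pr(3) smooth_inv[OF p pr(1)]]]
    by (simp add: case_prod_unfold)
  show "(case y of (x, g) \<Rightarrow> (act \<one>\<^bsub>G\<^esub> x, g \<otimes>\<^bsub>G\<^esub> inv\<^bsub>G\<^esub> \<one>\<^bsub>G\<^esub>)) = y" if "y \<in> points (XP i)" for y
    using that i U_points by auto
  fix t y assume t: "t \<in> carrier G"
  show "(case y of (x, g) \<Rightarrow> (act (t \<otimes>\<^bsub>G\<^esub> h) x, g \<otimes>\<^bsub>G\<^esub> inv\<^bsub>G\<^esub> (t \<otimes>\<^bsub>G\<^esub> h))) =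
      (case (case y of (x, g) \<Rightarrow> (act h x, g \<otimes>\<^bsub>G\<^esub> inv\<^bsub>G\<^esub> h)) of
        (x, g) \<Rightarrow> (act t x, g \<otimes>\<^bsub>G\<^esub> inv\<^bsub>G\<^esub> t))" if "h \<in> carrier G" "y \<in> points (XP i)" for h
    using that t i U_points by (auto simp: act_mult grp.inv_mult_group grp.m_assoc)
  fix j assume j: "j \<in> I" and y: "y \<in> (U i \<inter> U j) \<times> carrier G"
  show "(case y of (x, g) \<Rightarrow> (act t x, g \<otimes>\<^bsub>G\<^esub> inv\<^bsub>G\<^esub> t)) \<in> (U i \<inter> U j) \<times> carrier G"
    using y t i j by (auto intro: U_act)
  have "g \<otimes>\<^bsub>G\<^esub> inv\<^bsub>G\<^esub> t \<otimes>\<^bsub>G\<^esub> \<phi> i j (act t x) = g \<otimes>\<^bsub>G\<^esub> \<phi> i j x \<otimes>\<^bsub>G\<^esub> inv\<^bsub>G\<^esub> t"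
    if "x \<in> U i" "x \<in> U j" "g \<in> carrier G" for x g
  proof -
    have "inv\<^bsub>G\<^esub> t \<otimes>\<^bsub>G\<^esub> (t \<otimes>\<^bsub>G\<^esub> (\<phi> i j x \<otimes>\<^bsub>G\<^esub> inv\<^bsub>G\<^esub> t)) = \<phi> i j x \<otimes>\<^bsub>G\<^esub> inv\<^bsub>G\<^esub> t"
      using that t i j phi_carrier by (simp flip: grp.m_assoc)
    then show ?thesis using that t i j phi_carrier by (simp add: phi_act grp.m_assoc)
  qed
  then show "fP i j (case y of (x, g) \<Rightarrow> (act t x, g \<otimes>\<^bsub>G\<^esub> inv\<^bsub>G\<^esub> t)) =
      (case fP i j y of (x, g) \<Rightarrow> (act t x, g \<otimes>\<^bsub>G\<^esub> inv\<^bsub>G\<^esub> t))"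
    using y by auto
qed

section \<open>The bundle, its projection and its local triviality\<close>

lemma P_cls_points: "i \<in> I \<Longrightarrow> x \<in> U i \<Longrightarrow> g \<in> carrier G \<Longrightarrow> P.cls i (x, g) \<in> points P.N"
  by (rule P.cls_in) auto

lemma P_pointsE:
  assumes "p \<in> points P.N"
  obtains i x g where "i \<in> I" "x \<in> U i" "g \<in> carrier G" "p = P.cls i (x, g)"
  using assms by (rule P.pointsE) auto

lemma P_mem_cls:
  "i \<in> I \<Longrightarrow> x \<in> U i \<Longrightarrow> g \<in> carrier G \<Longrightarrow>
    (j, y, h) \<in> P.cls i (x, g) \<longleftrightarrow> j \<in> I \<and> x \<in> U j \<and> y = x \<and> h = g \<otimes>\<^bsub>G\<^esub> \<phi> i j x"
  using P.mem_cls[of i "(x, g)" j "(y, h)"] by auto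

text \<open>Gluing changes only the group coordinate, so all representatives of a class share the
  same \<open>x\<close>.\<close>

lemma star_proj_cls:
  assumes "i \<in> I" "x \<in> U i" "g \<in> carrier G"
  shows "star_proj (P.cls i (x, g)) = x"
  unfolding star_proj_def
proof (rule the_equality)
  show "\<exists>j h. (j, x, h) \<in> P.cls i (x, g)"
    using P_mem_cls[OF assms, of i x] assms(1,2) by blast
  show "y = x" if "\<exists>j h. (j, y, h) \<in> P.cls i (x, g)" for y
    using that P_mem_cls[OF assms] by blast
qed

lemma smooth_star_proj: "smooth_map P.N M star_proj"
proof (rule P.smooth_map_from_glue[OF premanifold_M])
  fix i assume i: "i \<in> I"
  have "smooth_map (XP i) M (\<lambda>z. fst z)"
    using smooth_map_compose[OF premanifold_XP[OF i] premanifold_XM[OF i] premanifold_M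
        smooth_map_fst[OF premanifold_XM[OF i] premanifold_G] smooth_inclusion[OF premanifold_M U_open[OF i]]] .
  then show "smooth_map (XP i) M (\<lambda>z. star_proj (P.cls i z))"
    by (rule smooth_map_cong[OF premanifold_XP[OF i] premanifold_M])
      (use i in \<open>auto simp: star_proj_cls\<close>)
qed

text \<open>The comparison map is the projection to the Hausdorff space \<open>M\<close>. Two
  classes over the same base point can both be represented in any piece that contains this
  point.\<close>

lemma Hausdorff_P: "Hausdorff_space (mtop P.N)"
proof (rule P.Hausdorff_glue[OF Hausdorff_M smooth_map_continuous[OF smooth_star_proj]])
  show "Hausdorff_space (mtop (XP i))" if "i \<in> I" for i
    using Hausdorff_M Hausdorff_G
    by (simp add: mtop_product_manifold mtop_open_submanifold Hausdorff_space_prod_topology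
        Hausdorff_space_subtopology)
  fix i j y z assume "i \<in> I" "j \<in> I" "y \<in> points (XP i)" "z \<in> points (XP j)"
    "star_proj (P.cls i y) = star_proj (P.cls j z)"
  then show "z \<in> (U j \<inter> U i) \<times> carrier G" by (auto simp: star_proj_cls)
qed

lemma manifold_P: "smooth_manifold P.N"
  using Hausdorff_P P.premanifold_N by (simp add: smooth_manifold_def)

lemma principal_bundle_P: "principal_bundle G \<G> P.N M star_proj PP.pa"
  unfolding principal_bundle_def
proof (intro conjI ballI manifold_P smooth_star_proj PP.pa_smooth_action)
  show "smooth_manifold M" using M by (simp add: G_manifold_def)
  fix x assume "x \<in> points M"
  then obtain i where i: "i \<in> I" "x \<in> U i" using U_cover by auto
  let ?t = "P.cls i" and ?PV = "open_submanifold P.N (points P.N \<inter> star_proj -` U i)"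
  \<comment> \<open>The whole preimage of \<open>U i\<close> is piece \<open>i\<close>: a class over
    \<open>y \<in> U i\<close> that is given in piece \<open>j\<close> is moved there by
    \<open>\<phi> j i y\<close>. This makes \<open>cls i\<close> a trivialisation over
    \<open>U i\<close>.\<close>
  have eq: "points P.N \<inter> star_proj -` U i = P.piece i"
  proof (intro equalityI subsetI)
    fix p assume p: "p \<in> points P.N \<inter> star_proj -` U i"
    then obtain j y g where j: "j \<in> I" "y \<in> U j" "g \<in> carrier G" "p = P.cls j (y, g)"
      by (auto elim: P_pointsE)
    then have y: "y \<in> U i" using p by (simp add: star_proj_cls)
    then have "P.cls i (y, g \<otimes>\<^bsub>G\<^esub> \<phi> j i y) = P.cls j (y, g)"
      using P.cls_f[of j i "(y, g)"] i j by simp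
    then show "p \<in> P.piece i"
      using i j y phi_carrier by (intro image_eqI[of p _ "(y, g \<otimes>\<^bsub>G\<^esub> \<phi> j i y)"]) auto
  next
    fix p assume "p \<in> P.piece i"
    then show "p \<in> points P.N \<inter> star_proj -` U i"
      using i by (auto simp: star_proj_cls P_cls_points)
  qed
  note PV = smooth_premanifold_open_submanifold[OF P.premanifold_N P.openin_piece[OF i(1)]]
  have "diffeomorphism (XP i) ?PV ?t"
    unfolding eq
  proof (rule diffeomorphismI[OF premanifold_XP[OF i(1)] PV])
    show "smooth_map (XP i) (open_submanifold P.N (P.piece i)) ?t"
      by (rule smooth_map_restrict_codomain[OF premanifold_XP[OF i(1)] P.premanifold_N
            P.smooth_cls[OF i(1)] P.openin_piece[OF i(1)]]) auto
    show "smooth_map (open_submanifold P.N (P.piece i)) (XP i) (P.rep i)"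
      using P.smooth_rep[OF i(1)] .
    show "P.rep i (P.cls i z) = z" if "z \<in> points (XP i)" for z using P.rep_cls[OF i(1) that] .
    show "P.cls i (P.rep i p) = p" if "p \<in> points (open_submanifold P.N (P.piece i))" for p
      using that P.rep_cls[OF i(1)] by auto
  qed
  moreover have "star_proj (?t (y, g)) = y" if "y \<in> U i" "g \<in> carrier G" for y g
    using that i by (simp add: star_proj_cls)
  moreover have "?t (y, s \<otimes>\<^bsub>G\<^esub> g) = PP.pa s (?t (y, g))"
    if "y \<in> U i" "g \<in> carrier G" "s \<in> carrier G" for y g s
    using that i PP.pa_cls[of s i "(y, g)"] by simp
  ultimately show "\<exists>V t. openin (mtop M) V \<and> x \<in> V \<and>
      diffeomorphism (product_manifold (open_submanifold M V) \<G>)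
        (open_submanifold P.N (points P.N \<inter> star_proj -` V)) t \<and>
      (\<forall>y\<in>V. \<forall>g\<in>carrier G. star_proj (t (y, g)) = y \<and>
         (\<forall>s\<in>carrier G. t (y, s \<otimes>\<^bsub>G\<^esub> g) = PP.pa s (t (y, g))))"
    using U_open[OF i(1)] i(2) by (intro exI[of _ "U i"] exI[of _ ?t]) blast
qed

section \<open>The star action and the map to \<open>M'\<close>\<close>

lemma star_act_cls:
  "t \<in> carrier G \<Longrightarrow> i \<in> I \<Longrightarrow> x \<in> U i \<Longrightarrow> g \<in> carrier G \<Longrightarrow>
    PS.pa t (P.cls i (x, g)) = P.cls i (act t x, g \<otimes>\<^bsub>G\<^esub> inv\<^bsub>G\<^esub> t)"
  using PS.pa_cls[of t i "(x, g)"] by simp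

lemma principal_act_cls:
  "s \<in> carrier G \<Longrightarrow> i \<in> I \<Longrightarrow> x \<in> U i \<Longrightarrow> g \<in> carrier G \<Longrightarrow>
    PP.pa s (P.cls i (x, g)) = P.cls i (x, s \<otimes>\<^bsub>G\<^esub> g)"
  using PP.pa_cls[of s i "(x, g)"] by simp

lemma act_cls:
  "g \<in> carrier G \<Longrightarrow> i \<in> I \<Longrightarrow> x \<in> U i \<Longrightarrow> Q.pa g (Q.cls i x) = Q.cls i (act g x)"
  using Q.pa_cls[of g i x] by simp

text \<open>Representatives in a fixed piece are unique, so a fixed point can be examined in
  coordinates. There \<open>g t\<^sup>-\<^sup>1 = g\<close> forces \<open>t\<close> to be the unit,
  whatever the stabiliser of \<open>x\<close> is.\<close>

lemma star_act_free: "free_action G (points P.N) PS.pa"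
  unfolding free_action_def
proof (intro ballI impI)
  fix t p assume t: "t \<in> carrier G" and p: "p \<in> points P.N" and fix_p: "PS.pa t p = p"
  obtain i x g where i: "i \<in> I" "x \<in> U i" "g \<in> carrier G" "p = P.cls i (x, g)"
    using p by (rule P_pointsE)
  have "P.rep i (P.cls i (act t x, g \<otimes>\<^bsub>G\<^esub> inv\<^bsub>G\<^esub> t)) = P.rep i (P.cls i (x, g))"
    using fix_p i t by (simp add: star_act_cls)
  then have "g \<otimes>\<^bsub>G\<^esub> inv\<^bsub>G\<^esub> t = g" using i t U_act by simp
  then have "inv\<^bsub>G\<^esub> t = \<one>\<^bsub>G\<^esub>" using i(3) t by simp
  then show "t = \<one>\<^bsub>G\<^esub>" using t by (metis grp.inv_inv grp.inv_one)
qed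

lemma star_act_commutes:
  assumes "t \<in> carrier G" "s \<in> carrier G" "p \<in> points P.N"
  shows "PS.pa t (PP.pa s p) = PP.pa s (PS.pa t p)"
  using assms(3)
  by (rule P_pointsE) (use assms(1,2) U_act in \<open>simp add: star_act_cls principal_act_cls grp.m_assoc\<close>)

text \<open>An arbitrary representative is taken; that the result does not depend on it is the
  content of \<open>Phi_cls\<close>.\<close>

definition \<Phi> :: "('i \<times> 'm \<times> 'g) set \<Rightarrow> ('i \<times> 'm) set" where
  "\<Phi> p = (case SOME z. z \<in> p of (i, x, g) \<Rightarrow> Q.cls i (act g x))"

lemma Phi_cls:
  assumes i: "i \<in> I" "x \<in> U i" "g \<in> carrier G"
  shows "\<Phi> (P.cls i (x, g)) = Q.cls i (act g x)"
proof -
  obtain j y h where z: "(SOME z. z \<in> P.cls i (x, g)) = (j, y, h)" by (rule prod_cases3)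
  have "\<exists>z. z \<in> P.cls i (x, g)" using P.cls_self[of i "(x, g)"] i by auto
  then have "(SOME z. z \<in> P.cls i (x, g)) \<in> P.cls i (x, g)" by (rule someI_ex)
  then have "(j, y, h) \<in> P.cls i (x, g)" by (simp only: z)
  then have j: "j \<in> I" "x \<in> U j" "y = x" "h = g \<otimes>\<^bsub>G\<^esub> \<phi> i j x"
    using P_mem_cls[OF i] by auto
  have x: "x \<in> points M" using U_points i by blast
  have "act g x \<in> U i \<inter> U j" using i j U_act by simp
  then have "Q.cls j (adjoint_map act \<phi> i j (act g x)) = Q.cls i (act g x)"
    using Q.cls_f[OF i(1) j(1)] by simp
  moreover have "adjoint_map act \<phi> i j (act g x) = act h x"
  proof -
    have "\<phi> i j x \<in> carrier G" using i j phi_carrier by simp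
    then have "\<phi> i j (act g x) \<otimes>\<^bsub>G\<^esub> g = g \<otimes>\<^bsub>G\<^esub> \<phi> i j x"
      using i j by (simp add: phi_act grp.m_assoc)
    then show ?thesis
      using i j x phi_carrier[of i j "act g x"] phi_carrier[of i j x] U_act
      by (simp add: adjoint_map_def flip: act_mult)
  qed
  ultimately show ?thesis by (simp add: \<Phi>_def z j(3))
qed

lemma smooth_Phi: "smooth_map P.N Q.N \<Phi>"
proof (rule P.smooth_map_from_glue[OF Q.premanifold_N])
  fix i assume i: "i \<in> I"
  have "smooth_map (XP i) Q.N (\<lambda>z. Q.cls i (act (snd z) (fst z)))"
    by (rule smooth_map_compose[OF premanifold_XP[OF i] premanifold_XM[OF i] Q.premanifold_N
          smooth_act_XM[OF premanifold_XP[OF i] i smooth_map_snd[OF premanifold_XM[OF i] premanifold_G]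
            smooth_map_fst[OF premanifold_XM[OF i] premanifold_G]] Q.smooth_cls[OF i]])
  then show "smooth_map (XP i) Q.N (\<lambda>z. \<Phi> (P.cls i z))"
    by (rule smooth_map_cong[OF premanifold_XP[OF i] Q.premanifold_N]) (use i in \<open>auto simp: Phi_cls\<close>)
qed

lemma Phi_principal_act:
  assumes "s \<in> carrier G" "p \<in> points P.N"
  shows "\<Phi> (PP.pa s p) = Q.pa s (\<Phi> p)"
  using assms(2)
  by (rule P_pointsE) (use assms(1) U_act U_points in \<open>simp add: Phi_cls principal_act_cls act_cls act_mult\<close>)

lemma Phi_points: "p \<in> points P.N \<Longrightarrow> \<Phi> p \<in> points Q.N"
  by (rule smooth_map_in_points[OF smooth_Phi])

lemma Phi_section:
  assumes p: "p \<in> points P.N"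
  shows "\<exists>W \<sigma>. openin (mtop Q.N) W \<and> \<Phi> p \<in> W \<and>
    smooth_map (open_submanifold Q.N W) P.N \<sigma> \<and> \<sigma> (\<Phi> p) = p \<and> (\<forall>y\<in>W. \<Phi> (\<sigma> y) = y)"
proof -
  obtain i x g where i: "i \<in> I" "x \<in> U i" "g \<in> carrier G" "p = P.cls i (x, g)"
    using p by (rule P_pointsE)
  \<comment> \<open>The group coordinate is frozen at that of the chosen representative of
    \<open>p\<close>, which makes the section pass through \<open>p\<close>.\<close>
  define \<sigma> where "\<sigma> = (\<lambda>q. P.cls i (act (inv\<^bsub>G\<^esub> g) (Q.rep i q), g))"
  note W = smooth_premanifold_open_submanifold[OF Q.premanifold_N Q.openin_piece[OF i(1)]]
  have const: "smooth_map (open_submanifold Q.N (Q.piece i)) \<G> (\<lambda>q. h)" if "h \<in> carrier G" for h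
    by (rule smooth_map_const[OF W premanifold_G]) (use that in simp)
  have "smooth_map (open_submanifold Q.N (Q.piece i)) (XP i) (\<lambda>q. (act (inv\<^bsub>G\<^esub> g) (Q.rep i q), g))"
    using i(3)
    by (intro smooth_map_Pair[OF W premanifold_XM[OF i(1)] premanifold_G]
        smooth_act_XM[OF W i(1)] const Q.smooth_rep[OF i(1)]) auto
  from smooth_map_compose[OF W premanifold_XP[OF i(1)] P.premanifold_N this P.smooth_cls[OF i(1)]]
  have "smooth_map (open_submanifold Q.N (Q.piece i)) P.N \<sigma>" by (simp add: \<sigma>_def)
  moreover have "\<Phi> p \<in> Q.piece i" using i U_act by (simp add: Phi_cls)
  moreover have "\<sigma> (\<Phi> p) = p" using i U_act U_points by (simp add: \<sigma>_def Phi_cls)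
  moreover have "\<Phi> (\<sigma> y) = y" if "y \<in> Q.piece i" for y
    using that i U_act U_points by (auto simp: \<sigma>_def Phi_cls)
  ultimately show ?thesis using Q.openin_piece[OF i(1)] by blast
qed

lemma open_Phi: "open_map (mtop P.N) (mtop Q.N) \<Phi>"
proof (rule open_map_if_local_sections)
  show "\<Phi> \<in> points P.N \<rightarrow> points Q.N" using Phi_points by blast
  fix p assume p: "p \<in> points P.N"
  obtain W \<sigma> where W: "openin (mtop Q.N) W" "\<Phi> p \<in> W" "smooth_map (open_submanifold Q.N W) P.N \<sigma>"
    "\<sigma> (\<Phi> p) = p" "\<forall>y\<in>W. \<Phi> (\<sigma> y) = y"
    using Phi_section[OF p] by auto
  have "continuous_map (subtopology (mtop Q.N) W) (mtop P.N) \<sigma>"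
    using smooth_map_continuous[OF W(3)] by (simp add: mtop_open_submanifold)
  then show "\<exists>W \<sigma>. openin (mtop Q.N) W \<and> \<Phi> p \<in> W \<and> continuous_map (subtopology (mtop Q.N) W) (mtop P.N) \<sigma> \<and>
      \<sigma> (\<Phi> p) = p \<and> (\<forall>y\<in>W. \<Phi> (\<sigma> y) = y)"
    using W by blast
qed

lemma surj_Phi: "\<Phi> ` points P.N = points Q.N"
proof (intro equalityI subsetI)
  fix q assume "q \<in> points Q.N"
  then obtain i x where i: "i \<in> I" "x \<in> U i" "q = Q.cls i x" by (auto elim: Q.pointsE)
  then have "\<Phi> (P.cls i (x, \<one>\<^bsub>G\<^esub>)) = q" using U_points by (simp add: Phi_cls)
  then show "q \<in> \<Phi> ` points P.N" using i P_cls_points grp.one_closed by blast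
qed (use Phi_points in auto)

lemma Phi_star_act:
  assumes "t \<in> carrier G" "p \<in> points P.N"
  shows "\<Phi> (PS.pa t p) = \<Phi> p"
  using assms(2)
proof (rule P_pointsE)
  fix i x g assume i: "i \<in> I" "x \<in> U i" "g \<in> carrier G" "p = P.cls i (x, g)"
  then have "act (g \<otimes>\<^bsub>G\<^esub> inv\<^bsub>G\<^esub> t) (act t x) = act g x"
    using assms(1) U_points act_points by (simp add: act_mult)
  then show ?thesis using i assms(1) U_act by (simp add: star_act_cls Phi_cls)
qed

text \<open>Equal images put \<open>g x\<close> into \<open>U j\<close>, hence also \<open>x\<close>
  by invariance of the cover, so \<open>p\<close> can be rewritten in the piece of \<open>q\<close>.
  There representatives are unique and the hypothesis becomes an equation \<open>g' x = h y\<close>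
  in \<open>M\<close>.\<close>

lemma Phi_eq_imp_star_act:
  assumes p: "p \<in> points P.N" and q: "q \<in> points P.N" and eq: "\<Phi> p = \<Phi> q"
  shows "\<exists>t\<in>carrier G. q = PS.pa t p"
proof -
  obtain i x g where i: "i \<in> I" "x \<in> U i" "g \<in> carrier G" "p = P.cls i (x, g)"
    using p by (rule P_pointsE)
  obtain j y h where j: "j \<in> I" "y \<in> U j" "h \<in> carrier G" "q = P.cls j (y, h)"
    using q by (rule P_pointsE)
  have xy: "x \<in> points M" "y \<in> points M" using i j U_points by blast+
  have "Q.cls i (act g x) = Q.cls j (act h y)" using eq i j by (simp add: Phi_cls)
  then have "act g x \<in> U i \<inter> U j"
    using Q.cls_eq_iff[OF i(1) j(1), of "act g x" "act h y"] i j U_act by simp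
  then have xj: "x \<in> U j" using U_act_iff[OF j(1) i(3) xy(1)] by simp
  define g' where "g' = g \<otimes>\<^bsub>G\<^esub> \<phi> i j x"
  have g': "g' \<in> carrier G" using i j xj phi_carrier by (simp add: g'_def)
  have p': "p = P.cls j (x, g')"
    using P.cls_f[OF i(1) j(1), of "(x, g)"] i xj by (simp add: g'_def)
  have "Q.cls j (act g' x) = Q.cls j (act h y)"
    using eq j xj g' by (simp add: p' Phi_cls)
  then have "Q.rep j (Q.cls j (act g' x)) = Q.rep j (Q.cls j (act h y))" by simp
  then have gh: "act g' x = act h y" using j xj g' U_act by simp
  \<comment> \<open>The group coordinate dictates this choice, as
    \<open>g' t\<^sup>-\<^sup>1 = h\<close> is required; the equation \<open>g' x = h y\<close> then
    yields \<open>t x = y\<close>.\<close>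
  let ?t = "inv\<^bsub>G\<^esub> h \<otimes>\<^bsub>G\<^esub> g'"
  have "act ?t x = y" using g' j(3) xy gh by (simp add: act_mult)
  moreover have "g' \<otimes>\<^bsub>G\<^esub> inv\<^bsub>G\<^esub> ?t = h"
    using g' j(3) by (simp add: grp.inv_mult_group flip: grp.m_assoc)
  ultimately have "PS.pa ?t p = q"
    using g' j xj by (simp add: p' star_act_cls)
  then show ?thesis using g' j(3) by (intro bexI[of _ ?t]) auto
qed

section \<open>The orbit space of the star action\<close>

definition fibre :: "('i \<times> 'm) set \<Rightarrow> ('i \<times> 'm \<times> 'g) set set" where
  "fibre y = {p \<in> points P.N. \<Phi> p = y}"

lemma star_orbit:
  assumes p: "p \<in> points P.N"
  shows "orbit G PS.pa p = fibre (\<Phi> p)"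
proof (intro equalityI subsetI)
  fix q assume "q \<in> orbit G PS.pa p"
  then obtain t where "t \<in> carrier G" "q = PS.pa t p" by (auto simp: orbit_def)
  then show "q \<in> fibre (\<Phi> p)"
    using Phi_star_act PS.pa_closed p by (simp add: fibre_def)
next
  fix q assume "q \<in> fibre (\<Phi> p)"
  then show "q \<in> orbit G PS.pa p"
    using Phi_eq_imp_star_act[OF p, of q] by (auto simp: orbit_def fibre_def)
qed

lemma star_orbits: "orbits G (points P.N) PS.pa = fibre ` points Q.N"
proof -
  have "orbits G (points P.N) PS.pa = orbit G PS.pa ` points P.N" by (auto simp: orbits_def)
  also have "\<dots> = fibre ` \<Phi> ` points P.N" by (simp add: image_image star_orbit cong: image_cong_simp)
  finally show ?thesis by (simp only: surj_Phi)
qed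

definition F :: "('i \<times> 'm \<times> 'g) set set \<Rightarrow> ('i \<times> 'm) set" where
  "F c = \<Phi> (SOME p. p \<in> c)"

text \<open>The orbit space with the charts of \<open>M'\<close> pulled back along \<open>F\<close>.
  Its second component is the atlas that the theorem asks for.\<close>

definition R :: "(('i \<times> 'm \<times> 'g) set set, 'e) smooth_space" where
  "R = \<lparr>mtop = quotient_topology (mtop P.N) (orbits G (points P.N) PS.pa),
    charts = transport_charts (orbits G (points P.N) PS.pa) F (charts Q.N)\<rparr>"

lemma points_R: "points R = fibre ` points Q.N"
  and homeo_F: "homeomorphic_maps (mtop R) (mtop Q.N) F fibre"
  using quotient_by_fibres[OF smooth_map_continuous[OF smooth_Phi] open_Phi surj_Phi]
  by (simp_all add: R_def star_orbits F_def[abs_def] fibre_def[abs_def])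

lemma fibre_points: "y \<in> points Q.N \<Longrightarrow> fibre y \<in> points R"
  by (simp add: points_R)

text \<open>Writes \<open>R\<close> in terms of its own point set instead of the set of orbits, the
  form in which the transport lemmas produce their space.\<close>

lemma R_transport: "R = \<lparr>mtop = mtop R, charts = transport_charts (points R) F (charts Q.N)\<rparr>"
proof -
  have "charts R = transport_charts (points R) F (charts Q.N)"
    unfolding points_R star_orbits[symmetric] by (simp add: R_def)
  then show ?thesis by (intro smooth_space.equality) simp_all
qed

lemma premanifold_R: "smooth_premanifold R"
  using transport_premanifold[OF Q.premanifold_N homeo_F] by (simp flip: R_transport)

lemma smooth_F: "smooth_map R Q.N F"
  using transport_smooth[OF Q.premanifold_N homeo_F] by (simp flip: R_transport)

lemma smooth_fibre: "smooth_map Q.N R fibre"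
  using transport_inverse_smooth[OF Q.premanifold_N homeo_F] by (simp flip: R_transport)

lemma F_fibre [simp]: "y \<in> points Q.N \<Longrightarrow> F (fibre y) = y"
  and fibre_F [simp]: "c \<in> points R \<Longrightarrow> fibre (F c) = c"
  using homeo_F by (auto simp: homeomorphic_maps_def)

lemma diffeomorphism_F: "diffeomorphism R Q.N F"
  by (rule diffeomorphismI[OF premanifold_R Q.premanifold_N smooth_F smooth_fibre]) auto

text \<open>Equivariance of \<open>\<Phi>\<close> sends a fibre into a fibre. Applying the inverse
  element gives the reverse inclusion, so images of fibres are whole fibres.\<close>

lemma induced_fibre:
  assumes g: "g \<in> carrier G" and y: "y \<in> points Q.N"
  shows "induced_action (points R) PP.pa g (fibre y) = fibre (Q.pa g y)"
proof -
  have gi: "inv\<^bsub>G\<^esub> g \<in> carrier G" using g by simp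
  have "PP.pa g ` fibre y = fibre (Q.pa g y)"
  proof (intro equalityI subsetI)
    fix q assume "q \<in> PP.pa g ` fibre y"
    then show "q \<in> fibre (Q.pa g y)"
      using g PP.pa_closed by (auto simp: fibre_def Phi_principal_act)
  next
    fix q assume "q \<in> fibre (Q.pa g y)"
    then have q: "q \<in> points P.N" "\<Phi> q = Q.pa g y" by (auto simp: fibre_def)
    let ?p = "PP.pa (inv\<^bsub>G\<^esub> g) q"
    have "?p \<in> fibre y"
      using Phi_principal_act[OF gi q(1)] PP.pa_closed[OF gi q(1)] Q.pa_inv(2)[OF g y] q(2)
      by (simp add: fibre_def)
    moreover have "PP.pa g ?p = q" using PP.pa_inv(1)[OF g q(1)] .
    ultimately show "q \<in> PP.pa g ` fibre y" by (intro image_eqI[of q _ ?p]) simp_all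
  qed
  then show ?thesis using y by (simp add: induced_action_def points_R)
qed

lemma equivariant_F:
  "equivariant G (points R) (induced_action (points R) PP.pa) Q.pa F"
  unfolding equivariant_def
proof (intro ballI)
  fix g c assume g: "g \<in> carrier G" and c: "c \<in> points R"
  then obtain y where y: "y \<in> points Q.N" "c = fibre y" by (auto simp: points_R)
  have "Q.pa g y \<in> points Q.N" using Q.pa_closed[OF g y(1)] .
  then show "F (induced_action (points R) PP.pa g c) = Q.pa g (F c)"
    using g y by (simp add: induced_fibre)
qed

text \<open>Conjugation by \<open>F\<close> and its inverse \<open>fibre\<close> turns the induced
  action into the patched action on \<open>M'\<close>, from which the group laws and smoothness are
  inherited.\<close>

lemma smooth_action_R: "smooth_action G \<G> R (induced_action (points R) PP.pa)"
proof -
  let ?a = "induced_action (points R) PP.pa"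
  have Fpt: "F c \<in> points Q.N" if "c \<in> points R" for c using smooth_map_in_points[OF smooth_F that] .
  have a: "?a g c = fibre (Q.pa g (F c))" if "g \<in> carrier G" "c \<in> points R" for g c
    using induced_fibre[OF that(1) Fpt[OF that(2)]] that(2) by simp
  have "group_action G (points R) ?a"
  proof (rule group_actionI[OF grp.is_group])
    show "?a g \<in> extensional (points R)" for g by (simp add: induced_action_def)
    show "?a g c \<in> points R" if "g \<in> carrier G" "c \<in> points R" for g c
      using that Q.pa_closed Fpt by (simp add: a fibre_points)
    show "?a \<one>\<^bsub>G\<^esub> c = c" if "c \<in> points R" for c
      using that Fpt by (simp add: a Q.pa_one)
    show "?a (g \<otimes>\<^bsub>G\<^esub> h) c = ?a g (?a h c)" if "g \<in> carrier G" "h \<in> carrier G" "c \<in> points R" for g h c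
    proof -
      have "fibre (Q.pa h (F c)) \<in> points R"
        using that Q.pa_closed Fpt by (simp add: fibre_points)
      then show ?thesis
        using that Q.pa_closed Fpt by (simp add: a Q.pa_mult)
    qed
  qed
  moreover have "smooth_map (product_manifold \<G> R) R (\<lambda>(g, c). ?a g c)"
  proof -
    note GR = smooth_premanifold_product[OF premanifold_G premanifold_R]
    have "smooth_map (product_manifold \<G> R) (product_manifold \<G> Q.N) (\<lambda>z. (fst z, F (snd z)))"
      by (rule smooth_map_Pair[OF GR premanifold_G Q.premanifold_N smooth_map_fst[OF premanifold_G premanifold_R]
            smooth_map_compose[OF GR premanifold_R Q.premanifold_N smooth_map_snd[OF premanifold_G premanifold_R] smooth_F]])
    moreover have "smooth_map (product_manifold \<G> Q.N) Q.N (\<lambda>(g, q). Q.pa g q)"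
      using Q.pa_smooth_action by (simp add: smooth_action_def)
    ultimately have "smooth_map (product_manifold \<G> R) Q.N (\<lambda>z. (\<lambda>(g, q). Q.pa g q) (fst z, F (snd z)))"
      by (rule smooth_map_compose[OF GR smooth_premanifold_product[OF premanifold_G Q.premanifold_N] Q.premanifold_N])
    from smooth_map_compose[OF GR Q.premanifold_N premanifold_R this smooth_fibre]
    show ?thesis
      by (rule smooth_map_cong[OF GR premanifold_R]) (auto simp: a)
  qed
  ultimately show ?thesis by (simp add: smooth_action_def)
qed

text \<open>The orbit map is \<open>\<Phi>\<close> followed by \<open>fibre\<close>, so a local
  section of \<open>\<Phi>\<close> preceded by \<open>F\<close> is a local section of the orbit
  map.\<close>

lemma submersion_orbit: "submersion P.N R (orbit G PS.pa)"
proof (rule submersionI[OF P.premanifold_N premanifold_R])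
  show "smooth_map P.N R (orbit G PS.pa)"
    by (rule smooth_map_cong[OF P.premanifold_N premanifold_R
          smooth_map_compose[OF P.premanifold_N Q.premanifold_N premanifold_R smooth_Phi smooth_fibre]])
      (simp add: star_orbit)
  fix p assume p: "p \<in> points P.N"
  obtain W \<sigma> where W: "openin (mtop Q.N) W" "\<Phi> p \<in> W" "smooth_map (open_submanifold Q.N W) P.N \<sigma>"
    "\<sigma> (\<Phi> p) = p" "\<forall>y\<in>W. \<Phi> (\<sigma> y) = y"
    using Phi_section[OF p] by auto
  define W' where "W' = {c \<in> points R. F c \<in> W}"
  have W': "openin (mtop R) W'"
    unfolding W'_def by (rule smooth_map_openin_preimage[OF smooth_F W(1)])
  note SR = smooth_premanifold_open_submanifold[OF premanifold_R W']
    and SQ = smooth_premanifold_open_submanifold[OF Q.premanifold_N W(1)]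
  have "smooth_map (open_submanifold R W') (open_submanifold Q.N W) F"
    by (rule smooth_map_restrict_codomain[OF SR Q.premanifold_N
          smooth_map_restrict_domain[OF premanifold_R Q.premanifold_N smooth_F W'] W(1)])
      (simp add: W'_def)
  from smooth_map_compose[OF SR SQ P.premanifold_N this W(3)]
  have "smooth_map (open_submanifold R W') P.N (\<lambda>c. \<sigma> (F c))" .
  moreover have "orbit G PS.pa p \<in> W'"
    using p W(2) Phi_points by (simp add: W'_def star_orbit points_R)
  moreover have "\<sigma> (F (orbit G PS.pa p)) = p"
    using p W(4) Phi_points by (simp add: star_orbit)
  moreover have "orbit G PS.pa (\<sigma> (F c)) = c" if "c \<in> W'" for c
  proof -
    have c: "c \<in> points R" "F c \<in> W" using that by (auto simp: W'_def)
    have "F c \<in> points Q.N" using smooth_map_in_points[OF smooth_F c(1)] .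
    then have "\<sigma> (F c) \<in> points P.N" using smooth_map_in_points[OF W(3)] c(2) by simp
    then show ?thesis using bspec[OF W(5) c(2)] c(1) by (simp add: star_orbit)
  qed
  ultimately show "\<exists>W \<sigma>. openin (mtop R) W \<and> orbit G PS.pa p \<in> W \<and>
      smooth_map (open_submanifold R W) P.N \<sigma> \<and> \<sigma> (orbit G PS.pa p) = p \<and>
      (\<forall>y\<in>W. orbit G PS.pa (\<sigma> y) = y)"
    using W' by (intro exI[of _ W'] exI[of _ "\<lambda>c. \<sigma> (F c)"]) blast
qed

section \<open>The orbit space of \<open>M\<close> and the Hausdorff property\<close>

lemma act_orbit_eq:
  assumes "g \<in> carrier G" "x \<in> points M"
  shows "orbit G act (act g x) = orbit G act x"
proof (intro equalityI subsetI)
  fix y assume "y \<in> orbit G act (act g x)"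
  then obtain h where "h \<in> carrier G" "y = act (h \<otimes>\<^bsub>G\<^esub> g) x"
    using assms by (auto simp: orbit_def act_mult)
  then show "y \<in> orbit G act x" using assms(1) by (auto simp: orbit_def)
next
  fix y assume "y \<in> orbit G act x"
  then obtain h where h: "h \<in> carrier G" "y = act h x" by (auto simp: orbit_def)
  then have "y = act (h \<otimes>\<^bsub>G\<^esub> inv\<^bsub>G\<^esub> g) (act g x)"
    using assms act_points by (simp add: act_mult)
  then show "y \<in> orbit G act (act g x)" using h(1) assms(1) by (auto simp: orbit_def)
qed

lemma act_orbit_self: "x \<in> points M \<Longrightarrow> x \<in> orbit G act x"
  using act_one grp.one_closed unfolding orbit_def by (metis (mono_tags, lifting) mem_Collect_eq)

lemma act_orbitD:
  assumes "y \<in> orbit G act x"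
  obtains g where "g \<in> carrier G" "y = act g x"
  using assms by (auto simp: orbit_def)

lemma act_orbits: "orbits G (points M) act = orbit G act ` points M"
  by (auto simp: orbits_def)

lemma disjoint_act_orbits: "disjoint (orbits G (points M) act)"
  unfolding disjoint_def act_orbits
proof (intro ballI impI)
  fix c d assume "c \<in> orbit G act ` points M" "d \<in> orbit G act ` points M" and ne: "c \<noteq> d"
  then obtain x y where xy: "x \<in> points M" "y \<in> points M" "c = orbit G act x" "d = orbit G act y" by auto
  have False if "z \<in> c" "z \<in> d" for z
    using that xy ne act_orbit_eq by (metis act_orbitD)
  then show "c \<inter> d = {}" by auto
qed

lemma orbits_Union: "\<Union>(orbits G (points M) act) = points M"
  using act_orbit_self act_points by (auto simp: act_orbits elim: act_orbitD)

lemma topspace_orbits: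
  "topspace (quotient_topology (mtop M) (orbits G (points M) act)) = orbits G (points M) act"
  by (rule topspace_quotient_topology[OF disjoint_act_orbits]) (simp add: orbits_Union)

lemma continuous_orbit:
  "continuous_map (mtop M) (quotient_topology (mtop M) (orbits G (points M) act)) (orbit G act)"
  unfolding continuous_map_def topspace_orbits
proof (intro conjI allI impI)
  show "orbit G act \<in> points M \<rightarrow> orbits G (points M) act" by (auto simp: act_orbits)
  fix \<U> assume "openin (quotient_topology (mtop M) (orbits G (points M) act)) \<U>"
  then have U: "\<U> \<subseteq> orbits G (points M) act" "openin (mtop M) (\<Union>\<U>)"
    by (auto simp: openin_quotient_topology[OF disjoint_act_orbits])
  have "{x \<in> points M. orbit G act x \<in> \<U>} = \<Union>\<U>"
  proof (intro equalityI subsetI)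
    fix x assume "x \<in> {x \<in> points M. orbit G act x \<in> \<U>}"
    then show "x \<in> \<Union>\<U>" using act_orbit_self by blast
  next
    fix x assume "x \<in> \<Union>\<U>"
    then obtain c where c: "c \<in> \<U>" "x \<in> c" by auto
    then obtain y where y: "y \<in> points M" "c = orbit G act y" using U(1) by (auto simp: act_orbits)
    then obtain g where "g \<in> carrier G" "x = act g y" using act_orbitD[of x y] c(2) by blast
    then have "x \<in> points M" "orbit G act x = c"
      using y by (simp_all add: act_orbit_eq act_points)
    then show "x \<in> {x \<in> points M. orbit G act x \<in> \<U>}" using c(1) by simp
  qed
  then show "openin (mtop M) {x \<in> points M. orbit G act x \<in> \<U>}" using U(2) by simp
qed

lemma Hausdorff_Q:
  assumes H: "Hausdorff_space (quotient_topology (mtop M) (orbits G (points M) act))"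
  shows "Hausdorff_space (mtop Q.N)"
proof -
  define h where "h = (\<lambda>q::('i \<times> 'm) set. orbit G act (snd (SOME z. z \<in> q)))"
  have h: "h (Q.cls i x) = orbit G act x" if "i \<in> I" "x \<in> U i" for i x
  proof -
    obtain j y where z: "(SOME z. z \<in> Q.cls i x) = (j, y)" by (rule prod.exhaust)
    have "\<exists>z. z \<in> Q.cls i x" using Q.cls_self[of i x] that by auto
    then have "(SOME z. z \<in> Q.cls i x) \<in> Q.cls i x" by (rule someI_ex)
    then have "(j, y) \<in> Q.cls i x" by (simp only: z)
    then have "j \<in> I" "x \<in> U j" "y = act (\<phi> i j x) x"
      using Q.mem_cls[of i x j y] that by (auto simp: adjoint_map_def)
    then show ?thesis using that phi_carrier U_points by (simp add: h_def z act_orbit_eq)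
  qed
  show ?thesis
  proof (rule Q.Hausdorff_glue[OF H, of h])
    show "continuous_map (mtop Q.N) (quotient_topology (mtop M) (orbits G (points M) act)) h"
    proof (rule Q.continuous_map_from_glue)
      fix i assume i: "i \<in> I"
      have "continuous_map (mtop (XM i)) (quotient_topology (mtop M) (orbits G (points M) act)) (orbit G act)"
        using continuous_map_from_subtopology[OF continuous_orbit] by (simp add: mtop_open_submanifold)
      then show "continuous_map (mtop (XM i)) (quotient_topology (mtop M) (orbits G (points M) act))
          (\<lambda>x. h (Q.cls i x))"
        by (rule continuous_map_eq) (use i h in auto)
    qed
    show "Hausdorff_space (mtop (XM i))" if "i \<in> I" for i
      using Hausdorff_M by (simp add: mtop_open_submanifold Hausdorff_space_subtopology)
    fix i j x y assume ij: "i \<in> I" "j \<in> I" "x \<in> points (XM i)" "y \<in> points (XM j)"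
      "h (Q.cls i x) = h (Q.cls j y)"
    then have xy: "x \<in> U i" "y \<in> U j" by auto
    then have "orbit G act x = orbit G act y" using ij h by simp
    then have "y \<in> orbit G act x" using act_orbit_self U_points[OF ij(2) xy(2)] by simp
    \<comment> \<open>The piece \<open>U i\<close> is invariant, so it contains the whole orbit of
      \<open>x\<close>; this is the overlap condition of \<open>Hausdorff_glue\<close>.\<close>
    then obtain g where "g \<in> carrier G" "y = act g x" using act_orbitD by blast
    then show "y \<in> U j \<inter> U i" using U_act ij(1) xy by simp
  qed
qed

text \<open>The union of the orbits that meet \<open>W\<close> is the union of all translates of
  \<open>W\<close>, each of them open as the preimage of \<open>W\<close> under a group
  element.\<close>

lemma open_saturation:
  assumes W: "openin (mtop M) W"
  shows "openin (quotient_topology (mtop M) (orbits G (points M) act)) (orbit G act ` W)"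
  unfolding openin_quotient_topology[OF disjoint_act_orbits]
proof
  have sub: "W \<subseteq> points M" using W by (rule openin_subset)
  then show "orbit G act ` W \<subseteq> orbits G (points M) act" by (auto simp: act_orbits)
  have "\<Union>(orbit G act ` W) = (\<Union>g\<in>carrier G. {x \<in> points M. act g x \<in> W})"
  proof (intro equalityI subsetI)
    fix x assume "x \<in> \<Union>(orbit G act ` W)"
    then obtain y g where y: "y \<in> W" "g \<in> carrier G" "x = act g y" by (auto simp: orbit_def)
    then have "x \<in> points M" "act (inv\<^bsub>G\<^esub> g) x \<in> W" using sub act_points by auto
    then show "x \<in> (\<Union>g\<in>carrier G. {x \<in> points M. act g x \<in> W})" using y(2) grp.inv_closed by blast
  next
    fix x assume "x \<in> (\<Union>g\<in>carrier G. {x \<in> points M. act g x \<in> W})"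
    then obtain g where g: "g \<in> carrier G" "x \<in> points M" "act g x \<in> W" by auto
    then have "x \<in> orbit G act (act g x)" using act_orbit_eq act_orbit_self by simp
    then show "x \<in> \<Union>(orbit G act ` W)" using g(3) by blast
  qed
  moreover have "openin (mtop M) {x \<in> points M. act g x \<in> W}" if "g \<in> carrier G" for g
  proof (rule smooth_map_openin_preimage[OF _ W])
    show "smooth_map M M (act g)"
      by (rule smooth_act[OF premanifold_M smooth_map_const[OF premanifold_M premanifold_G] smooth_map_id[OF premanifold_M]])
        (use that in simp)
  qed
  ultimately show "openin (mtop M) (\<Union>(orbit G act ` W))" by auto
qed

text \<open>A tube argument over the compact group. For each \<open>g\<close> the points
  \<open>g x\<close> and \<open>y\<close> are separated, and by continuity this persists for
  elements near \<open>g\<close> and points near \<open>x\<close>. Finitely many such neighbourhoods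
  cover \<open>G\<close>; intersecting the corresponding neighbourhoods of \<open>x\<close> and of
  \<open>y\<close> gives sets that no group element connects, and their saturations separate the
  orbits.\<close>

lemma Hausdorff_orbits_compact:
  assumes compact: "compact_space (mtop \<G>)"
  shows "Hausdorff_space (quotient_topology (mtop M) (orbits G (points M) act))"
  unfolding Hausdorff_space_def topspace_orbits
proof (intro allI impI)
  fix c d assume cd: "c \<in> orbits G (points M) act \<and> d \<in> orbits G (points M) act \<and> c \<noteq> d"
  then obtain x y where x: "x \<in> points M" "c = orbit G act x" and y: "y \<in> points M" "d = orbit G act y"
    by (auto simp: act_orbits)
  define separates where "separates = (\<lambda>g K S T. openin (mtop \<G>) K \<and> openin (mtop M) S \<and>
    openin (mtop M) T \<and> g \<in> K \<and> x \<in> S \<and> y \<in> T \<and> (\<forall>h\<in>K. \<forall>z\<in>S. act h z \<notin> T))"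
  have "\<exists>K S T. separates g K S T" if g: "g \<in> carrier G" for g
  proof -
    have "act g x \<noteq> y" using act_orbit_eq[OF g x(1)] cd x y by auto
    then obtain A T where AT: "openin (mtop M) A" "openin (mtop M) T" "act g x \<in> A" "y \<in> T" "disjnt A T"
      using Hausdorff_M[unfolded Hausdorff_space_def, rule_format, of "act g x" y]
        act_points[OF g x(1)] y(1) by auto
    have "openin (prod_topology (mtop \<G>) (mtop M)) {z \<in> carrier G \<times> points M. (case z of (g, x) \<Rightarrow> act g x) \<in> A}"
      using smooth_map_openin_preimage[OF smooth_act_M AT(1)] by (simp add: mtop_product_manifold)
    moreover have "(g, x) \<in> {z \<in> carrier G \<times> points M. (case z of (g, x) \<Rightarrow> act g x) \<in> A}"
      using g x(1) AT(3) by simp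
    ultimately obtain K S where KS: "openin (mtop \<G>) K" "openin (mtop M) S" "g \<in> K" "x \<in> S"
      "K \<times> S \<subseteq> {z \<in> carrier G \<times> points M. (case z of (g, x) \<Rightarrow> act g x) \<in> A}"
      unfolding openin_prod_topology_alt by meson
    then have "\<forall>h\<in>K. \<forall>z\<in>S. act h z \<notin> T" using AT(5) by (fastforce simp: disjnt_iff)
    then show ?thesis using KS AT unfolding separates_def by blast
  qed
  then obtain K S T where KST: "\<And>g. g \<in> carrier G \<Longrightarrow> separates g (K g) (S g) (T g)"
    by metis
  then have K: "\<And>g. g \<in> carrier G \<Longrightarrow> openin (mtop \<G>) (K g)"
    and S: "\<And>g. g \<in> carrier G \<Longrightarrow> openin (mtop M) (S g)" and T: "\<And>g. g \<in> carrier G \<Longrightarrow> openin (mtop M) (T g)"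
    and mem: "\<And>g. g \<in> carrier G \<Longrightarrow> g \<in> K g" "\<And>g. g \<in> carrier G \<Longrightarrow> x \<in> S g"
      "\<And>g. g \<in> carrier G \<Longrightarrow> y \<in> T g"
    and sep: "\<And>g h z. g \<in> carrier G \<Longrightarrow> h \<in> K g \<Longrightarrow> z \<in> S g \<Longrightarrow> act h z \<notin> T g"
    unfolding separates_def by simp_all
  have "\<Union>(K ` carrier G) = points \<G>"
    using mem(1) K[THEN openin_subset] by fastforce
  moreover have "\<forall>C\<in>K ` carrier G. openin (mtop \<G>) C" using K by auto
  ultimately obtain \<F> where "finite \<F>" "\<F> \<subseteq> K ` carrier G" "points \<G> \<subseteq> \<Union>\<F>"
    using compact unfolding compact_space_alt by (metis order_refl)
  then obtain B where B: "finite B" "B \<subseteq> carrier G" "carrier G \<subseteq> \<Union>(K ` B)"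
    using finite_subset_image[of \<F> K "carrier G"] by auto
  \<comment> \<open>The intersection over an empty index set would be \<open>UNIV\<close>, which
    need not be an open subset of \<open>M\<close>; the unit of \<open>G\<close> guarantees a member
    of \<open>B\<close>.\<close>
  have ne: "B \<noteq> {}" using B(3) grp.one_closed by auto
  define S0 where "S0 = (\<Inter>g\<in>B. S g)"
  define T0 where "T0 = (\<Inter>g\<in>B. T g)"
  have op: "openin (mtop M) S0" "openin (mtop M) T0"
    using B(1,2) ne S T unfolding S0_def T0_def by (auto intro!: openin_Inter)
  have sub: "S0 \<subseteq> points M" "T0 \<subseteq> points M" using op by (auto dest: openin_subset)
  have "disjnt (orbit G act ` S0) (orbit G act ` T0)"
  proof -
    have False if uv: "u \<in> S0" "v \<in> T0" "orbit G act u = orbit G act v" for u v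
    proof -
      have "v \<in> orbit G act u" using uv sub act_orbit_self by auto
      then obtain h where h: "h \<in> carrier G" "v = act h u" using act_orbitD by blast
      then obtain g where "g \<in> B" "h \<in> K g" using B(3) by auto
      then show False using sep[of g h u] uv h B(2) by (auto simp: S0_def T0_def)
    qed
    then show ?thesis by (fastforce simp: disjnt_iff)
  qed
  moreover have "x \<in> S0" "y \<in> T0" using mem B(2) by (auto simp: S0_def T0_def)
  then have "c \<in> orbit G act ` S0" "d \<in> orbit G act ` T0" using x(2) y(2) by simp_all
  ultimately show "\<exists>V W. openin (quotient_topology (mtop M) (orbits G (points M) act)) V \<and>
      openin (quotient_topology (mtop M) (orbits G (points M) act)) W \<and> c \<in> V \<and> d \<in> W \<and> disjnt V W"
    using open_saturation[OF op(1)] open_saturation[OF op(2)] by blast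
qed

lemma manifold_R:
  assumes "compact_space (mtop \<G>) \<or> Hausdorff_space (quotient_topology (mtop M) (orbits G (points M) act))"
  shows "smooth_manifold R"
proof -
  have "Hausdorff_space (mtop Q.N)" using assms Hausdorff_orbits_compact Hausdorff_Q by blast
  moreover have "mtop R homeomorphic_space mtop Q.N" using homeo_F homeomorphic_space_def by blast
  ultimately have "Hausdorff_space (mtop R)" using homeomorphic_Hausdorff_space by blast
  then show ?thesis using premanifold_R by (simp add: smooth_manifold_def)
qed

end

text \<open>The quotient topology brings no charts with it, hence the existentially quantified
  atlas; the submersion clause determines the smooth structure that this atlas generates. The last
  clause isolates the Hausdorff property, the only part of being a \<open>G\<close>-manifold that
  the gluing can destroy.\<close>

theorem theorem2p1:
  fixes G :: "'g monoid"
    and \<G> :: "('g, 'f::real_normed_vector) smooth_space"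
    and M :: "('m, 'e::real_normed_vector) smooth_space"
    and act :: "'g \<Rightarrow> 'm \<Rightarrow> 'm"
    and I :: "'i set"
    and U :: "'i \<Rightarrow> 'm set"
    and \<phi> :: "'i \<Rightarrow> 'i \<Rightarrow> 'm \<Rightarrow> 'g"
  assumes "lie_group G \<G>"
    and "G_manifold G \<G> M act"
    and "invariant_open_cover G M act I U"
    and "star_collection G \<G> M act I U \<phi>"
  shows
    "let P = star_bundle G \<G> M I U \<phi>;
         pact = star_principal_action G (points P);
         M' = star_space M act I U \<phi>;
         act' = patched_action (points M') act
     in principal_bundle G \<G> P M star_proj pact \<and>
        G_premanifold G \<G> M' act' \<and>
        (\<exists>star :: 'g \<Rightarrow> ('i \<times> 'm \<times> 'g) set \<Rightarrow> ('i \<times> 'm \<times> 'g) set.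
           smooth_action G \<G> P star \<and>
           free_action G (points P) star \<and>
           (\<forall>g\<in>carrier G. \<forall>s\<in>carrier G. \<forall>p\<in>points P. star g (pact s p) = pact s (star g p)) \<and>
           (\<exists>A :: (('i \<times> 'm \<times> 'g) set set set \<times> (('i \<times> 'm \<times> 'g) set set \<Rightarrow> 'e)) set.
              let Q = \<lparr>mtop = quotient_topology (mtop P) (orbits G (points P) star), charts = A\<rparr>;
                  qact = induced_action (points Q) pact
              in G_premanifold G \<G> Q qact \<and>
                 submersion P Q (orbit G star) \<and>
                 (\<exists>F. diffeomorphism Q M' F \<and> equivariant G (points Q) qact act' F) \<and>
                 (compact_space (mtop \<G>) \<or>
                    Hausdorff_space (quotient_topology (mtop M) (orbits G (points M) act)) \<longrightarrow>
                  G_manifold G \<G> Q qact)))"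
proof -
  interpret star_gluing G \<G> M act I U \<phi>
    by (rule star_gluing.intro[OF assms])
  have P: "star_bundle G \<G> M I U \<phi> = P.N" by (simp add: star_bundle_def)
  have M': "star_space M act I U \<phi> = Q.N" by (simp add: star_space_def)
  have pact: "star_principal_action G (points P.N) = PP.pa" by (simp add: star_principal_action_def)
  let ?A = "transport_charts (orbits G (points P.N) PS.pa) F (charts Q.N)"
  have R: "\<lparr>mtop = quotient_topology (mtop P.N) (orbits G (points P.N) PS.pa), charts = ?A\<rparr> = R"
    by (simp add: R_def)
  have B: "G_premanifold G \<G> R (induced_action (points R) PP.pa) \<and>
      submersion P.N R (orbit G PS.pa) \<and>
      (\<exists>F. diffeomorphism R Q.N F \<and> equivariant G (points R) (induced_action (points R) PP.pa) Q.pa F) \<and>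
      (compact_space (mtop \<G>) \<or>
         Hausdorff_space (quotient_topology (mtop M) (orbits G (points M) act)) \<longrightarrow>
       G_manifold G \<G> R (induced_action (points R) PP.pa))"
    using premanifold_R smooth_action_R submersion_orbit diffeomorphism_F equivariant_F manifold_R
    unfolding G_premanifold_def G_manifold_def by blast
  \<comment> \<open>The record in the \<open>let\<close> has to be recognised as \<open>R\<close>
    before \<open>B\<close> applies, so the witness is supplied explicitly and the
    \<open>let\<close> is unfolded.\<close>
  have A: "\<exists>A :: (('i \<times> 'm \<times> 'g) set set set \<times> (('i \<times> 'm \<times> 'g) set set \<Rightarrow> 'e)) set.
      let Q = \<lparr>mtop = quotient_topology (mtop P.N) (orbits G (points P.N) PS.pa), charts = A\<rparr>;
        qact = induced_action (points Q) PP.pa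
      in G_premanifold G \<G> Q qact \<and>
         submersion P.N Q (orbit G PS.pa) \<and>
         (\<exists>F. diffeomorphism Q Q.N F \<and> equivariant G (points Q) qact Q.pa F) \<and>
         (compact_space (mtop \<G>) \<or>
            Hausdorff_space (quotient_topology (mtop M) (orbits G (points M) act)) \<longrightarrow>
          G_manifold G \<G> Q qact)"
    by (intro exI[of _ ?A], unfold Let_def R, rule B)
  have "G_premanifold G \<G> Q.N Q.pa"
    using Q.premanifold_N Q.pa_smooth_action by (simp add: G_premanifold_def)
  with A show ?thesis
    unfolding P M' Let_def[of "P.N"] Let_def[of "Q.N"] pact Let_def[of PP.pa] Let_def[of Q.pa]
    using principal_bundle_P PS.pa_smooth_action star_act_free star_act_commutes
    by (intro conjI exI[of _ PS.pa] ballI) blast+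
qed

end
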